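(* Let $G = P_n \times P_3$ with $r \geq 2$ and $n \geq 3$. The following are equivalent: (1) $\Sigma_r(G)$ is vertex decomposable; (2) $\Sigma_r(G)$ is shellable; (3) $\Sigma_r(G)$ is Cohen–Macaulay (over a field $\mathbb K$); (4) $2n \le r$; (5) the clutter $\mathrm{Con}_r(G)$ is co-chordal.
   Context: $P_n$ is the path on $n$ vertices and $\times$ is the Cartesian product of graphs (vertices $(x,y)$, with $(x,y)\sim(a,b)$ iff $x=a$ and $y\sim b$, or $y=b$ and $x\sim a$). $\mathrm{Con}_r(G)$ is the $r$-uniform clutter on $V(G)$ whose circuits are the $r$-subsets $W$ with $G[W]$ connected; $\Sigma_r(G)$ is the simplicial complex generated by $V(G)\setminus W$ for such $W$. A $d$-uniform clutter is chordal if it has no circuits or has a $(d-1)$-set $Z$ whose closed neighborhood $Z\cup\{x\notin Z: x\in\mathcal E\subseteq Z\cup\{x\}\text{ for a circuit }\mathcal E\}$ is a clique (all $d$-subsets are circuits) and such that deleting all circuits containing $Z$ leaves a chordal clutter; co-chordal means the complement clutter is chordal. Vertex decomposable, shellable, Cohen–Macaulay: standard. *)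

theory Defs
  imports
    "HOL-Library.Extended_Nat"
    "HOL-Library.Poly_Mapping"
    "HOL-Algebra.QuotRing"
begin

section \<open>Graphs\<close>

record 'a ugraph =
  verts :: "'a set"
  adj :: "'a \<Rightarrow> 'a \<Rightarrow> bool"

definition path_graph :: "nat \<Rightarrow> nat ugraph" where
  "path_graph n = \<lparr>verts = {1..n},
     adj = (\<lambda>i j. i \<in> {1..n} \<and> j \<in> {1..n} \<and> (j = i + 1 \<or> i = j + 1))\<rparr>"

definition cartesian_product :: "'a ugraph \<Rightarrow> 'b ugraph \<Rightarrow> ('a \<times> 'b) ugraph" where
  "cartesian_product G H = \<lparr>verts = verts G \<times> verts H,
     adj = (\<lambda>(x, y) (a, b). x \<in> verts G \<and> a \<in> verts G \<and> y \<in> verts H \<and> b \<in> verts H \<and>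
              (x = a \<and> adj H y b \<or> y = b \<and> adj G x a))\<rparr>"

text \<open>Connectedness of the induced subgraph on \<open>W\<close>; the graph without vertices is not connected.\<close>

definition connected_on :: "'a ugraph \<Rightarrow> 'a set \<Rightarrow> bool" where
  "connected_on G W \<longleftrightarrow> W \<noteq> {} \<and>
     (\<forall>x\<in>W. \<forall>y\<in>W. (x, y) \<in> {(a, b). a \<in> W \<and> b \<in> W \<and> adj G a b}\<^sup>*)"


section \<open>Uniform clutters\<close>

text \<open>A \<open>d\<close>-uniform clutter on \<open>V\<close> is given by its set \<open>C\<close> of circuits, together with \<open>V\<close> and \<open>d\<close>.\<close>

definition Con :: "nat \<Rightarrow> 'a ugraph \<Rightarrow> 'a set set" where
  "Con r G = {W. W \<subseteq> verts G \<and> card W = r \<and> connected_on G W}"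

definition complement_clutter :: "'a set \<Rightarrow> nat \<Rightarrow> 'a set set \<Rightarrow> 'a set set" where
  "complement_clutter V d C = {W. W \<subseteq> V \<and> card W = d} - C"

definition closed_nbhd :: "'a set set \<Rightarrow> 'a set \<Rightarrow> 'a set" where
  "closed_nbhd C Z = Z \<union> {x. x \<notin> Z \<and> (\<exists>\<E>\<in>C. x \<in> \<E> \<and> \<E> \<subseteq> insert x Z)}"

definition is_clique :: "nat \<Rightarrow> 'a set set \<Rightarrow> 'a set \<Rightarrow> bool" where
  "is_clique d C K \<longleftrightarrow> (\<forall>W. W \<subseteq> K \<and> card W = d \<longrightarrow> W \<in> C)"

inductive chordal_clutter :: "'a set \<Rightarrow> nat \<Rightarrow> 'a set set \<Rightarrow> bool" for V d where
  no_circuits: "chordal_clutter V d {}"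
| delete: "\<lbrakk>Z \<subseteq> V; card Z = d - 1; is_clique d C (closed_nbhd C Z);
            chordal_clutter V d {\<E> \<in> C. \<not> Z \<subseteq> \<E>}\<rbrakk> \<Longrightarrow> chordal_clutter V d C"

definition co_chordal_clutter :: "'a set \<Rightarrow> nat \<Rightarrow> 'a set set \<Rightarrow> bool" where
  "co_chordal_clutter V d C \<longleftrightarrow> chordal_clutter V d (complement_clutter V d C)"


section \<open>Simplicial complexes\<close>

text \<open>
  A simplicial complex is the set of its faces. The complex \<open>{}\<close> without any face (the one
  generated by no facet) is admitted. It is a degenerate case distinct from \<open>{{}}\<close>, and by the
  usual convention it is vertex decomposable, shellable and Cohen--Macaulay.
\<close>

definition generated_complex :: "'a set set \<Rightarrow> 'a set set" where
  "generated_complex \<F> = {F. \<exists>H\<in>\<F>. F \<subseteq> H}"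

definition facets :: "'a set set \<Rightarrow> 'a set set" where
  "facets \<Delta> = {F \<in> \<Delta>. \<forall>H\<in>\<Delta>. F \<subseteq> H \<longrightarrow> F = H}"

definition Sigma_complex :: "nat \<Rightarrow> 'a ugraph \<Rightarrow> 'a set set" where
  "Sigma_complex r G = generated_complex {verts G - W | W. W \<in> Con r G}"

definition link :: "'a set set \<Rightarrow> 'a \<Rightarrow> 'a set set" where
  "link \<Delta> v = {F. v \<notin> F \<and> insert v F \<in> \<Delta>}"

definition deletion :: "'a set set \<Rightarrow> 'a \<Rightarrow> 'a set set" where
  "deletion \<Delta> v = {F \<in> \<Delta>. v \<notin> F}"

text \<open>
  Vertex decomposability in the sense of Bjoerner and Wachs; for pure complexes, such as those
  generated by sets of one fixed size, this is the notion of Provan and Billera.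
\<close>

inductive vertex_decomposable :: "'a set set \<Rightarrow> bool" where
  void: "vertex_decomposable {}"
| simplex: "finite F \<Longrightarrow> vertex_decomposable (Pow F)"
| shed: "\<lbrakk>{v} \<in> \<Delta>; vertex_decomposable (link \<Delta> v); vertex_decomposable (deletion \<Delta> v);
          facets (deletion \<Delta> v) \<subseteq> facets \<Delta>\<rbrakk> \<Longrightarrow> vertex_decomposable \<Delta>"

text \<open>The intersection of each later facet with the complex generated by the earlier ones is
  pure of codimension one in that facet.\<close>

definition shelling :: "'a set set \<Rightarrow> 'a set list \<Rightarrow> bool" where
  "shelling \<Delta> Fs \<longleftrightarrow> distinct Fs \<and> set Fs = facets \<Delta> \<and>
     (\<forall>j. 0 < j \<and> j < length Fs \<longrightarrow>
        (\<forall>H \<in> facets (Pow (Fs ! j) \<inter> generated_complex (set (take j Fs))).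
           card H + 1 = card (Fs ! j)))"

definition shellable :: "'a set set \<Rightarrow> bool" where
  "shellable \<Delta> \<longleftrightarrow> (\<exists>Fs. shelling \<Delta> Fs)"


section \<open>Krull dimension and depth\<close>

definition krull_dim :: "('a, 'b) ring_scheme \<Rightarrow> enat" where
  "krull_dim R = Sup {enat n | n. \<exists>P :: nat \<Rightarrow> 'a set.
     (\<forall>i\<le>n. primeideal (P i) R) \<and> (\<forall>i<n. P i \<subset> P (Suc i))}"

definition regular_sequence :: "('a, 'b) ring_scheme \<Rightarrow> 'a list \<Rightarrow> bool" where
  "regular_sequence R xs \<longleftrightarrow> set xs \<subseteq> carrier R \<and>
     (\<forall>i<length xs. \<forall>y\<in>carrier R.
        xs ! i \<otimes>\<^bsub>R\<^esub> y \<in> genideal R (set (take i xs)) \<longrightarrow> y \<in> genideal R (set (take i xs))) \<and>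
     genideal R (set xs) \<noteq> carrier R"

definition depth :: "('a, 'b) ring_scheme \<Rightarrow> 'a set \<Rightarrow> enat" where
  "depth R I = Sup {enat (length xs) | xs. regular_sequence R xs \<and> set xs \<subseteq> I}"


section \<open>Cohen--Macaulay complexes\<close>

text \<open>
  Polynomials with coefficients in \<open>'k\<close> are finitely supported maps from exponent vectors
  (finitely supported maps \<open>'a \<Rightarrow>\<^sub>0 nat\<close>) to \<open>'k\<close>; only variables from \<open>V\<close> are allowed.
\<close>

definition poly_ring :: "'a set \<Rightarrow> (('a \<Rightarrow>\<^sub>0 nat) \<Rightarrow>\<^sub>0 'k::field) ring" where
  "poly_ring V = \<lparr>carrier = {p. \<forall>m\<in>Poly_Mapping.keys p. Poly_Mapping.keys m \<subseteq> V},
     monoid.mult = (*), one = 1, zero = 0, add = (+)\<rparr>"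

definition var :: "'a \<Rightarrow> ('a \<Rightarrow>\<^sub>0 nat) \<Rightarrow>\<^sub>0 'k::field" where
  "var v = Poly_Mapping.single (Poly_Mapping.single v 1) 1"

definition stanley_reisner_ideal :: "'a set \<Rightarrow> 'a set set \<Rightarrow> (('a \<Rightarrow>\<^sub>0 nat) \<Rightarrow>\<^sub>0 'k::field) set" where
  "stanley_reisner_ideal V \<Delta> =
     genideal (poly_ring V) {\<Prod>v\<in>F. var v | F. F \<subseteq> V \<and> finite F \<and> F \<notin> \<Delta>}"

definition stanley_reisner_ring ::
    "'a set \<Rightarrow> 'a set set \<Rightarrow> (('a \<Rightarrow>\<^sub>0 nat) \<Rightarrow>\<^sub>0 'k::field) set ring" where
  "stanley_reisner_ring V \<Delta> = poly_ring V Quot stanley_reisner_ideal V \<Delta>"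

definition irrelevant_ideal ::
    "'a set \<Rightarrow> 'a set set \<Rightarrow> (('a \<Rightarrow>\<^sub>0 nat) \<Rightarrow>\<^sub>0 'k::field) set set" where
  "irrelevant_ideal V \<Delta> = genideal (stanley_reisner_ring V \<Delta>)
     {stanley_reisner_ideal V \<Delta> +>\<^bsub>poly_ring V\<^esub> var v | v. v \<in> V}"

text \<open>
  A complex \<open>\<Delta>\<close> on the finite vertex set \<open>V\<close> is Cohen--Macaulay over \<open>'k\<close> if its Stanley--Reisner
  ring is. As this is a standard graded algebra, this means that its depth (with respect to the
  irrelevant ideal) equals its Krull dimension. For \<open>\<Delta> = {}\<close> the ring is zero, there are neither
  prime ideals nor regular sequences, and both sides are \<open>Sup {} = 0\<close>.
\<close>

definition cohen_macaulay_complex :: "'k::field itself \<Rightarrow> 'a set \<Rightarrow> 'a set set \<Rightarrow> bool" where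
  "cohen_macaulay_complex K V \<Delta> \<longleftrightarrow>
     depth (stanley_reisner_ring V \<Delta> :: (('a \<Rightarrow>\<^sub>0 nat) \<Rightarrow>\<^sub>0 'k) set ring) (irrelevant_ideal V \<Delta>) =
     krull_dim (stanley_reisner_ring V \<Delta> :: (('a \<Rightarrow>\<^sub>0 nat) \<Rightarrow>\<^sub>0 'k) set ring)"

end

theory Submission
  imports Defs "HOL-Library.Product_Lexorder"
begin

text \<open>
  Let \<open>2 n \<le> r\<close>. Connected sets containing a fixed connected set \<open>A\<close> can always be shed at a
  neighbour of \<open>A\<close>, and a vertex adjacent to every connected \<open>r\<close>-set that avoids it is a shedding
  vertex of \<open>Con\<^sub>r\<close>. Removing the middle row from its centre outwards keeps every such vertex in
  this situation, until only two rows with \<open>n < r\<close> vertices each are left. A shedding order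
  yields vertex decomposability, and co-chordality by first eliminating all circuits through the
  shedding vertex.

  Let \<open>r < 2 n\<close>. Some link of \<open>\<Sigma>\<^sub>r\<close> has a nonzero reduced cohomology class below its top degree:
  for \<open>r \<le> n\<close> the link belonging to the union of two connected \<open>r\<close>-sets in the outer rows is
  disconnected, and for \<open>n < r\<close> the link belonging to the boundary cycle of length \<open>2 n + 2\<close> carries the
  winding number cocycle. Cocycles extend along the elimination of circuits of a chordal clutter,
  so the complement clutter is not chordal; and the class survives in the Koszul cohomology of the
  Stanley--Reisner ring, so its depth is too small.

  In a shellable complex the elementary symmetric polynomials form a regular sequence, by
  filtering along the shelling and passing from each facet to its boundary. Both the Krull dimension
  and the depth are bounded by the facet size, because longer sequences of elements are
  algebraically dependent, while chains of primes and regular sequences give independent elements.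
\<close>

section \<open>Cochains and chordal clutters\<close>

text \<open>The threshold \<open>2 * n\<close> is where the class on the boundary cycle reaches the
  top degree: that cycle has \<open>2 * n + 2\<close> vertices, so the facets of its link have
  \<open>2 * n + 2 - r\<close> elements, and a class on edges lies below them exactly when
  \<open>r < 2 * n\<close>. The two outer rows give a class on single vertices against facets with
  \<open>r\<close> elements, which is where \<open>r \<ge> 2\<close> enters. The predicate
  \<open>obstruction\<close> records such a class in purely simplicial terms, so the same class
  contradicts chordality and the Cohen-Macaulay property. For chordality the point is that deleting
  circuits only adds faces, ending with a full skeleton of a simplex, which has no cohomology below
  its top. For depth the obstacle is that the class belongs to a link and not to the whole complex;
  taking squares of the variables outside the link as Koszul parameters makes these directions
  invisible in squarefree degrees, so no localization is required. Elementary symmetric polynomials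
  are chosen as parameters because they work over every field, also over finite ones, where suitable
  linear forms may not exist.\<close>

abbreviation pos_sign :: "('a \<Rightarrow> nat) \<Rightarrow> 'a \<Rightarrow> 'a set \<Rightarrow> 'r::comm_ring_1" where
  "pos_sign pos t T \<equiv> (-1) ^ card {u \<in> T. pos u < pos t}"

lemma pos_sign_remove:
  assumes "finite T" "u \<in> T" "pos u < pos t"
  shows "pos_sign pos u (T - {t}) = (pos_sign pos u T :: 'r::comm_ring_1)"
    "pos_sign pos t T = - (pos_sign pos t (T - {u}) :: 'r)"
proof -
  have "{w \<in> T - {t}. pos w < pos u} = {w \<in> T. pos w < pos u}" using assms by auto
  then show "pos_sign pos u (T - {t}) = (pos_sign pos u T :: 'r)" by simp
  have "{w \<in> T. pos w < pos t} = insert u {w \<in> T - {u}. pos w < pos t}" using assms by auto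
  then have "card {w \<in> T. pos w < pos t} = Suc (card {w \<in> T - {u}. pos w < pos t})"
    using assms(1) by simp
  then show "pos_sign pos t T = - (pos_sign pos t (T - {u}) :: 'r)" by simp
qed

text \<open>Constant weights \<open>y = 1\<close> give the simplicial coboundary, ring elements as
  weights the Koszul differential of the family \<open>y\<close>. Sharing one operator allows a
  simplicial class to be carried into a Koszul complex.\<close>

definition cobd :: "('a \<Rightarrow> nat) \<Rightarrow> ('a \<Rightarrow> 'r::comm_ring_1) \<Rightarrow> ('a set \<Rightarrow> 'r) \<Rightarrow> 'a set \<Rightarrow> 'r" where
  "cobd pos y h T = (\<Sum>t\<in>T. pos_sign pos t T * y t * h (T - {t}))"

lemma cobd_cong:
  assumes "\<And>t. t \<in> T \<Longrightarrow> h (T - {t}) = h' (T - {t})"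
  shows "cobd pos y h T = cobd pos y h' T"
  unfolding cobd_def using assms by (intro sum.cong) auto

lemma cobd_diff: "cobd pos y (\<lambda>A. h A - h' A) T = cobd pos y h T - cobd pos y h' T"
  unfolding cobd_def by (simp add: algebra_simps sum_subtractf)

lemma cobd_add: "cobd pos y (\<lambda>A. h A + h' A) T = cobd pos y h T + cobd pos y h' T"
  unfolding cobd_def by (simp add: algebra_simps sum.distrib)

lemma cobd_mult: "cobd pos y (\<lambda>A. c * h A) T = c * cobd pos y h T"
  unfolding cobd_def by (simp add: sum_distrib_left mult_ac)

lemma cobd_insert:
  assumes "finite T" "x \<notin> T"
  shows "cobd pos y h (insert x T) = pos_sign pos x (insert x T) * y x * h T
    + (\<Sum>t\<in>T. pos_sign pos t (insert x T) * y t * h (insert x T - {t}))"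
  unfolding cobd_def using assms by (simp add: insert_Diff_if)

text \<open>Removing \<open>t\<close> and \<open>u\<close> in the two possible orders gives opposite
  signs: taking out the smaller vertex shifts the sign of the larger one, but not
  conversely.\<close>

lemma cobd_cobd:
  assumes fin: "finite T" and inj: "inj_on pos T"
  shows "cobd pos y (cobd pos y h) T = 0"
proof -
  define a where "a t u = pos_sign pos t T * y t *
     (pos_sign pos u (T - {t}) * y u * h (T - {t} - {u}))" for t u
  have anti: "a u t = - a t u" if "t \<in> T" "u \<in> T" "pos u < pos t" for t u
  proof -
    have swap: "T - {t} - {u} = T - {u} - {t}" by auto
    show ?thesis
      unfolding a_def swap pos_sign_remove(1)[OF fin that(2,3)] pos_sign_remove(2)[OF fin that(2,3)]
      by (simp add: mult_ac)
  qed
  define P where "P = {(t, u). t \<in> T \<and> u \<in> T \<and> pos u < pos t}"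
  define Q where "Q = {(t, u). t \<in> T \<and> u \<in> T \<and> pos t < pos u}"
  have finPQ: "finite P" "finite Q"
    by (rule finite_subset[of _ "T \<times> T"], auto simp: P_def Q_def fin)+
  have "cobd pos y (cobd pos y h) T = (\<Sum>t\<in>T. \<Sum>u\<in>T - {t}. a t u)"
    unfolding cobd_def a_def by (simp add: sum_distrib_left)
  also have "\<dots> = (\<Sum>(t, u)\<in>Sigma T (\<lambda>t. T - {t}). a t u)"
    using fin by (subst sum.Sigma) auto
  also have "Sigma T (\<lambda>t. T - {t}) = P \<union> Q"
    using inj by (auto simp: P_def Q_def inj_on_def) (metis linorder_neqE_nat)
  also have "(\<Sum>(t, u)\<in>P \<union> Q. a t u) = (\<Sum>(t, u)\<in>P. a t u) + (\<Sum>(t, u)\<in>Q. a t u)"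
    by (rule sum.union_disjoint) (use finPQ in \<open>auto simp: P_def Q_def\<close>)
  also have "(\<Sum>(t, u)\<in>Q. a t u) = (\<Sum>(t, u)\<in>P. a u t)"
    by (rule sum.reindex_bij_witness[of _ prod.swap prod.swap]) (auto simp: P_def Q_def)
  also have "\<dots> = (\<Sum>(t, u)\<in>P. - a t u)"
    by (rule sum.cong) (auto simp: P_def anti)
  also have "\<dots> = - (\<Sum>(t, u)\<in>P. a t u)"
    by (simp add: sum_negf case_prod_unfold)
  finally show ?thesis by simp
qed

section \<open>Simplicial cocycles along the elimination of circuits\<close>

abbreviation cobd1 :: "('a \<Rightarrow> nat) \<Rightarrow> ('a set \<Rightarrow> 'r::comm_ring_1) \<Rightarrow> 'a set \<Rightarrow> 'r" where
  "cobd1 pos \<equiv> cobd pos (\<lambda>_. 1)"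

text \<open>Used with a cone point \<open>x\<close>: once the cochain vanishes on the other facets
  of \<open>insert x T\<close>, the cocycle condition there reduces to a single signed term.\<close>

lemma cobd_single_term:
  assumes "finite T" "x \<notin> T" "\<And>t. t \<in> T \<Longrightarrow> h (insert x T - {t}) = 0"
    "cobd1 pos h (insert x T) = 0"
  shows "h T = 0"
proof -
  have "(\<Sum>t\<in>T. pos_sign pos t (insert x T) * 1 * h (insert x T - {t})) = 0"
    using assms(3) by (intro sum.neutral) auto
  then have "pos_sign pos x (insert x T) * h T = 0"
    using assms(4) cobd_insert[OF assms(1,2), of pos "\<lambda>_. 1" h] by simp
  then have "pos_sign pos x (insert x T) *
      (pos_sign pos x (insert x T) * h T) = 0"
    by (simp only: mult_zero_right)
  then show ?thesis by (simp add: mult.assoc[symmetric])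
qed

text \<open>For the complement \<open>C\<close> of a clutter \<open>D\<close> this is the link of
  the vertices outside \<open>U\<close> in the complex of complements of members of
  \<open>D\<close>. It is antitone in \<open>C\<close>: deleting circuits adds faces.\<close>

definition clutter_link :: "'a set \<Rightarrow> nat \<Rightarrow> 'a set set \<Rightarrow> 'a set set" where
  "clutter_link U r C = {B. B \<subseteq> U \<and> (\<exists>W. W \<subseteq> U - B \<and> card W = r \<and> W \<notin> C)}"

lemma clutter_link_mono: "B \<in> clutter_link U r C \<Longrightarrow> A \<subseteq> B \<Longrightarrow> A \<in> clutter_link U r C"
  unfolding clutter_link_def by blast

text \<open>A simplex is a cone over any of its vertices \<open>x\<close>. Subtracting the
  coboundary of the contraction \<open>b\<close> makes the cocycle vanish on the sets through
  \<open>x\<close>; the cocycle condition on \<open>insert x B\<close> then removes the other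
  values.\<close>

lemma complete_cocycle:
  fixes c :: "'a set \<Rightarrow> 'r::comm_ring_1"
  assumes fin: "finite U" and inj: "inj_on pos U" and k: "k + r < card U"
    and coc: "\<And>B. B \<subseteq> U \<Longrightarrow> card B = Suc k \<Longrightarrow> cobd1 pos c B = 0"
  shows "\<exists>b. \<forall>B. B \<subseteq> U \<and> card B = k \<longrightarrow> c B = cobd1 pos b B"
proof -
  obtain x where x: "x \<in> U" using k by fastforce
  define b where "b A = (if x \<in> A then 0 else pos_sign pos x (insert x A) * c (insert x A))" for A
  define e where "e A = c A - cobd1 pos b A" for A
  have finB: "finite B" if "B \<subseteq> U" for B using that fin finite_subset by blast
  have injB: "inj_on pos B" if "B \<subseteq> U" for B using that inj inj_on_subset by blast
  have e_x: "e (insert x A) = 0" if "A \<subseteq> U" "x \<notin> A" for A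
  proof -
    have "(\<Sum>t\<in>A. pos_sign pos t (insert x A) * 1 * b (insert x A - {t})) = 0"
      using that by (intro sum.neutral) (auto simp: b_def)
    then have "cobd1 pos b (insert x A) = pos_sign pos x (insert x A) * b A"
      using cobd_insert[OF finB[OF that(1)] that(2), of pos "\<lambda>_. 1" b] by simp
    also have "\<dots> = c (insert x A)"
      using that(2) by (simp add: b_def mult.assoc[symmetric])
    finally show ?thesis by (simp add: e_def)
  qed
  have "e B = 0" if "B \<subseteq> U" "card B = k" for B
  proof (cases "x \<in> B")
    case True
    then show ?thesis using e_x[of "B - {x}"] that by (auto simp: insert_absorb)
  next
    case False
    have sub: "insert x B \<subseteq> U" using that x by auto
    have "cobd1 pos e (insert x B) =
      cobd1 pos c (insert x B) - cobd1 pos (cobd1 pos b) (insert x B)"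
      unfolding e_def by (rule cobd_diff)
    also have "\<dots> = 0"
      using coc[OF sub] that False finB[OF that(1)] cobd_cobd[OF finB[OF sub] injB[OF sub]] by simp
    finally have d0: "cobd1 pos e (insert x B) = 0" .
    have e0: "e (insert x B - {t}) = 0" if t: "t \<in> B" for t
    proof -
      have "insert x B - {t} = insert x (B - {t})" using t False by auto
      then show ?thesis using e_x[of "B - {t}"] that \<open>B \<subseteq> U\<close> False by auto
    qed
    show ?thesis
      by (rule cobd_single_term[OF finB[OF that(1)] False e0 d0])
  qed
  then have "\<forall>B. B \<subseteq> U \<and> card B = k \<longrightarrow> c B = cobd1 pos b B"
    by (simp add: e_def)
  then show ?thesis by blast
qed

text \<open>A vertex \<open>x0\<close> of the neighbourhood of \<open>Z\<close> serves as a cone point for the new faces.\<close>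

lemma extend_cocycle:
  fixes c :: "'a set \<Rightarrow> 'r::comm_ring_1"
  assumes fin: "finite U" and inj: "inj_on pos U" and r: "r \<ge> 1"
    and Cr: "\<And>W. W \<in> C \<Longrightarrow> card W = r"
    and cZ: "card Z = r - 1" "finite Z"
    and clique: "is_clique r C (closed_nbhd C Z)"
    and coc: "\<And>B. B \<in> clutter_link U r C \<Longrightarrow> card B = Suc k \<Longrightarrow> cobd1 pos c B = 0"
  defines "C' \<equiv> {\<E> \<in> C. \<not> Z \<subseteq> \<E>}"
  shows "\<exists>c'. (\<forall>B\<in>clutter_link U r C. c' B = c B) \<and>
    (\<forall>B\<in>clutter_link U r C'. card B = Suc k \<longrightarrow> cobd1 pos c' B = 0)"
proof -
  let ?L = "clutter_link U r C" and ?L' = "clutter_link U r C'"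
  let ?d = "cobd pos (\<lambda>_. 1 :: 'r)"
  define N where "N = closed_nbhd C Z - Z"
  have finB: "finite B" if "B \<subseteq> U" for B using that fin finite_subset by blast
  have injB: "inj_on pos B" if "B \<subseteq> U" for B using that inj inj_on_subset by blast
  have card_ins: "card (insert x Z) = r" if "x \<notin> Z" for x
    using that cZ r by simp
  have nbhd: "x \<in> N \<longleftrightarrow> x \<notin> Z \<and> insert x Z \<in> C" for x
  proof
    assume "x \<in> N"
    then obtain E where E: "x \<notin> Z" "E \<in> C" "x \<in> E" "E \<subseteq> insert x Z"
      by (auto simp: N_def closed_nbhd_def)
    have "E = insert x Z"
      using card_subset_eq[of "insert x Z" E] E cZ card_ins[OF E(1)] Cr[OF E(2)] by simp
    with E show "x \<notin> Z \<and> insert x Z \<in> C" by simp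
  next
    assume "x \<notin> Z \<and> insert x Z \<in> C"
    then show "x \<in> N" by (auto simp: N_def closed_nbhd_def)
  qed
  have closed: "closed_nbhd C Z = Z \<union> N" by (auto simp: N_def closed_nbhd_def)
  \<comment> \<open>The shape of a face gained by deleting the circuits through \<open>Z\<close>:
    all \<open>r\<close>-subsets of its complement were circuits and one contains \<open>Z\<close>,
    so every further vertex of the complement is a neighbour of \<open>Z\<close>.\<close>
  define new where "new B \<longleftrightarrow> B \<subseteq> U \<and> Z \<subseteq> U - B \<and> U - B \<subseteq> Z \<union> N \<and> U - B \<noteq> Z" for B
  have new_L: "B \<notin> ?L" if "new B" for B
    using that clique unfolding clutter_link_def new_def closed is_clique_def by blast
  have L'_iff: "new B" if "B \<in> ?L'" "B \<notin> ?L" for B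
  proof -
    have B: "B \<subseteq> U" using that by (auto simp: clutter_link_def)
    have all: "W \<in> C" if "W \<subseteq> U - B" "card W = r" for W
      using that B \<open>B \<notin> ?L\<close> by (auto simp: clutter_link_def)
    obtain W where W: "W \<subseteq> U - B" "card W = r" "W \<notin> C'"
      using \<open>B \<in> ?L'\<close> by (auto simp: clutter_link_def)
    then have ZW: "Z \<subseteq> W" using all by (auto simp: C'_def)
    have "U - B \<subseteq> Z \<union> N"
    proof
      fix x assume x: "x \<in> U - B"
      show "x \<in> Z \<union> N"
      proof (cases "x \<in> Z")
        case False
        then have "insert x Z \<in> C" using all[of "insert x Z"] card_ins[of x] x ZW W(1) by blast
        then show ?thesis using nbhd False by simp
      qed simp
    qed
    moreover have "U - B \<noteq> Z"
    proof
      assume "U - B = Z"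
      then have "card W \<le> card Z" using W(1) cZ card_mono by metis
      then show False using cZ r W by simp
    qed
    ultimately show ?thesis using ZW W B by (auto simp: new_def)
  qed
  show ?thesis
  proof (cases "\<exists>B. new B")
    case False
    then have "?L' \<subseteq> ?L" using L'_iff by blast
    then show ?thesis using coc by blast
  next
    case True
    then obtain x0 where x0: "x0 \<in> U" "x0 \<in> N" "x0 \<notin> Z"
      by (force simp: new_def nbhd)
    define c0 where "c0 B = (if B \<in> ?L then c B else 0)" for B
    \<comment> \<open>Gained faces through \<open>x0\<close> keep the value 0; on those without
      \<open>x0\<close> the value is the one that solves the cocycle equation at
      \<open>insert x0 B\<close>.\<close>
    define c' where "c' B = (if new B \<and> x0 \<notin> B
       then c0 B - pos_sign pos x0 (insert x0 B) * ?d c0 (insert x0 B) else c0 B)" for B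
    have c'_L: "c' B = c B" if "B \<in> ?L" for B
      using that new_L by (auto simp: c'_def c0_def)
    have d_L: "?d c' T = 0" if "T \<in> ?L" "card T = Suc k" for T
    proof -
      have "?d c' T = ?d c T"
        using that(1) by (intro cobd_cong c'_L) (blast intro: clutter_link_mono)
      then show ?thesis using coc that by simp
    qed
    have d_x0: "?d c' (insert x0 B) = 0" if "new B" "x0 \<notin> B" for B
    proof -
      have fB: "finite B" using that finB by (auto simp: new_def)
      have eq: "c' (insert x0 B - {t}) = c0 (insert x0 B - {t})" if "t \<in> B" for t
        using that \<open>x0 \<notin> B\<close> by (auto simp: c'_def)
      have "?d c' (insert x0 B) - ?d c0 (insert x0 B) =
         pos_sign pos x0 (insert x0 B) * (c' B - c0 B)"
        unfolding cobd_insert[OF fB that(2)] using eq by (simp add: algebra_simps)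
      also have "\<dots> = - ?d c0 (insert x0 B)"
        using that by (simp add: c'_def mult.assoc[symmetric])
      finally show ?thesis by simp
    qed
    have d_new_x0: "?d c' T = 0" if "new T" "x0 \<in> T" for T
    proof -
      have "new (T - {x0})" using that x0 by (auto simp: new_def)
      from d_x0[OF this] show ?thesis using that by (simp add: insert_absorb)
    qed
    have d_new: "?d c' T = 0" if "new T" "x0 \<notin> T" "card T = Suc k" for T
    proof -
      have TU: "T \<subseteq> U" and fT: "finite T" using that finB by (auto simp: new_def)
      have sub: "insert x0 T \<subseteq> U" using TU x0 by simp
      \<comment> \<open>The coboundary already vanishes on the facets of \<open>insert x0 T\<close>
        through \<open>x0\<close>. For \<open>t\<close> in \<open>N\<close> such a facet has the
        shape of a gained face through \<open>x0\<close>; otherwise \<open>insert t Z\<close> is not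
        a circuit and the facet is an old face.\<close>
      have "?d c' (insert x0 T - {t}) = 0" if t: "t \<in> T" for t
      proof (cases "t \<in> N")
        case True
        then have "new (insert x0 T - {t})"
          using t \<open>new T\<close> \<open>x0 \<notin> T\<close> x0 nbhd TU by (auto simp: new_def)
        then show ?thesis using d_new_x0 t \<open>x0 \<notin> T\<close> by auto
      next
        case False
        have tZ: "t \<notin> Z" using t \<open>new T\<close> by (auto simp: new_def)
        have "insert t Z \<subseteq> U - (insert x0 T - {t})"
          using t TU \<open>new T\<close> x0 by (auto simp: new_def)
        then have "insert x0 T - {t} \<in> ?L"
          unfolding clutter_link_def using False nbhd tZ card_ins[OF tZ] sub by blast
        moreover have "card (insert x0 T - {t}) = Suc k"
          using t fT \<open>x0 \<notin> T\<close> \<open>card T = Suc k\<close> by simp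
        ultimately show ?thesis using d_L by blast
      qed
      moreover have "?d (?d c') (insert x0 T) = 0"
        using cobd_cobd finB[OF sub] injB[OF sub] by blast
      ultimately show ?thesis using cobd_single_term[OF fT that(2)] by blast
    qed
    have "?d c' B = 0" if "B \<in> ?L'" "card B = Suc k" for B
      using that d_L d_new d_new_x0 L'_iff by blast
    then show ?thesis using c'_L by blast
  qed
qed

text \<open>\<open>extend_cocycle\<close> carries the cocycle to the larger complex of each later
  clutter. At the empty clutter \<open>k + r < card U\<close> leaves \<open>r\<close> vertices
  outside every set of size \<open>k + 1\<close>, so \<open>complete_cocycle\<close> applies, and
  the primitive found there restricts back to the original complex.\<close>

lemma chordal_cocycle:
  fixes c :: "'a set \<Rightarrow> 'r::comm_ring_1"
  assumes "chordal_clutter V r C" and "finite V" "U \<subseteq> V" "inj_on pos U" "r \<ge> 1" "k + r < card U"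
    and "\<And>W. W \<in> C \<Longrightarrow> card W = r"
    and "\<And>B. B \<in> clutter_link U r C \<Longrightarrow> card B = Suc k \<Longrightarrow> cobd1 pos c B = 0"
  shows "\<exists>b. \<forall>B\<in>clutter_link U r C. card B = k \<longrightarrow> c B = cobd1 pos b B"
  using assms
proof (induction arbitrary: c rule: chordal_clutter.induct)
  case no_circuits
  have fU: "finite U" using no_circuits finite_subset by blast
  have "B \<in> clutter_link U r {}" if "B \<subseteq> U" "card B = Suc k" for B
  proof -
    have "r \<le> card (U - B)"
      using that no_circuits fU by (simp add: card_Diff_subset finite_subset)
    then obtain W where "W \<subseteq> U - B" "card W = r" by (meson obtain_subset_with_card_n)
    then show ?thesis using that by (auto simp: clutter_link_def)
  qed
  then have "\<exists>b. \<forall>B. B \<subseteq> U \<and> card B = k \<longrightarrow> c B = cobd1 pos b B"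
    using no_circuits fU by (intro complete_cocycle) auto
  then show ?case by (auto simp: clutter_link_def)
next
  case (delete Z C)
  have fU: "finite U" and fZ: "finite Z" using delete finite_subset by blast+
  let ?C' = "{\<E> \<in> C. \<not> Z \<subseteq> \<E>}"
  obtain c' where c': "\<forall>B\<in>clutter_link U r C. c' B = c B"
    "\<forall>B\<in>clutter_link U r ?C'. card B = Suc k \<longrightarrow> cobd1 pos c' B = 0"
    using extend_cocycle[OF fU delete.prems(3,4), of C Z k c] delete fZ by blast
  have "\<exists>b. \<forall>B\<in>clutter_link U r ?C'. card B = k \<longrightarrow> c' B = cobd1 pos b B"
    using delete.prems c'(2) by (intro delete.IH) auto
  then obtain b where b: "\<forall>B\<in>clutter_link U r ?C'. card B = k \<longrightarrow> c' B = cobd1 pos b B" ..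
  have "clutter_link U r C \<subseteq> clutter_link U r ?C'" by (auto simp: clutter_link_def)
  then show ?case using b c'(1) by (intro exI[of _ b]) auto
qed

section \<open>Shedding families\<close>

text \<open>Members are complements of facets. Those avoiding \<open>v\<close> therefore describe
  the link of \<open>v\<close>, and those through \<open>v\<close>, stripped of \<open>v\<close>,
  the deletion. The last clause is an exchange: in a uniform family, \<open>W'\<close> arises from
  \<open>W\<close> by trading one element for \<open>v\<close>.\<close>

inductive shed_family :: "'a set \<Rightarrow> 'a set set \<Rightarrow> bool" where
  empty: "shed_family V {}"
| unit: "shed_family V {{}}"
| step: "\<lbrakk>v \<in> V; shed_family (V - {v}) {W \<in> D. v \<notin> W};
          shed_family (V - {v}) ((\<lambda>W. W - {v}) ` {W \<in> D. v \<in> W});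
          \<forall>W\<in>D. v \<notin> W \<longrightarrow> (\<exists>W'\<in>D. v \<in> W' \<and> W' - {v} \<subset> W)\<rbrakk> \<Longrightarrow> shed_family V D"

definition co_complex :: "'a set \<Rightarrow> 'a set set \<Rightarrow> 'a set set" where
  "co_complex V D = generated_complex {V - W | W. W \<in> D}"

lemma in_co_complex: "F \<in> co_complex V D \<longleftrightarrow> (\<exists>W\<in>D. F \<subseteq> V - W)"
  by (auto simp: co_complex_def generated_complex_def)

lemma vertex_decomposable_co_complex:
  assumes "shed_family V D" "finite V" "D \<subseteq> Pow V"
  shows "vertex_decomposable (co_complex V D)"
  using assms
proof (induction rule: shed_family.induct)
  case (empty V)
  have "co_complex V {} = {}" by (auto simp: in_co_complex)
  then show ?case by (simp add: vertex_decomposable.void)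
next
  case (unit V)
  have "co_complex V {{}} = Pow V" by (auto simp: in_co_complex)
  then show ?case using unit by (simp add: vertex_decomposable.simplex)
next
  case (step v V D)
  let ?D1 = "{W \<in> D. v \<notin> W}" and ?D2 = "(\<lambda>W. W - {v}) ` {W \<in> D. v \<in> W}"
  let ?\<Delta> = "co_complex V D"
  have VD1: "vertex_decomposable (co_complex (V - {v}) ?D1)"
    by (rule step.IH(1)) (use step.prems in auto)
  have VD2: "vertex_decomposable (co_complex (V - {v}) ?D2)"
    by (rule step.IH(2)) (use step.prems in auto)
  have link: "link ?\<Delta> v = co_complex (V - {v}) ?D1"
    by (rule Set.set_eqI) (use step.hyps(1) in \<open>auto simp: link_def in_co_complex\<close>)
  have del: "deletion ?\<Delta> v = co_complex (V - {v}) ?D2"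
  proof (intro Set.set_eqI iffI)
    fix F assume "F \<in> deletion ?\<Delta> v"
    then obtain W where F: "v \<notin> F" "W \<in> D" "F \<subseteq> V - W" by (auto simp: deletion_def in_co_complex)
    show "F \<in> co_complex (V - {v}) ?D2"
    proof (cases "v \<in> W")
      case True
      then show ?thesis using F by (auto simp: in_co_complex)
    next
      case False
      obtain W' where "W' \<in> D" "v \<in> W'" "W' - {v} \<subset> W" using False bspec[OF step.hyps(4) F(2)] by blast
      then show ?thesis using F unfolding in_co_complex by blast
    qed
  qed (auto simp: deletion_def in_co_complex)
  show ?case
  proof (cases "?D1 = {}")
    \<comment> \<open>No face contains \<open>v\<close> here, so \<open>v\<close> cannot be shed;
      but the complex coincides with its deletion.\<close>
    case True
    then have "v \<notin> F" if "F \<in> ?\<Delta>" for F using that unfolding in_co_complex by blast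
    then have "deletion ?\<Delta> v = ?\<Delta>" by (auto simp: deletion_def)
    then show ?thesis using VD2 del by metis
  next
    case False
    have 1: "{v} \<in> ?\<Delta>" using False step.hyps(1) by (auto simp: in_co_complex)
    have "F \<in> facets ?\<Delta>" if F: "F \<in> facets (deletion ?\<Delta> v)" for F
    proof -
      have max: "H = F" if "H \<in> deletion ?\<Delta> v" "F \<subseteq> H" for H
        using F that by (auto simp: facets_def)
      have F': "F \<in> ?\<Delta>" "v \<notin> F" using F by (auto simp: facets_def deletion_def)
      have "F = H" if H: "H \<in> ?\<Delta>" "F \<subseteq> H" for H
      proof (cases "v \<in> H")
        case False
        then show ?thesis using max H by (auto simp: deletion_def)
      next
        case True
        obtain W where W: "W \<in> D" "H \<subseteq> V - W" using H by (auto simp: in_co_complex)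
        then have "v \<notin> W" using True by blast
        then obtain W' where W': "W' \<in> D" "v \<in> W'" "W' - {v} \<subset> W"
          using bspec[OF step.hyps(4) W(1)] by blast
        \<comment> \<open>Maximality identifies \<open>F\<close> with \<open>V - W'\<close>. By
          strictness some \<open>w\<close> in \<open>W\<close> lies outside \<open>W'\<close>, hence
          in \<open>F\<close>, which contradicts
          \<open>F \<subseteq> H \<subseteq> V - W\<close>.\<close>
        have "V - W' \<in> deletion ?\<Delta> v" using W' by (auto simp: deletion_def in_co_complex)
        moreover have "F \<subseteq> V - W'" using W W' H F' by blast
        ultimately have "V - W' = F" using max by blast
        moreover obtain w where "w \<in> W" "w \<notin> W' - {v}" using W' by blast
        moreover have "W \<subseteq> V" using W step.prems by blast
        moreover have "w \<noteq> v" using \<open>w \<in> W\<close> True W by blast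
        ultimately have "w \<in> F" by blast
        then show ?thesis using H W \<open>w \<in> W\<close> by blast
      qed
      then show ?thesis using F' by (auto simp: facets_def)
    qed
    then have "facets (deletion ?\<Delta> v) \<subseteq> facets ?\<Delta>" by blast
    then show ?thesis
      using vertex_decomposable.shed[of v ?\<Delta>] 1 VD1 VD2 link del by simp
  qed
qed

section \<open>Co-chordality from a shedding order\<close>

lemma chordal_clutter_mono:
  assumes "chordal_clutter V d C" "V \<subseteq> V'"
  shows "chordal_clutter V' d C"
  using assms
proof (induction rule: chordal_clutter.induct)
  case (delete Z C)
  show ?case
    by (rule chordal_clutter.delete[of Z])
      (use delete.hyps(1-3) delete.IH[OF delete.prems] delete.prems in auto)
qed (rule chordal_clutter.no_circuits)

text \<open>With \<open>d - 1 = 0\<close> the set \<open>Z\<close> is empty and lies in every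
  circuit, so one deletion empties the clutter. This settles the sizes excluded in
  \<open>chordal_clutter_cone\<close>.\<close>

lemma chordal_clutter_small:
  assumes "d \<le> 1" "\<And>W. W \<in> C \<Longrightarrow> finite W \<and> card W = d"
  shows "chordal_clutter V d C"
proof (cases "C = {}")
  case True
  then show ?thesis by (simp add: chordal_clutter.no_circuits)
next
  case nonempty: False
  have nb: "\<exists>E\<in>C. x \<in> E \<and> E \<subseteq> {x}" if "x \<in> closed_nbhd C {}" for x
    using that by (auto simp: closed_nbhd_def)
  have "W \<in> C" if W: "W \<subseteq> closed_nbhd C {}" "card W = d" for W
  proof (cases "W = {}")
    case True
    then have "E = {}" if "E \<in> C" for E using assms(2)[OF that] W by auto
    then show ?thesis using nonempty True by blast
  next
    case False
    then obtain x where x: "x \<in> W" by blast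
    then obtain E where E: "E \<in> C" "x \<in> E" "E \<subseteq> {x}" using nb W by blast
    then have Ex: "E = {x}" by blast
    then have "card W = 1" using W assms(2)[OF E(1)] by simp
    then have "W = {x}" using x by (metis card_1_singletonE singletonD)
    then show ?thesis using E Ex by simp
  qed
  then have "is_clique d C (closed_nbhd C {})" by (auto simp: is_clique_def)
  moreover have "{\<E> \<in> C. \<not> {} \<subseteq> \<E>} = {}" by simp
  ultimately show ?thesis
    using chordal_clutter.delete[of "{}" V d C] chordal_clutter.no_circuits[of V d] assms(1) by simp
qed

text \<open>The elimination of \<open>C2\<close> is replayed with \<open>v\<close> added to every
  \<open>Z\<close>, which removes all circuits through \<open>v\<close> and leaves
  \<open>C1\<close>. The last assumption supplies the clique condition for sets avoiding
  \<open>v\<close>: all their subsets of size \<open>d - 1\<close> lie in \<open>C2\<close>. It is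
  inherited when \<open>C2\<close> shrinks.\<close>

lemma chordal_clutter_cone:
  assumes "chordal_clutter (V - {v}) (d - 1) C2" "d \<ge> 2" "v \<in> V" "finite V"
    and "chordal_clutter (V - {v}) d C1"
    and "\<And>W. W \<in> C1 \<Longrightarrow> W \<subseteq> V - {v} \<and> card W = d"
    and "\<And>W. W \<in> C2 \<Longrightarrow> W \<subseteq> V - {v}"
    and "\<And>W. W \<subseteq> V - {v} \<Longrightarrow> card W = d \<Longrightarrow> (\<And>A. A \<subseteq> W \<Longrightarrow> card A = d - 1 \<Longrightarrow> A \<in> C2) \<Longrightarrow> W \<in> C1"
  shows "chordal_clutter V d (C1 \<union> insert v ` C2)"
  using assms
proof (induction rule: chordal_clutter.induct)
  case no_circuits
  then show ?case by (simp add: chordal_clutter_mono[of "V - {v}"])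
next
  case (delete Z C2)
  let ?C = "C1 \<union> insert v ` C2" and ?Z = "insert v Z"
  have fZ: "finite Z" using delete.hyps(1) delete.prems(3) by (meson finite_Diff finite_subset)
  have cZ: "card ?Z = d - 1" using delete.hyps(1,2) delete.prems(1) fZ by (auto simp: card_insert_if)
  have nb: "closed_nbhd ?C ?Z \<subseteq> insert v (closed_nbhd C2 Z)"
  proof
    fix x assume x: "x \<in> closed_nbhd ?C ?Z"
    show "x \<in> insert v (closed_nbhd C2 Z)"
    proof (cases "x \<in> ?Z")
      case True
      then show ?thesis by (auto simp: closed_nbhd_def)
    next
      case False
      then obtain E where E: "E \<in> ?C" "x \<in> E" "E \<subseteq> insert x ?Z"
        using x by (auto simp: closed_nbhd_def)
      have "E \<notin> C1"
      proof
        assume "E \<in> C1"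
        then have *: "E \<subseteq> insert x Z" "card E = d" using delete.prems(5)[of E] E by auto
        have "card E \<le> card (insert x Z)" using * fZ by (intro card_mono) auto
        then show False using * fZ False delete.hyps(2) delete.prems(1) by simp
      qed
      then obtain E' where "E' \<in> C2" "E = insert v E'" using E by auto
      then have "x \<in> E'" "E' \<subseteq> insert x Z" using E False delete.prems(6)[of E'] by auto
      then show ?thesis using \<open>E' \<in> C2\<close> False by (auto simp: closed_nbhd_def)
    qed
  qed
  have nbV: "closed_nbhd C2 Z \<subseteq> V - {v}"
    using delete.hyps(1) delete.prems(6) by (auto simp: closed_nbhd_def)
  have clique2: "A \<in> C2" if "A \<subseteq> closed_nbhd C2 Z" "card A = d - 1" for A
    using delete.hyps(3) that by (auto simp: is_clique_def)
  have clique: "is_clique d ?C (closed_nbhd ?C ?Z)"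
    unfolding is_clique_def
  proof (intro allI impI, elim conjE)
    fix W assume W: "W \<subseteq> closed_nbhd ?C ?Z" "card W = d"
    have fW: "finite W" using W delete.prems(1) by (intro card_ge_0_finite) simp
    show "W \<in> ?C"
    proof (cases "v \<in> W")
      case True
      have "W - {v} \<in> C2" by (rule clique2) (use W nb True fW in auto)
      then have "insert v (W - {v}) \<in> insert v ` C2" by blast
      then show ?thesis using True by (simp add: insert_absorb)
    next
      case False
      then have sub: "W \<subseteq> closed_nbhd C2 Z" using W nb by blast
      have "W \<in> C1"
        by (rule delete.prems(7)) (use sub nbV W clique2 in \<open>auto intro: subset_trans\<close>)
      then show ?thesis by simp
    qed
  qed
  let ?C2' = "{\<E> \<in> C2. \<not> Z \<subseteq> \<E>}"
  have rest: "{\<E> \<in> ?C. \<not> ?Z \<subseteq> \<E>} = C1 \<union> insert v ` ?C2'"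
    using delete.prems(5,6) delete.hyps(1) by blast
  have "chordal_clutter V d (C1 \<union> insert v ` ?C2')"
    by (rule delete.IH[OF delete.prems(1-5)]) (use delete.prems(6,7) in \<open>auto\<close>)
  then show ?case
    using chordal_clutter.delete[of ?Z V d ?C] cZ clique rest delete.hyps(1) delete.prems(2) by auto
qed

lemma complement_clutter_split:
  assumes "v \<in> V" "finite V" "d \<ge> 1"
  shows "complement_clutter V d D = complement_clutter (V - {v}) d {W \<in> D. v \<notin> W} \<union>
    insert v ` complement_clutter (V - {v}) (d - 1) ((\<lambda>W. W - {v}) ` {W \<in> D. v \<in> W})"
    (is "?L = ?A \<union> insert v ` ?B")
proof (intro Set.set_eqI iffI)
  fix W assume W: "W \<in> ?L"
  show "W \<in> ?A \<union> insert v ` ?B"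
  proof (cases "v \<in> W")
    case True
    have "W - {v} \<notin> (\<lambda>W. W - {v}) ` {W \<in> D. v \<in> W}"
    proof
      assume "W - {v} \<in> (\<lambda>W. W - {v}) ` {W \<in> D. v \<in> W}"
      then obtain A where "A \<in> D" "v \<in> A" "W - {v} = A - {v}" by blast
      then have "A = W" using True by blast
      then show False using W \<open>A \<in> D\<close> by (simp add: complement_clutter_def)
    qed
    then have "W - {v} \<in> ?B"
      using W True assms finite_subset[of W V] by (auto simp: complement_clutter_def)
    then have "insert v (W - {v}) \<in> insert v ` ?B" by blast
    then show ?thesis using True by (simp add: insert_absorb)
  qed (use W in \<open>auto simp: complement_clutter_def\<close>)
next
  fix W assume "W \<in> ?A \<union> insert v ` ?B"
  then show "W \<in> ?L"
  proof
    assume "W \<in> insert v ` ?B"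
    then obtain A where A: "A \<in> ?B" "W = insert v A" by blast
    then have "A \<subseteq> V - {v}" "card A = d - 1" by (auto simp: complement_clutter_def)
    moreover have "v \<notin> A" using \<open>A \<subseteq> V - {v}\<close> by blast
    moreover have "finite A" using \<open>A \<subseteq> V - {v}\<close> assms by (meson finite_Diff finite_subset)
    moreover have "insert v A \<notin> D"
    proof
      assume "insert v A \<in> D"
      moreover have "insert v A - {v} = A" using \<open>A \<subseteq> V - {v}\<close> by auto
      ultimately have "A \<in> (\<lambda>W. W - {v}) ` {W \<in> D. v \<in> W}" by (metis (mono_tags, lifting) image_eqI insertI1 mem_Collect_eq)
      then show False using A by (simp add: complement_clutter_def)
    qed
    ultimately show ?thesis using A assms by (auto simp: complement_clutter_def)
  qed (auto simp: complement_clutter_def)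
qed

text \<open>The exchange clause of shedding is the closure assumption of
  \<open>chordal_clutter_cone\<close> read in complements: a member \<open>W\<close> avoiding
  \<open>v\<close> contains some \<open>W' - {v}\<close> from the contraction, so not all subsets of
  \<open>W\<close> of size \<open>d - 1\<close> are circuits of the complement.\<close>

lemma co_chordal_step:
  assumes "v \<in> V" "finite V" "\<And>W. W \<in> D \<Longrightarrow> W \<subseteq> V \<and> card W = d"
    "co_chordal_clutter (V - {v}) d {W \<in> D. v \<notin> W}"
    "co_chordal_clutter (V - {v}) (d - 1) ((\<lambda>W. W - {v}) ` {W \<in> D. v \<in> W})"
    "\<And>W. W \<in> D \<Longrightarrow> v \<notin> W \<Longrightarrow> \<exists>W'\<in>D. v \<in> W' \<and> W' - {v} \<subset> W"
  shows "co_chordal_clutter V d D"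
proof (cases "d \<le> 1")
  case True
  have "finite W \<and> card W = d" if "W \<in> complement_clutter V d D" for W
    using that assms(2) finite_subset by (auto simp: complement_clutter_def)
  then show ?thesis unfolding co_chordal_clutter_def by (rule chordal_clutter_small[OF True])
next
  case False
  let ?D1 = "{W \<in> D. v \<notin> W}" and ?D2 = "(\<lambda>W. W - {v}) ` {W \<in> D. v \<in> W}"
  have "chordal_clutter V d (complement_clutter (V - {v}) d ?D1 \<union>
    insert v ` complement_clutter (V - {v}) (d - 1) ?D2)"
  proof (rule chordal_clutter_cone)
    fix W assume W: "W \<subseteq> V - {v}" "card W = d"
      "\<And>A. A \<subseteq> W \<Longrightarrow> card A = d - 1 \<Longrightarrow> A \<in> complement_clutter (V - {v}) (d - 1) ?D2"
    have "W \<notin> D"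
    proof
      assume "W \<in> D"
      moreover have "v \<notin> W" using W(1) by blast
      ultimately obtain W' where W': "W' \<in> D" "v \<in> W'" "W' - {v} \<subset> W"
        using assms(6) by blast
      have "finite W'" using assms(2,3) W'(1) finite_subset by blast
      then have "card (W' - {v}) = d - 1" using assms(3)[OF W'(1)] W' by simp
      then have "W' - {v} \<in> complement_clutter (V - {v}) (d - 1) ?D2" using W(3) W'(3) by blast
      then show False using W' by (auto simp: complement_clutter_def)
    qed
    then show "W \<in> complement_clutter (V - {v}) d ?D1"
      using W by (auto simp: complement_clutter_def)
  qed (use assms False in \<open>auto simp: co_chordal_clutter_def complement_clutter_def\<close>)
  then show ?thesis
    using complement_clutter_split[of v V d D] assms(1,2) False by (simp add: co_chordal_clutter_def)
qed

text \<open>Complete clutters are chordal because vertices can be split off one at a time, the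
  exchange condition being vacuous.\<close>

lemma co_chordal_clutter_empty:
  assumes "finite V"
  shows "co_chordal_clutter V d {}"
  using assms
proof (induction V arbitrary: d rule: finite_induct)
  case empty
  show ?case
  proof (cases "d = 0")
    case True
    then show ?thesis
      unfolding co_chordal_clutter_def
      by (intro chordal_clutter_small) (auto simp: complement_clutter_def)
  next
    case False
    then have "complement_clutter {} d {} = ({} :: 'a set set)" by (auto simp: complement_clutter_def)
    then show ?thesis by (simp add: co_chordal_clutter_def chordal_clutter.no_circuits)
  qed
next
  case (insert v V)
  have "insert v V - {v} = V" using insert.hyps(2) by simp
  then show ?case
    using insert.hyps(1) insert.IH co_chordal_step[of v "insert v V" "{}" d] by simp
qed

lemma co_chordal_clutter_shed_family:
  assumes "shed_family V D" "finite V" "\<And>W. W \<in> D \<Longrightarrow> W \<subseteq> V \<and> card W = d"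
  shows "co_chordal_clutter V d D"
  using assms
proof (induction arbitrary: d rule: shed_family.induct)
  case (empty V)
  then show ?case by (simp add: co_chordal_clutter_empty)
next
  case (unit V)
  then have "d = 0" by auto
  then have "complement_clutter V d {{}} = {}"
    using unit.prems(1) by (auto simp: complement_clutter_def dest: finite_subset)
  then show ?case by (simp add: co_chordal_clutter_def chordal_clutter.no_circuits)
next
  case (step v V D)
  have fin: "finite W" if "W \<in> D" for W using step.prems that finite_subset by blast
  show ?case
  proof (rule co_chordal_step[of v])
    show "co_chordal_clutter (V - {v}) d {W \<in> D. v \<notin> W}"
      by (rule step.IH(1)) (use step.prems in auto)
    show "co_chordal_clutter (V - {v}) (d - 1) ((\<lambda>W. W - {v}) ` {W \<in> D. v \<in> W})"
      by (rule step.IH(2)) (use step.prems fin in auto)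
  qed (use step in auto)
qed

section \<open>Connected sets of the grid\<close>

lemma connected_on_singleton: "connected_on G {v}"
  by (simp add: connected_on_def)

lemma connected_on_insert:
  assumes sym: "\<And>a b. adj G a b \<Longrightarrow> adj G b a"
    and W: "connected_on G W" and u: "u \<in> W" "adj G u v"
  shows "connected_on G (insert v W)"
proof -
  let ?R = "{(a, b). a \<in> W \<and> b \<in> W \<and> adj G a b}"
  let ?R' = "{(a, b). a \<in> insert v W \<and> b \<in> insert v W \<and> adj G a b}"
  have sub: "?R\<^sup>* \<subseteq> ?R'\<^sup>*" by (rule rtrancl_mono) auto
  have 1: "(x, y) \<in> ?R'\<^sup>*" if "x \<in> W" "y \<in> W" for x y
    using W that sub by (auto simp: connected_on_def)
  have 2: "(u, v) \<in> ?R'\<^sup>*" using u by (intro r_into_rtrancl) auto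
  have 3: "(v, u) \<in> ?R'\<^sup>*" using u sym by (intro r_into_rtrancl) auto
  have to_u: "(x, u) \<in> ?R'\<^sup>*" if "x \<in> insert v W" for x using that 1 3 u by auto
  have from_u: "(u, y) \<in> ?R'\<^sup>*" if "y \<in> insert v W" for y using that 1 2 u by auto
  have "(x, y) \<in> ?R'\<^sup>*" if "x \<in> insert v W" "y \<in> insert v W" for x y
    using to_u[OF that(1)] from_u[OF that(2)] by (rule rtrancl_trans)
  then show ?thesis by (simp add: connected_on_def)
qed

lemma connected_on_separate:
  assumes W: "connected_on G W" "W \<subseteq> X \<union> Y"
    and no_edge: "\<And>x y. x \<in> X \<Longrightarrow> y \<in> Y \<Longrightarrow> x \<in> W \<Longrightarrow> y \<in> W \<Longrightarrow> \<not> adj G x y"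
  shows "W \<subseteq> X \<or> W \<subseteq> Y"
proof (cases "W \<inter> X = {}")
  case True
  then show ?thesis using W by blast
next
  case False
  let ?R = "{(a, b). a \<in> W \<and> b \<in> W \<and> adj G a b}"
  from False obtain w where w: "w \<in> W" "w \<in> X" by blast
  have "y \<in> X" if "(w, y) \<in> ?R\<^sup>*" for y
    using that
  proof induction
    case (step a b)
    then show ?case using no_edge[of a b] W by blast
  qed (rule w)
  then have "W \<subseteq> X" using W w unfolding connected_on_def by blast
  then show ?thesis ..
qed

text \<open>A maximal connected \<open>B\<close> with \<open>A \<subseteq> B \<subset> W\<close>
  misses exactly one vertex of \<open>W\<close>: some edge leaves \<open>B\<close> inside
  \<open>W\<close>, and adding its end must already give \<open>W\<close>.\<close>

lemma connected_on_remove: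
  assumes sym: "\<And>a b. adj G a b \<Longrightarrow> adj G b a"
    and "connected_on G A" "connected_on G W" "finite W" "A \<subset> W"
  shows "\<exists>u\<in>W - A. connected_on G (W - {u})"
proof -
  let ?S = "{B. A \<subseteq> B \<and> B \<subset> W \<and> connected_on G B}"
  have "finite ?S" by (rule finite_subset[of _ "Pow W"]) (use assms in auto)
  moreover have "?S \<noteq> {}" using assms by auto
  ultimately obtain B where B: "B \<in> ?S" "\<And>B'. B' \<in> ?S \<Longrightarrow> B \<subseteq> B' \<Longrightarrow> B = B'"
    by (metis (no_types, lifting) finite_has_maximal)
  have "\<not> (W \<subseteq> B \<or> W \<subseteq> W - B)" using B(1) assms(2) by (auto simp: connected_on_def)
  then obtain x y where xy: "x \<in> B" "y \<in> W - B" "adj G x y"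
    using connected_on_separate[OF assms(3), of B "W - B"] by blast
  have "connected_on G (insert y B)"
    using B(1) xy by (intro connected_on_insert[OF sym]) auto
  then have "insert y B = W" using B(1) B(2)[of "insert y B"] xy by blast
  then have "W - {y} = B" using xy by blast
  then show ?thesis using B(1) xy by (intro bexI[of _ y]) auto
qed

definition connected_sets :: "'a ugraph \<Rightarrow> nat \<Rightarrow> 'a set \<Rightarrow> 'a set set" where
  "connected_sets G r X = {W. W \<subseteq> X \<and> card W = r \<and> connected_on G W}"

text \<open>The contraction at \<open>A\<close>: the form that the family of connected sets takes
  once the vertices of \<open>A\<close> have been shed as members.\<close>

definition rooted_sets :: "'a ugraph \<Rightarrow> nat \<Rightarrow> 'a set \<Rightarrow> 'a set \<Rightarrow> 'a set set" where
  "rooted_sets G r X A = (\<lambda>W. W - A) ` {W \<in> connected_sets G r X. A \<subseteq> W}"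

text \<open>Any neighbour \<open>v\<close> of \<open>A\<close> sheds. If a connected
  \<open>S\<close> contains \<open>A\<close> and not \<open>v\<close>, then
  \<open>insert v S\<close> is connected, and \<open>connected_on_remove\<close> with the connected
  set \<open>insert v A\<close> discards another vertex outside \<open>insert v A\<close>. Both
  branches have one free vertex fewer.\<close>

lemma shed_family_rooted_sets:
  assumes sym: "\<And>a b. adj G a b \<Longrightarrow> adj G b a"
    and "finite X" "connected_on G A" "A \<subseteq> X"
  shows "shed_family (X - A) (rooted_sets G r X A)"
  using assms(2-)
proof (induction "card (X - A)" arbitrary: X A rule: less_induct)
  case less
  let ?D = "rooted_sets G r X A"
  show ?case
  proof (cases "?D \<subseteq> {{}}")
    case True
    then have "?D = {} \<or> ?D = {{}}" by blast
    then show ?thesis by (metis shed_family.empty shed_family.unit)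
  next
    case False
    then obtain W where W: "W \<subseteq> X" "card W = r" "connected_on G W" "A \<subset> W"
      by (auto simp: rooted_sets_def connected_sets_def)
    have fW: "finite B" if "B \<subseteq> X" for B using that less.prems(1) finite_subset by blast
    have cA: "card A < r" using W fW psubset_card_mono by metis
    have "\<not> (W \<subseteq> A \<or> W \<subseteq> W - A)" using W less.prems(2) by (auto simp: connected_on_def)
    then obtain a v where av: "a \<in> A" "v \<in> W - A" "adj G a v"
      using connected_on_separate[OF W(3), of A "W - A"] by blast
    have v: "v \<in> X - A" using av W by blast
    have conn_v: "connected_on G (insert v A)"
      by (rule connected_on_insert[OF sym less.prems(2) av(1,3)])
    have dec: "card (X - A - {v}) < card (X - A)"
      using v less.prems(1) by (intro card_Diff1_less) auto
    have D1: "{W \<in> ?D. v \<notin> W} = rooted_sets G r (X - {v}) A"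
      using v by (auto simp: rooted_sets_def connected_sets_def)
    have "(\<lambda>W. W - {v}) ` {W \<in> ?D. v \<in> W} =
        (\<lambda>W. W - A - {v}) ` {W \<in> connected_sets G r X. insert v A \<subseteq> W}"
      using v by (auto simp: rooted_sets_def)
    also have "\<dots> = rooted_sets G r X (insert v A)"
      unfolding rooted_sets_def by (intro image_cong) auto
    finally have D2: "(\<lambda>W. W - {v}) ` {W \<in> ?D. v \<in> W} = rooted_sets G r X (insert v A)" .
    show ?thesis
    proof (rule shed_family.step[OF v])
      have "X - {v} - A = X - A - {v}" by blast
      then show "shed_family (X - A - {v}) {W \<in> ?D. v \<notin> W}"
        using less.hyps[of "X - {v}" A] dec less.prems v unfolding D1 by auto
      have "X - insert v A = X - A - {v}" by blast
      then show "shed_family (X - A - {v}) ((\<lambda>W. W - {v}) ` {W \<in> ?D. v \<in> W})"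
        using less.hyps[of X "insert v A"] dec less.prems v conn_v unfolding D2 by auto
      show "\<forall>B\<in>?D. v \<notin> B \<longrightarrow> (\<exists>B'\<in>?D. v \<in> B' \<and> B' - {v} \<subset> B)"
      proof (intro ballI impI)
        fix B assume "B \<in> ?D" "v \<notin> B"
        then obtain S where S: "B = S - A" "S \<subseteq> X" "card S = r" "connected_on G S" "A \<subseteq> S"
          by (auto simp: rooted_sets_def connected_sets_def)
        have vS: "v \<notin> S" using S \<open>v \<notin> B\<close> v by blast
        have "S \<noteq> A" using S cA by blast
        then have "insert v A \<noteq> insert v S" using vS v by (metis Diff_iff insert_ident)
        then have "insert v A \<subset> insert v S" using S(5) by blast
        moreover have "connected_on G (insert v S)"
          using S av by (intro connected_on_insert[OF sym S(4) _ av(3)]) auto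
        ultimately obtain u where u: "u \<in> insert v S - insert v A" "connected_on G (insert v S - {u})"
          using connected_on_remove[OF sym conn_v] fW[OF S(2)] by blast
        have "card (insert v S - {u}) = r"
          using u S vS fW[OF S(2)] by simp
        then have "insert v S - {u} - A \<in> ?D"
          using u S v unfolding rooted_sets_def connected_sets_def by blast
        moreover have "insert v S - {u} - A - {v} \<subset> B" using u S vS by blast
        moreover have "v \<in> insert v S - {u} - A" using u v by blast
        ultimately show "\<exists>B'\<in>?D. v \<in> B' \<and> B' - {v} \<subset> B"
          by (intro bexI[of _ "insert v S - {u} - A"] conjI)
      qed
    qed
  qed
qed

text \<open>The contraction at \<open>v\<close> is rooted at a connected set, hence always
  sheddable; only the sets avoiding \<open>v\<close> remain to be treated. By \<open>nbr\<close>
  each of these stays connected when \<open>v\<close> is added, which gives the exchange.\<close>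

lemma shed_family_connected_sets_step:
  assumes sym: "\<And>a b. adj G a b \<Longrightarrow> adj G b a"
    and "finite X" "v \<in> X" "r \<ge> 2"
    and "shed_family (X - {v}) (connected_sets G r (X - {v}))"
    and nbr: "\<And>W. W \<in> connected_sets G r (X - {v}) \<Longrightarrow> \<exists>w\<in>W. adj G w v"
  shows "shed_family X (connected_sets G r X)"
proof (rule shed_family.step[OF assms(3)])
  let ?D = "connected_sets G r X"
  have "{W \<in> ?D. v \<notin> W} = connected_sets G r (X - {v})"
    by (auto simp: connected_sets_def)
  then show "shed_family (X - {v}) {W \<in> ?D. v \<notin> W}" using assms by simp
  have "(\<lambda>W. W - {v}) ` {W \<in> ?D. v \<in> W} = rooted_sets G r X {v}"
    by (simp add: rooted_sets_def)
  then show "shed_family (X - {v}) ((\<lambda>W. W - {v}) ` {W \<in> ?D. v \<in> W})"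
    using shed_family_rooted_sets[OF sym assms(2) connected_on_singleton, of v r] assms(3) by simp
  show "\<forall>W\<in>?D. v \<notin> W \<longrightarrow> (\<exists>W'\<in>?D. v \<in> W' \<and> W' - {v} \<subset> W)"
  proof (intro ballI impI)
    fix W assume W: "W \<in> ?D" "v \<notin> W"
    then have W': "W \<subseteq> X" "card W = r" "connected_on G W" by (auto simp: connected_sets_def)
    then obtain w where w: "w \<in> W" "adj G w v" using nbr[of W] W by (auto simp: connected_sets_def)
    have fin: "finite W" using W' assms(2) finite_subset by blast
    have "W \<noteq> {}" using W' assms(4) by auto
    then have "{v} \<subset> insert v W" using W by blast
    then obtain u where u: "u \<in> insert v W - {v}" "connected_on G (insert v W - {u})"
      using connected_on_remove[OF sym connected_on_singleton connected_on_insert[OF sym W'(3) w]] fin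
      by blast
    then have "card (insert v W - {u}) = r" using W' W fin by simp
    then have "insert v W - {u} \<in> ?D" using u W' assms(3) by (auto simp: connected_sets_def)
    moreover have "insert v W - {u} - {v} \<subset> W" "v \<in> insert v W - {u}" using u W by blast+
    ultimately show "\<exists>W'\<in>?D. v \<in> W' \<and> W' - {v} \<subset> W"
      by (intro bexI[of _ "insert v W - {u}"] conjI)
  qed
qed

section \<open>The grid with three rows and its shedding order\<close>

abbreviation grid :: "nat \<Rightarrow> (nat \<times> nat) ugraph" where
  "grid n \<equiv> cartesian_product (path_graph n) (path_graph 3)"

lemma verts_grid: "verts (grid n) = {1..n} \<times> {1..3}"
  by (simp add: cartesian_product_def path_graph_def)

lemma adj_grid: "adj (grid n) (x, y) (a, b) \<longleftrightarrow>
    (x, y) \<in> {1..n} \<times> {1..3} \<and> (a, b) \<in> {1..n} \<times> {1..3} \<and>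
    (x = a \<and> (b = y + 1 \<or> y = b + 1) \<or> y = b \<and> (a = x + 1 \<or> x = a + 1))"
  by (auto simp: cartesian_product_def path_graph_def)

lemma adj_grid_sym: "adj (grid n) u v \<Longrightarrow> adj (grid n) v u"
  by (cases u; cases v) (auto simp: adj_grid)

text \<open>The stages of a shedding order that removes the middle row from its centre outwards.\<close>

definition cut_grid :: "nat \<Rightarrow> nat \<Rightarrow> nat \<Rightarrow> (nat \<times> nat) set" where
  "cut_grid n p q = {(x, y) \<in> {1..n} \<times> {1..3}. y = 2 \<longrightarrow> x \<le> p \<or> n - q < x}"

lemma finite_cut_grid: "finite (cut_grid n p q)"
  by (rule finite_subset[of _ "{1..n} \<times> {1..3}"]) (auto simp: cut_grid_def)

lemma grid_separate_column:
  assumes "connected_on (grid n) W" "\<And>x y. (x, y) \<in> W \<Longrightarrow> x \<noteq> c"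
  shows "W \<subseteq> {(x, y). x < c} \<or> W \<subseteq> {(x, y). c < x}"
proof (rule connected_on_separate[OF assms(1)])
  show "W \<subseteq> {(x, y). x < c} \<union> {(x, y). c < x}"
  proof
    fix w assume "w \<in> W"
    then show "w \<in> {(x, y). x < c} \<union> {(x, y). c < x}"
      using assms(2) by (cases w) (force simp: neq_iff)
  qed
qed (auto simp: adj_grid)

text \<open>Without a neighbour of \<open>(c, 2)\<close> in rows 1 and 3, the set misses the whole
  column \<open>c\<close>, which separates the grid.\<close>

lemma grid_neighbour_or_side:
  assumes "connected_on (grid n) W" "W \<subseteq> {1..n} \<times> {1..3}" "(c, 2) \<notin> W" "c \<in> {1..n}"
  shows "(\<exists>w\<in>W. adj (grid n) w (c, 2)) \<or> W \<subseteq> {(x, y). x < c} \<or> W \<subseteq> {(x, y). c < x}"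
proof (cases "\<exists>w\<in>W. adj (grid n) w (c, 2)")
  case no: False
  have "x \<noteq> c" if "(x, y) \<in> W" for x y
  proof
    assume "x = c"
    have "y \<in> {1..3}" "y \<noteq> 2" using that assms(2,3) \<open>x = c\<close> by auto
    then have "y = 1 \<or> y = 3" by auto
    then show False using no that \<open>x = c\<close> assms(4) by (force simp: adj_grid)
  qed
  then have "W \<subseteq> {(x, y). x < c} \<or> W \<subseteq> {(x, y). c < x}"
    by (rule grid_separate_column[OF assms(1)])
  then show ?thesis ..
qed blast

text \<open>\<open>p\<close> and \<open>q\<close> count the middle vertices still present at the two
  ends, and the longer end loses its innermost vertex. Balance keeps both sides of that column below
  \<open>2 * n\<close> vertices: in the case \<open>p \<le> q\<close> they have at most
  \<open>(n - q) * 2 + p\<close> and \<open>(q - 1) * 3\<close>. A connected \<open>r\<close>-set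
  avoiding the vertex thus fits on neither side and contains a neighbour of it. With the middle row
  gone, each component has only \<open>n < r\<close> vertices.\<close>

lemma shed_family_cut_grid:
  assumes "2 * n \<le> r" "n \<ge> 1"
  shows "p + q \<le> n \<Longrightarrow> p \<le> q + 1 \<Longrightarrow> q \<le> p + 1 \<Longrightarrow>
    shed_family (cut_grid n p q) (connected_sets (grid n) r (cut_grid n p q))"
proof (induction "p + q" arbitrary: p q)
  case 0
  have "False" if W: "W \<subseteq> cut_grid n 0 0" "card W = r" "connected_on (grid n) W" for W
  proof -
    have "W \<subseteq> {1..n} \<times> {1} \<or> W \<subseteq> {1..n} \<times> {3}"
    proof (rule connected_on_separate[OF W(3)])
      show "W \<subseteq> {1..n} \<times> {1} \<union> {1..n} \<times> {3}"
        using W(1) by (force simp: cut_grid_def)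
    qed (auto simp: adj_grid)
    then obtain y where "W \<subseteq> {1..n} \<times> {y}" by blast
    from card_mono[OF _ this] have "card W \<le> n" by (simp add: card_cartesian_product)
    then show False using W assms by simp
  qed
  then have "connected_sets (grid n) r (cut_grid n 0 0) = {}" by (auto simp: connected_sets_def)
  then show ?case using 0 by (simp add: shed_family.empty)
next
  case (Suc m)
  have r2: "r \<ge> 2" using assms by simp
  have bound: False if "W \<subseteq> S" "card S < 2 * n" "finite S" "card W = r" for W S :: "(nat \<times> nat) set"
    using card_mono[OF that(3,1)] that assms by simp
  show ?case
  proof (cases "p \<le> q")
    case True
    then have q: "q \<ge> 1" using Suc by simp
    define c where "c = n - q + 1"
    have c: "c \<le> n" "1 \<le> c" using q Suc by (auto simp: c_def)
    have del: "cut_grid n p q - {(c, 2)} = cut_grid n p (q - 1)"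
      using q Suc by (auto simp: cut_grid_def c_def)
    show ?thesis
    proof (rule shed_family_connected_sets_step[of _ _ "(c, 2)"])
      show "(c, 2) \<in> cut_grid n p q" using c q by (auto simp: cut_grid_def c_def)
      show "shed_family (cut_grid n p q - {(c, 2)})
          (connected_sets (grid n) r (cut_grid n p q - {(c, 2)}))"
        unfolding del using Suc q True by (intro Suc.hyps(1)) auto
      fix W assume "W \<in> connected_sets (grid n) r (cut_grid n p q - {(c, 2)})"
      then have W: "W \<subseteq> cut_grid n p q - {(c, 2)}" "card W = r" "connected_on (grid n) W"
        by (auto simp: connected_sets_def)
      have range: "x \<in> {1..n}" "y \<in> {1..3}" "y = 2 \<longrightarrow> x \<le> p \<or> n - q < x"
        if "(x, y) \<in> W" for x y using W(1) that by (auto simp: cut_grid_def)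
      have sub: "W \<subseteq> {1..n} \<times> {1..3}" "(c, 2) \<notin> W" using W(1) by (auto simp: cut_grid_def)
      have "\<not> W \<subseteq> {(x, y). x < c} \<and> \<not> W \<subseteq> {(x, y). c < x}"
      proof (intro conjI notI)
        assume 1: "W \<subseteq> {(x, y). x < c}"
        let ?S = "{1..n - q} \<times> {1, 3} \<union> {1..p} \<times> {2::nat}"
        have "w \<in> ?S" if "w \<in> W" for w
        proof (cases w)
          case (Pair x y)
          then show ?thesis using that 1 range[of x y] by (auto simp: c_def)
        qed
        then have "W \<subseteq> ?S" by blast
        moreover have "card ?S \<le> (n - q) * 2 + p"
          using card_Un_le[of "{1..n - q} \<times> {1, 3}" "{1..p} \<times> {2::nat}"]
          by (simp add: card_cartesian_product)
        moreover have "(n - q) * 2 + p < 2 * n" using Suc.prems Suc.hyps(2) True q by linarith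
        ultimately have "W \<subseteq> ?S" "card ?S < 2 * n" by linarith+
        then show False using bound[of W ?S] W(2) by simp
      next
        assume 2: "W \<subseteq> {(x, y). c < x}"
        let ?S = "{c + 1..n} \<times> {1..3::nat}"
        have "w \<in> ?S" if "w \<in> W" for w
        proof (cases w)
          case (Pair x y)
          then show ?thesis using that 2 range[of x y] by auto
        qed
        then have "W \<subseteq> ?S" by blast
        moreover have "card ?S < 2 * n"
          using Suc.prems Suc.hyps(2) True q by (simp add: card_cartesian_product c_def)
        ultimately show False using bound[of W ?S] W by simp
      qed
      then show "\<exists>w\<in>W. adj (grid n) w (c, 2)"
        using grid_neighbour_or_side[OF W(3) sub] c by auto
    qed (use r2 adj_grid_sym finite_cut_grid in auto)
  next
    case False
    then have p: "p \<ge> 1" by simp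
    have del: "cut_grid n p q - {(p, 2)} = cut_grid n (p - 1) q"
      using p Suc False by (auto simp: cut_grid_def)
    show ?thesis
    proof (rule shed_family_connected_sets_step[of _ _ "(p, 2)"])
      show "(p, 2) \<in> cut_grid n p q" using p Suc by (auto simp: cut_grid_def)
      show "shed_family (cut_grid n p q - {(p, 2)})
          (connected_sets (grid n) r (cut_grid n p q - {(p, 2)}))"
        unfolding del using Suc p False by (intro Suc.hyps(1)) auto
      fix W assume "W \<in> connected_sets (grid n) r (cut_grid n p q - {(p, 2)})"
      then have W: "W \<subseteq> cut_grid n p q - {(p, 2)}" "card W = r" "connected_on (grid n) W"
        by (auto simp: connected_sets_def)
      have range: "x \<in> {1..n}" "y \<in> {1..3}" "y = 2 \<longrightarrow> x \<le> p \<or> n - q < x"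
        if "(x, y) \<in> W" for x y using W(1) that by (auto simp: cut_grid_def)
      have sub: "W \<subseteq> {1..n} \<times> {1..3}" "(p, 2) \<notin> W" using W(1) by (auto simp: cut_grid_def)
      have "\<not> W \<subseteq> {(x, y). x < p} \<and> \<not> W \<subseteq> {(x, y). p < x}"
      proof (intro conjI notI)
        assume 1: "W \<subseteq> {(x, y). x < p}"
        let ?S = "{1..p - 1} \<times> {1..3::nat}"
        have "w \<in> ?S" if "w \<in> W" for w
        proof (cases w)
          case (Pair x y)
          then show ?thesis using that 1 range[of x y] by auto
        qed
        then have "W \<subseteq> ?S" by blast
        moreover have "card ?S < 2 * n"
          using Suc.prems Suc.hyps(2) False p by (simp add: card_cartesian_product)
        ultimately show False using bound[of W ?S] W by simp
      next
        assume 2: "W \<subseteq> {(x, y). p < x}"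
        let ?S = "{p + 1..n} \<times> {1, 3} \<union> {n - q + 1..n} \<times> {2::nat}"
        have "w \<in> ?S" if "w \<in> W" for w
        proof (cases w)
          case (Pair x y)
          then show ?thesis using that 2 range[of x y] by auto
        qed
        then have "W \<subseteq> ?S" by blast
        moreover have "card ?S \<le> (n - p) * 2 + (n - (n - q))"
          using card_Un_le[of "{p + 1..n} \<times> {1, 3}" "{n - q + 1..n} \<times> {2::nat}"]
          by (simp add: card_cartesian_product)
        moreover have "(n - p) * 2 + (n - (n - q)) < 2 * n"
          using Suc.prems Suc.hyps(2) False p by linarith
        ultimately have "W \<subseteq> ?S" "card ?S < 2 * n" by linarith+
        then show False using bound[of W ?S] W(2) by simp
      qed
      then show "\<exists>w\<in>W. adj (grid n) w (p, 2)"
        using grid_neighbour_or_side[OF W(3) sub] p Suc.prems(1) by auto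
    qed (use r2 adj_grid_sym finite_cut_grid in auto)
  qed
qed

lemma shed_family_Con_grid:
  assumes "2 * n \<le> r" "n \<ge> 1"
  shows "shed_family (verts (grid n)) (Con r (grid n))"
proof -
  \<comment> \<open>An even split of the full middle row, as the balance conditions demand.\<close>
  define p where "p = n div 2"
  have "cut_grid n p (n - p) = verts (grid n)" by (auto simp: cut_grid_def verts_grid)
  moreover have "Con r (grid n) = connected_sets (grid n) r (verts (grid n))"
    by (auto simp: Con_def connected_sets_def)
  moreover have "p + (n - p) \<le> n" "p \<le> n - p + 1" "n - p \<le> p + 1" by (auto simp: p_def)
  ultimately show ?thesis using shed_family_cut_grid[OF assms, of p "n - p"] by simp
qed

section \<open>Cohomological obstructions in the grid\<close>

lemma cobd_singleton: "cobd1 pos h {a} = h {}"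
proof -
  have "cobd1 pos h {a} = pos_sign pos a ({a}) * h {}"
    by (simp add: cobd_def)
  also have "{u \<in> {a}. pos u < pos a} = {}" by auto
  finally show ?thesis by simp
qed

lemma cobd_pair:
  assumes "pos a < pos b"
  shows "cobd1 pos h {a, b} = h {b} - h {a}"
proof -
  have ne: "a \<noteq> b" using assms by auto
  have 1: "{u \<in> {a, b}. pos u < pos a} = {}" "{u \<in> {a, b}. pos u < pos b} = {a}"
    using assms by auto
  have 2: "{a, b} - {a} = {b}" "{a, b} - {b} = {a}" using ne by auto
  have "cobd1 pos h {a, b} = (-1) ^ card {u \<in> {a, b}. pos u < pos a} * h ({a, b} - {a})
      + (-1) ^ card {u \<in> {a, b}. pos u < pos b} * h ({a, b} - {b})"
    unfolding cobd_def using ne by simp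
  then show ?thesis unfolding 1 2 by simp
qed

lemma cobd_triple:
  assumes "pos a < pos b" "pos b < pos d"
  shows "cobd1 pos h {a, b, d} = h {b, d} - h {a, d} + h {a, b}"
proof -
  have ne: "a \<noteq> b" "b \<noteq> d" "a \<noteq> d" using assms by auto
  have 1: "{u \<in> {a, b, d}. pos u < pos a} = {}" "{u \<in> {a, b, d}. pos u < pos b} = {a}"
    "{u \<in> {a, b, d}. pos u < pos d} = {a, b}" using assms by auto
  have 2: "{a, b, d} - {a} = {b, d}" "{a, b, d} - {b} = {a, d}" "{a, b, d} - {d} = {a, b}"
    using ne by auto
  have "cobd1 pos h {a, b, d} =
      (-1) ^ card {u \<in> {a, b, d}. pos u < pos a} * h ({a, b, d} - {a})
      + ((-1) ^ card {u \<in> {a, b, d}. pos u < pos b} * h ({a, b, d} - {b})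
      + (-1) ^ card {u \<in> {a, b, d}. pos u < pos d} * h ({a, b, d} - {d}))"
    unfolding cobd_def using ne by simp
  also have "\<dots> = h {b, d} + (- h {a, d} + h {a, b})"
    unfolding 1 2 using ne by simp
  finally show ?thesis by simp
qed

lemma card_2_ordered:
  assumes "card B = 2" "inj_on pos B"
  obtains a b where "B = {a, b}" "pos a < (pos b :: nat)"
proof -
  obtain x y where xy: "B = {x, y}" "x \<noteq> y" using assms(1) by (auto simp: card_2_iff)
  then have "pos x \<noteq> pos y" using assms(2) by (auto simp: inj_on_def)
  then show thesis using that[of x y] that[of y x] xy by (metis insert_commute nat_neq_iff)
qed

lemma card_3_ordered:
  assumes "card B = 3" "inj_on pos B"
  obtains a b d where "B = {a, b, d}" "pos a < (pos b :: nat)" "pos b < pos d"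
proof -
  have "finite B" "B \<noteq> {}" using assms(1) by (auto intro: card_ge_0_finite)
  then obtain a where a: "a \<in> B" "\<And>x. x \<in> B \<Longrightarrow> pos a \<le> pos x"
    using ex_is_arg_min_if_finite[of B pos] by (auto simp: is_arg_min_linorder)
  have "card (B - {a}) = 2" using a assms(1) \<open>finite B\<close> by simp
  moreover have "inj_on pos (B - {a})" using assms(2) by (rule inj_on_subset) auto
  ultimately obtain b d where bd: "B - {a} = {b, d}" "pos b < pos d" by (rule card_2_ordered)
  then have "b \<in> B" "b \<noteq> a" by auto
  then have "pos a \<noteq> pos b" using a(1) assms(2) by (auto simp: inj_on_def)
  then have "pos a < pos b" using a(2)[OF \<open>b \<in> B\<close>] by simp
  moreover have "B = {a, b, d}" using bd a(1) by blast
  ultimately show thesis using bd(2) that by blast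
qed

lemma connected_on_path:
  fixes f :: "nat \<Rightarrow> 'a"
  assumes sym: "\<And>a b. adj G a b \<Longrightarrow> adj G b a"
    and "\<And>i. Suc i < m \<Longrightarrow> adj G (f i) (f (Suc i))" and "m > 0"
  shows "connected_on G (f ` {..<m})"
  using assms(2,3)
proof (induction m)
  case (Suc m)
  show ?case
  proof (cases "m = 0")
    case True
    then show ?thesis by (simp add: lessThan_Suc connected_on_singleton)
  next
    case False
    then have conn: "connected_on G (f ` {..<m})" using Suc by auto
    have mem: "f (m - 1) \<in> f ` {..<m}" using False by auto
    have "adj G (f (m - 1)) (f m)" using Suc.prems(1)[of "m - 1"] False by simp
    then have "connected_on G (insert (f m) (f ` {..<m}))"
      using connected_on_insert[OF sym conn mem] by blast
    then show ?thesis by (simp add: lessThan_Suc)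
  qed
qed simp

text \<open>In a complex \<open>co_complex V D\<close> with \<open>D\<close> \<open>r\<close>-uniform, the link of \<open>V - U\<close> has facets of size
  \<open>card U - r\<close>; the class lives on faces of the smaller size \<open>k\<close>.\<close>

definition obstruction :: "'a set \<Rightarrow> nat \<Rightarrow> 'a set set \<Rightarrow> ('a set \<Rightarrow> 'r::comm_ring_1) \<Rightarrow> bool" where
  "obstruction U r D c \<longleftrightarrow> (\<exists>(pos :: 'a \<Rightarrow> nat) k. inj_on pos U \<and> k + r < card U \<and>
     (\<forall>B \<in> co_complex U {W \<in> D. W \<subseteq> U}. card B = Suc k \<longrightarrow> cobd1 pos c B = 0) \<and>
     \<not> (\<exists>b. \<forall>B \<in> co_complex U {W \<in> D. W \<subseteq> U}. card B = k \<longrightarrow> c B = cobd1 pos b B))"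

lemma not_co_chordal_obstruction:
  assumes "obstruction U r D c" "finite V" "U \<subseteq> V" "r \<ge> 1"
    and "\<And>W. W \<in> D \<Longrightarrow> W \<subseteq> V \<and> card W = r"
  shows "\<not> co_chordal_clutter V r D"
proof
  assume "co_chordal_clutter V r D"
  then have chordal: "chordal_clutter V r (complement_clutter V r D)" by (simp add: co_chordal_clutter_def)
  have L: "clutter_link U r (complement_clutter V r D) = co_complex U {W \<in> D. W \<subseteq> U}"
  proof (rule Set.set_eqI)
    fix B
    show "B \<in> clutter_link U r (complement_clutter V r D) \<longleftrightarrow> B \<in> co_complex U {W \<in> D. W \<subseteq> U}"
    proof
      assume "B \<in> clutter_link U r (complement_clutter V r D)"
      then obtain W where W: "B \<subseteq> U" "W \<subseteq> U - B" "card W = r" "W \<notin> complement_clutter V r D"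
        by (auto simp: clutter_link_def)
      then have "W \<in> D" using assms(3) by (auto simp: complement_clutter_def)
      moreover have "W \<subseteq> U" "B \<subseteq> U - W" using W by blast+
      ultimately show "B \<in> co_complex U {W \<in> D. W \<subseteq> U}" unfolding in_co_complex by blast
    next
      assume "B \<in> co_complex U {W \<in> D. W \<subseteq> U}"
      then obtain W where W: "W \<in> D" "W \<subseteq> U" "B \<subseteq> U - W" by (auto simp: in_co_complex)
      then have "card W = r" "W \<notin> complement_clutter V r D"
        using assms(5) by (auto simp: complement_clutter_def)
      moreover have "B \<subseteq> U" "W \<subseteq> U - B" using W by blast+
      ultimately show "B \<in> clutter_link U r (complement_clutter V r D)"
        unfolding clutter_link_def by blast
    qed
  qed
  obtain pos :: "'a \<Rightarrow> nat" and k where pk: "inj_on pos U" "k + r < card U"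
     "\<And>B. B \<in> co_complex U {W \<in> D. W \<subseteq> U} \<Longrightarrow> card B = Suc k \<Longrightarrow> cobd1 pos c B = 0"
     "\<not> (\<exists>b. \<forall>B \<in> co_complex U {W \<in> D. W \<subseteq> U}. card B = k \<longrightarrow> c B = cobd1 pos b B)"
    using assms(1) unfolding obstruction_def by blast
  have "card W = r" if "W \<in> complement_clutter V r D" for W
    using that by (simp add: complement_clutter_def)
  from chordal_cocycle[OF chordal assms(2,3) pk(1) assms(4) pk(2) this] pk(3,4)
  show False unfolding L by blast
qed

text \<open>No edge joins rows 1 and 3, so the only connected \<open>r\<close>-sets in
  \<open>U\<close> are the two rows themselves, and their complements in \<open>U\<close> span two
  disjoint simplices. The cocycle is the indicator of one of them, a class with
  \<open>k = 1\<close>; it is below the top because \<open>r \<ge> 2\<close>.\<close>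

lemma grid_obstruction_rows:
  assumes "2 \<le> r" "r \<le> n"
  shows "\<exists>U \<subseteq> verts (grid n). \<exists>c :: (nat \<times> nat) set \<Rightarrow> 'r::comm_ring_1. obstruction U r (Con r (grid n)) c"
proof -
  define U where "U = {1..r} \<times> {1::nat, 3}"
  define R where "R y = {1..r} \<times> {y::nat}" for y
  define pos :: "nat \<times> nat \<Rightarrow> nat" where "pos = (\<lambda>(x, y). x + (if y = 1 then 0 else n))"
  define c where "c B = (if B \<subseteq> R 1 then 1 else 0 :: 'r)" for B
  let ?D = "{W \<in> Con r (grid n). W \<subseteq> U}"
  have UR: "U = R 1 \<union> R 3" "R 1 \<inter> R 3 = {}" by (auto simp: U_def R_def)
  have card_R: "card (R y) = r" "finite (R y)" for y by (auto simp: R_def card_cartesian_product)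
  have conn: "connected_on (grid n) (R y)" if "y \<in> {1, 3}" for y
  proof -
    have "connected_on (grid n) ((\<lambda>i. (Suc i, y)) ` {..<r})"
      by (rule connected_on_path) (use assms that in \<open>auto simp: adj_grid intro: adj_grid_sym\<close>)
    moreover have "(\<lambda>i. (Suc i, y)) ` {..<r} = R y"
    proof -
      have "x \<in> Suc ` {..<r}" if "x \<in> {1..r}" for x
        using that by (intro image_eqI[of _ _ "x - 1"]) auto
      then show ?thesis by (force simp: R_def)
    qed
    ultimately show ?thesis by simp
  qed
  have sub: "R y \<in> ?D" if "y \<in> {1, 3}" for y
    using that conn[OF that] card_R assms by (auto simp: Con_def UR verts_grid) (auto simp: R_def)
  have only: "W = R 1 \<or> W = R 3" if "W \<in> ?D" for W
  proof -
    have W: "W \<subseteq> R 1 \<union> R 3" "card W = r" "connected_on (grid n) W"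
      using that by (auto simp: Con_def UR)
    have "W \<subseteq> R 1 \<or> W \<subseteq> R 3"
      by (rule connected_on_separate[OF W(3,1)]) (auto simp: R_def adj_grid)
    then show ?thesis using card_R W(2) card_subset_eq by metis
  qed
  have L: "B \<in> co_complex U ?D \<longleftrightarrow> B \<subseteq> R 1 \<or> B \<subseteq> R 3" for B
  proof
    assume "B \<in> co_complex U ?D"
    then obtain W where "W \<in> ?D" "B \<subseteq> U - W" by (auto simp: in_co_complex)
    with only[of W] show "B \<subseteq> R 1 \<or> B \<subseteq> R 3" using UR by blast
  next
    assume "B \<subseteq> R 1 \<or> B \<subseteq> R 3"
    then have "B \<subseteq> U - R 3 \<or> B \<subseteq> U - R 1" using UR by blast
    then show "B \<in> co_complex U ?D" using sub[of 1] sub[of 3] unfolding in_co_complex by blast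
  qed
  have inj: "inj_on pos U"
    using assms by (auto simp: inj_on_def pos_def U_def split: if_splits)
  have "card U = r + r" unfolding UR(1) using card_R UR(2) by (simp add: card_Un_disjoint)
  then have "1 + r < card U" using assms by simp
  moreover have "cobd1 pos c B = 0" if B: "B \<in> co_complex U ?D" "card B = Suc 1" for B
  proof -
    have "B \<subseteq> U" using B by (auto simp: in_co_complex)
    then have injB: "inj_on pos B" using inj inj_on_subset by blast
    have "card B = 2" using B by simp
    then obtain a b where ab: "B = {a, b}" "pos a < pos b" using injB by (rule card_2_ordered)
    moreover have "c {a} = c {b}" using B(1) UR(2) unfolding L ab(1) c_def by auto
    ultimately show ?thesis by (simp add: cobd_pair)
  qed
  moreover have "\<not> (\<exists>b. \<forall>B \<in> co_complex U ?D. card B = 1 \<longrightarrow> c B = cobd1 pos b B)"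
  proof
    assume "\<exists>b. \<forall>B \<in> co_complex U ?D. card B = 1 \<longrightarrow> c B = cobd1 pos b B"
    then obtain b where b: "\<And>v. {v} \<in> co_complex U ?D \<Longrightarrow> c {v} = b {}"
      by (auto simp: cobd_singleton)
    have "c {(1, 1)} = c {(1, 3)}"
      using b[of "(1, 1)"] b[of "(1, 3)"] assms unfolding L by (simp add: R_def)
    then show False using assms by (simp add: c_def R_def)
  qed
  ultimately have "obstruction U r (Con r (grid n)) c"
    unfolding obstruction_def using inj by blast
  moreover have "U \<subseteq> verts (grid n)" using assms by (auto simp: U_def verts_grid)
  ultimately show ?thesis by blast
qed

text \<open>For \<open>n \<ge> 3\<close> the boundary is an induced cycle of \<open>N\<close>
  vertices, so its connected \<open>r\<close>-sets are arcs. The class has \<open>k = 2\<close>, and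
  \<open>r < 2 * n\<close> means \<open>2 + r < N\<close>. From \<open>n < r\<close> it follows that
  two disjoint \<open>r\<close>-arcs cannot both avoid the two ends of an edge, which makes the
  winding of an edge well defined.\<close>

lemma grid_obstruction_cycle:
  assumes "n \<ge> 3" "n < r" "r < 2 * n"
  shows "\<exists>U \<subseteq> verts (grid n). \<exists>c :: (nat \<times> nat) set \<Rightarrow> 'r::comm_ring_1. obstruction U r (Con r (grid n)) c"
proof -
  define N where "N = 2 * n + 2"
  define U :: "(nat \<times> nat) set" where "U = {(x, y) \<in> {1..n} \<times> {1..3::nat}. y \<noteq> 2 \<or> x = 1 \<or> x = n}"
  define pos :: "nat \<times> nat \<Rightarrow> nat" where "pos = (\<lambda>(x, y). if y = 1 then x - 1 else if y = 3 then 2 * n + 1 - x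
    else if x = n then n else 2 * n + (1::nat))"
  define vtx :: "nat \<Rightarrow> nat \<times> nat" where "vtx i = (if i < n then (i + 1, 1) else if i = n then (n, 2)
    else if i \<le> 2 * n then (2 * n + 1 - i, 3) else (1, 2::nat))" for i
  \<comment> \<open>For an edge that is a face, some \<open>r\<close>-arc avoids both ends. If it
    lies between their positions, the ends are joined outside the arc through position 0; this
    crossing is what the value 1 counts.\<close>
  define c where "c B = (if \<exists>a\<in>B. \<exists>b\<in>B. pos a + r < pos b then 1 else 0 :: 'r)" for B
  let ?D = "{W \<in> Con r (grid n). W \<subseteq> U}"
  have y123: "y = 1 \<or> y = 2 \<or> y = 3" if "y \<in> {1..3}" for y :: nat using that by auto
  have pos_vtx: "pos (vtx i) = i" "vtx i \<in> U" if "i < N" for i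
    using that assms by (auto simp: pos_def vtx_def U_def N_def)
  have vtx_pos: "vtx (pos u) = u" "pos u < N" if "u \<in> U" for u
    using that assms by (cases u; auto simp: pos_def vtx_def U_def N_def dest!: y123)+
  have bij: "bij_betw pos U {..<N}"
    by (rule bij_betw_byWitness[of _ vtx]) (use pos_vtx vtx_pos in auto)
  have inj: "inj_on pos U" using bij by (simp add: bij_betw_def)
  have card_U: "card U = N" using bij_betw_same_card[OF bij] by simp
  have UV: "U \<subseteq> verts (grid n)" by (auto simp: U_def verts_grid)
  have adj_pos: "pos v = pos u + 1 \<or> pos u = pos v + 1 \<or>
      (pos u = 0 \<and> pos v = N - 1) \<or> (pos v = 0 \<and> pos u = N - 1)"
    if "u \<in> U" "v \<in> U" "adj (grid n) u v" for u v
    using that assms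
    by (cases u; cases v) (auto simp: pos_def U_def N_def adj_grid dest!: y123)
  have adj_vtx: "adj (grid n) (vtx i) (vtx (Suc i mod N))" if "i < N" for i
  proof (cases "Suc i = N")
    case True
    then show ?thesis using assms by (auto simp: vtx_def N_def adj_grid)
  next
    case False
    then have "Suc i mod N = Suc i" using that by simp
    then show ?thesis using that False assms by (auto simp: vtx_def N_def adj_grid)
  qed
  have edge: "{vtx i, vtx (Suc i mod N)} \<in> co_complex U ?D" if "i < N" for i
  proof -
    \<comment> \<open>The arc of \<open>r\<close> vertices starting directly after the edge from
      \<open>i\<close>; \<open>r + 2 < N\<close> prevents it from running back into the
      edge.\<close>
    define f where "f j = (i + 2 + j) mod N" for j
    have N0: "N > 0" by (simp add: N_def)
    have rN: "r + 2 < N" using assms by (simp add: N_def)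
    have f_ne: "f j \<noteq> (i + k) mod N" if "j < r" "k < 2" for j k
    proof
      assume "f j = (i + k) mod N"
      then have "N dvd (i + 2 + j) - (i + k)"
        using that by (simp add: f_def mod_eq_dvd_iff_nat)
      moreover have "(i + 2 + j) - (i + k) = 2 + j - k" using that by simp
      ultimately have "N \<le> 2 + j - k" using that by (intro dvd_imp_le) auto
      then show False using that rN by simp
    qed
    have f_inj: "inj_on f {..<r}"
    proof (rule linorder_inj_onI)
      fix j j' assume j: "j < j'" "j' \<in> {..<r}"
      show "f j \<noteq> f j'"
      proof
        assume "f j = f j'"
        then have "N dvd (i + 2 + j') - (i + 2 + j)"
          using j by (metis f_def add_le_cancel_left less_imp_le mod_eq_dvd_iff_nat)
        then have "N \<le> j' - j" using j by (intro dvd_imp_le) auto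
        then show False using j rN by simp
      qed
    qed auto
    define W where "W = (\<lambda>j. vtx (f j)) ` {..<r}"
    have f_lt: "f j < N" for j using N0 by (simp add: f_def)
    have posW: "pos ` W = f ` {..<r}" using pos_vtx f_lt by (auto simp: W_def image_image)
    have WU: "W \<subseteq> U" using pos_vtx f_lt by (auto simp: W_def)
    have "card W = card (pos ` W)" using WU inj by (metis card_image inj_on_subset)
    also have "\<dots> = r" unfolding posW using f_inj by (simp add: card_image)
    finally have cW: "card W = r" .
    have "connected_on (grid n) W"
      unfolding W_def
    proof (rule connected_on_path)
      fix j
      have "f (Suc j) = Suc (f j) mod N" by (simp add: f_def mod_Suc_eq)
      then show "adj (grid n) (vtx (f j)) (vtx (f (Suc j)))" using adj_vtx[OF f_lt] by simp
    qed (use assms adj_grid_sym in auto)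
    then have "W \<in> ?D" using WU UV cW by (auto simp: Con_def)
    moreover have "{vtx i, vtx (Suc i mod N)} \<subseteq> U - W"
    proof -
      have "vtx i \<in> U" "vtx (Suc i mod N) \<in> U" using pos_vtx that N0 by auto
      moreover have "vtx i \<notin> W"
      proof
        assume "vtx i \<in> W"
        then have "pos (vtx i) \<in> f ` {..<r}" using posW by blast
        then show False using f_ne[of _ 0] pos_vtx that by auto
      qed
      moreover have "vtx (Suc i mod N) \<notin> W"
      proof
        assume "vtx (Suc i mod N) \<in> W"
        then have "pos (vtx (Suc i mod N)) \<in> f ` {..<r}" using posW by blast
        then obtain j where "j < r" "pos (vtx (Suc i mod N)) = f j" by auto
        then show False using f_ne[of j 1] pos_vtx(1)[of "Suc i mod N"] N0 by simp
      qed
      ultimately show ?thesis by blast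
    qed
    ultimately show ?thesis unfolding in_co_complex by blast
  qed
  have card_pos: "card W \<le> card S" if "W \<subseteq> U" "pos ` W \<subseteq> S" "finite S" for W S
    using that inj by (metis card_image card_mono inj_on_subset)
  have cocycle: "cobd1 pos c B = 0" if B: "B \<in> co_complex U ?D" "card B = Suc 2" for B
  proof -
    obtain W where W: "W \<subseteq> U" "card W = r" "connected_on (grid n) W" "B \<subseteq> U - W"
      using B(1) by (auto simp: in_co_complex Con_def)
    have injB: "inj_on pos B" using W(4) inj inj_on_subset by blast
    have "card B = 3" using B by simp
    then obtain a b d where abd: "B = {a, b, d}" "pos a < pos b" "pos b < pos d"
      using injB by (rule card_3_ordered)
    have U: "a \<in> U" "b \<in> U" "d \<in> U" "a \<notin> W" "b \<notin> W" "d \<notin> W" using W(4) abd(1) by auto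
    have ne: "pos w \<noteq> pos a" "pos w \<noteq> pos b" "pos w \<noteq> pos d" "pos w < N" if "w \<in> W" for w
    proof -
      have "w \<in> U" "w \<noteq> a" "w \<noteq> b" "w \<noteq> d" using that U W(1) by auto
      then show "pos w \<noteq> pos a" "pos w \<noteq> pos b" "pos w \<noteq> pos d" "pos w < N"
        using inj_on_eq_iff[OF inj] U vtx_pos(2) by blast+
    qed
    have dN: "pos d < N" using U vtx_pos by simp
    let ?X = "{w. pos a < pos w \<and> pos w < pos d}" and ?Y = "{w. pos w < pos a \<or> pos d < pos w}"
    let ?X1 = "{w. pos a < pos w \<and> pos w < pos b}" and ?X2 = "{w. pos b < pos w \<and> pos w < pos d}"
    have "W \<subseteq> ?X \<or> W \<subseteq> ?Y"
    proof (rule connected_on_separate[OF W(3)])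
      show "W \<subseteq> ?X \<union> ?Y"
      proof
        fix w assume "w \<in> W"
        then have "pos w \<noteq> pos a" "pos w \<noteq> pos d" using ne by blast+
        then show "w \<in> ?X \<union> ?Y" by (simp only: Un_iff mem_Collect_eq) linarith
      qed
      fix x y assume "x \<in> ?X" "y \<in> ?Y" "x \<in> W" "y \<in> W"
      moreover from this have "x \<in> U" "y \<in> U" using W(1) by blast+
      ultimately show "\<not> adj (grid n) x y"
        using adj_pos[of x y] dN by auto
    qed
    moreover have "W \<subseteq> ?X1 \<or> W \<subseteq> ?X2" if "W \<subseteq> ?X"
    proof (rule connected_on_separate[OF W(3)])
      show "W \<subseteq> ?X1 \<union> ?X2"
      proof
        fix w assume "w \<in> W"
        then have "pos w \<noteq> pos b" "w \<in> ?X" using ne(2) that by blast+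
        then show "w \<in> ?X1 \<union> ?X2" by (auto simp: neq_iff)
      qed
      fix x y assume "x \<in> ?X1" "y \<in> ?X2" "x \<in> W" "y \<in> W"
      moreover from this have "x \<in> U" "y \<in> U" using W(1) by blast+
      ultimately show "\<not> adj (grid n) x y"
        using adj_pos[of x y] dN by auto
    qed
    \<comment> \<open>The \<open>r\<close>-arc lies in one of three gaps. Accordingly the values on
      \<open>{b, d}\<close>, \<open>{a, d}\<close>, \<open>{a, b}\<close> are 0, 1, 1 or 1, 1, 0 or
      0, 0, 0, and the alternating sum vanishes each time.\<close>
    ultimately consider "W \<subseteq> ?X1" | "W \<subseteq> ?X2" | "W \<subseteq> ?Y" by blast
    then have "(if pos b + r < pos d then 1 else 0) - (if pos a + r < pos d then 1 else 0)
        + (if pos a + r < pos b then 1 else 0) = (0 :: 'r)"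
    proof cases
      case 1
      then have "pos ` W \<subseteq> {pos a<..<pos b}" by auto
      from card_pos[OF W(1) this] have "r \<le> pos b - Suc (pos a)" using W(2) by simp
      then have "pos a + r < pos b" "pos a + r < pos d" using assms abd by linarith+
      moreover have "\<not> pos b + r < pos d" using \<open>pos a + r < pos b\<close> dN assms by (simp add: N_def)
      ultimately show ?thesis by simp
    next
      case 2
      then have "pos ` W \<subseteq> {pos b<..<pos d}" by auto
      from card_pos[OF W(1) this] have "r \<le> pos d - Suc (pos b)" using W(2) by simp
      then have "pos b + r < pos d" "pos a + r < pos d" using assms abd by linarith+
      moreover have "\<not> pos a + r < pos b" using \<open>pos b + r < pos d\<close> dN assms by (simp add: N_def)
      ultimately show ?thesis by simp
    next
      case 3
      then have "pos ` W \<subseteq> {..<pos a} \<union> {pos d<..<N}" using ne by auto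
      from card_pos[OF W(1) this] have "r \<le> card ({..<pos a} \<union> {pos d<..<N})" using W(2) by simp
      also have "\<dots> \<le> pos a + (N - Suc (pos d))"
        using card_Un_le[of "{..<pos a}" "{pos d<..<N}"] by simp
      finally have "r \<le> pos a + (N - Suc (pos d))" .
      then have "\<not> pos a + r < pos d" using dN assms by (simp add: N_def)
      then show ?thesis using abd by simp
    qed
    moreover have c2: "c {u, v} = (if pos u + r < pos v then 1 else 0)" if "pos u < pos v" for u v
      using that by (auto simp: c_def)
    ultimately show ?thesis using abd by (simp add: cobd_triple c2)
  qed
  have "\<not> (\<exists>b. \<forall>B \<in> co_complex U ?D. card B = 2 \<longrightarrow> c B = cobd1 pos b B)"
  proof
    assume "\<exists>b. \<forall>B \<in> co_complex U ?D. card B = 2 \<longrightarrow> c B = cobd1 pos b B"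
    then obtain b where b: "\<And>B. B \<in> co_complex U ?D \<Longrightarrow> card B = 2 \<Longrightarrow> c B = cobd1 pos b B"
      by blast
    have pair: "c {u, v} = b {v} - b {u}" if "{u, v} \<in> co_complex U ?D" "pos u < pos v" for u v
    proof -
      have "u \<noteq> v" using that by auto
      then show ?thesis using b[OF that(1)] that(2) by (simp add: cobd_pair)
    qed
    \<comment> \<open>Neighbouring positions differ by \<open>1 \<le> r\<close>, so a primitive is
      constant along the cycle from 0 to \<open>N - 1\<close>; the closing edge has positions more
      than \<open>r\<close> apart and value 1.\<close>
    have const: "b {vtx i} = b {vtx 0}" if "i < N" for i
      using that
    proof (induction i)
      case (Suc i)
      have mod: "Suc i mod N = Suc i" using Suc.prems by simp
      have "c {vtx i, vtx (Suc i)} = b {vtx (Suc i)} - b {vtx i}"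
        using pair[of "vtx i" "vtx (Suc i)"] edge[of i] Suc.prems pos_vtx mod by simp
      moreover have "c {vtx i, vtx (Suc i)} = 0"
        using pos_vtx Suc.prems assms by (auto simp: c_def)
      ultimately show ?case using Suc by simp
    qed simp
    have "c {vtx 0, vtx (N - 1)} = b {vtx (N - 1)} - b {vtx 0}"
      using pair[of "vtx 0" "vtx (N - 1)"] edge[of "N - 1"] pos_vtx
      by (simp add: N_def insert_commute)
    also have "\<dots> = 0" using const[of "N - 1"] by (simp add: N_def)
    finally have "c {vtx 0, vtx (N - 1)} = 0" .
    moreover have "c {vtx 0, vtx (N - 1)} = 1"
      using pos_vtx[of 0] pos_vtx[of "N - 1"] assms by (auto simp: c_def N_def)
    ultimately show False by simp
  qed
  then have "obstruction U r (Con r (grid n)) c"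
    unfolding obstruction_def using inj cocycle card_U assms
    by (intro exI[of _ pos] exI[of _ 2]) (auto simp: N_def)
  then show ?thesis using UV by blast
qed

section \<open>Vertex decomposability and shellability\<close>

lemma face_in_facet:
  assumes "finite \<Delta>" "F \<in> \<Delta>"
  shows "\<exists>H\<in>facets \<Delta>. F \<subseteq> H"
proof -
  have "finite {H \<in> \<Delta>. F \<subseteq> H}" "F \<in> {H \<in> \<Delta>. F \<subseteq> H}" using assms by auto
  then obtain H where H: "H \<in> {H \<in> \<Delta>. F \<subseteq> H}" "\<And>K. K \<in> {H \<in> \<Delta>. F \<subseteq> H} \<Longrightarrow> H \<subseteq> K \<Longrightarrow> H = K"
    using finite_has_maximal[of "{H \<in> \<Delta>. F \<subseteq> H}"] by (metis (no_types, lifting) empty_iff)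
  then have "H \<in> facets \<Delta>" using H(2) by (auto simp: facets_def)
  then show ?thesis using H(1) by blast
qed

lemma facets_Pow: "facets (Pow F) = {F}"
  by (auto simp: facets_def)

definition simplicial :: "'a set set \<Rightarrow> bool" where
  "simplicial \<Delta> \<longleftrightarrow> (\<forall>F\<in>\<Delta>. \<forall>A. A \<subseteq> F \<longrightarrow> A \<in> \<Delta>)"

lemma generated_complex_facets:
  assumes "finite \<Delta>" "simplicial \<Delta>"
  shows "generated_complex (facets \<Delta>) = \<Delta>"
  using assms face_in_facet[OF assms(1)]
  by (auto simp: generated_complex_def simplicial_def facets_def)

text \<open>The facets of \<open>\<Delta>\<close> are those of the deletion, in shelling order, followed by those of
  the cone over the link.\<close>

lemma shellable_shed:
  assumes fin: "finite \<Delta>" "\<And>F. F \<in> \<Delta> \<Longrightarrow> finite F" and simp: "simplicial \<Delta>"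
    and v: "{v} \<in> \<Delta>"
    and "shellable (link \<Delta> v)" "shellable (deletion \<Delta> v)"
    and shed: "facets (deletion \<Delta> v) \<subseteq> facets \<Delta>"
  shows "shellable \<Delta>"
proof -
  obtain Ls where Ls: "shelling (link \<Delta> v) Ls" using assms by (auto simp: shellable_def)
  obtain Ds where Ds: "shelling (deletion \<Delta> v) Ds" using assms by (auto simp: shellable_def)
  have down: "A \<in> \<Delta>" if "F \<in> \<Delta>" "A \<subseteq> F" for A F using simp that by (auto simp: simplicial_def)
  have link_del: "L \<in> deletion \<Delta> v" if "L \<in> link \<Delta> v" for L
    using that down by (auto simp: link_def deletion_def)
  have finD: "finite (deletion \<Delta> v)" using fin by (auto simp: deletion_def)
  have simpD: "simplicial (deletion \<Delta> v)" using down by (auto simp: simplicial_def deletion_def)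
  have setL: "set Ls = facets (link \<Delta> v)" and setD: "set Ds = facets (deletion \<Delta> v)"
    and distL: "distinct Ls" and distD: "distinct Ds"
    using Ls Ds by (auto simp: shelling_def)
  have vL: "v \<notin> L" if "L \<in> set Ls" for L using that setL by (auto simp: facets_def link_def)
  have facetsDelta: "facets \<Delta> = set Ds \<union> insert v ` set Ls"
  proof (intro equalityI subsetI)
    fix F assume F: "F \<in> facets \<Delta>"
    show "F \<in> set Ds \<union> insert v ` set Ls"
    proof (cases "v \<in> F")
      case True
      have "F - {v} \<in> facets (link \<Delta> v)"
        unfolding facets_def
      proof (intro CollectI conjI ballI impI)
        show "F - {v} \<in> link \<Delta> v" using F True by (auto simp: facets_def link_def insert_absorb)
        fix H assume H: "H \<in> link \<Delta> v" "F - {v} \<subseteq> H"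
        then have "insert v H \<in> \<Delta>" "F \<subseteq> insert v H" "v \<notin> H" by (auto simp: link_def)
        then have "F = insert v H" using F by (auto simp: facets_def)
        then show "F - {v} = H" using \<open>v \<notin> H\<close> by auto
      qed
      then have "insert v (F - {v}) \<in> insert v ` set Ls" using setL by blast
      then show ?thesis using True by (simp add: insert_absorb)
    next
      case False
      then have "F \<in> facets (deletion \<Delta> v)" using F by (auto simp: facets_def deletion_def)
      then show ?thesis using setD by simp
    qed
  next
    fix F assume "F \<in> set Ds \<union> insert v ` set Ls"
    then show "F \<in> facets \<Delta>"
    proof
      assume "F \<in> set Ds" then show ?thesis using shed setD by auto
    next
      assume "F \<in> insert v ` set Ls"
      then obtain L where L: "L \<in> facets (link \<Delta> v)" "F = insert v L" using setL by auto
      then have L': "L \<in> link \<Delta> v" "v \<notin> L" "\<And>H. H \<in> link \<Delta> v \<Longrightarrow> L \<subseteq> H \<Longrightarrow> L = H"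
        by (auto simp: facets_def link_def)
      show ?thesis
        unfolding facets_def
      proof (intro CollectI conjI ballI impI)
        show "F \<in> \<Delta>" using L L' by (auto simp: link_def)
        fix H assume H: "H \<in> \<Delta>" "F \<subseteq> H"
        then have vH: "v \<in> H" using L by blast
        then have "H - {v} \<in> link \<Delta> v" using H by (auto simp: link_def insert_absorb)
        moreover have "L \<subseteq> H - {v}" using H L L'(2) by blast
        ultimately have "L = H - {v}" by (rule L'(3))
        then show "F = H" using L vH by auto
      qed
    qed
  qed
  define Fs where "Fs = Ds @ map (insert v) Ls"
  have injv: "inj_on (insert v) (set Ls)" using vL by (intro inj_onI) (metis insert_ident)
  have vD: "v \<notin> D" if "D \<in> set Ds" for D using that setD by (auto simp: facets_def deletion_def)
  have dist: "distinct Fs"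
    using distL distD injv vD by (auto simp: Fs_def distinct_map)
  have codim: "card H + 1 = card (Fs ! j)"
    if j: "0 < j" "j < length Fs" and H: "H \<in> facets (Pow (Fs ! j) \<inter> generated_complex (set (take j Fs)))"
    for j H
  proof (cases "j < length Ds")
    case True
    then have "Fs ! j = Ds ! j" "take j Fs = take j Ds" by (auto simp: Fs_def nth_append)
    then show ?thesis using Ds j True H by (auto simp: shelling_def)
  next
    case False
    define i where "i = j - length Ds"
    have i: "i < length Ls" using j False by (auto simp: Fs_def i_def)
    define L where "L = Ls ! i"
    have LL: "L \<in> set Ls" using i by (simp add: L_def)
    then have L: "L \<in> link \<Delta> v" "v \<notin> L" using setL vL by (auto simp: facets_def)
    then have finL: "finite L" using fin(2)[of "insert v L"] by (simp add: link_def)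
    have Fj: "Fs ! j = insert v L" using False i by (simp add: Fs_def nth_append i_def L_def)
    have take: "set (take j Fs) = set Ds \<union> insert v ` set (take i Ls)"
      using False by (auto simp: Fs_def i_def take_map)
    let ?K = "Pow L \<inter> generated_complex (set (take i Ls))"
    \<comment> \<open>\<open>L\<close> is a face of the deletion and so lies in an earlier facet. It
      is therefore the only facet of this intersection without \<open>v\<close>; the others are
      facets of \<open>?K\<close> with \<open>v\<close> added.\<close>
    have inter: "A \<in> Pow (Fs ! j) \<inter> generated_complex (set (take j Fs)) \<longleftrightarrow>
       A \<subseteq> L \<or> (v \<in> A \<and> A - {v} \<in> ?K)" for A
    proof
      assume A: "A \<in> Pow (Fs ! j) \<inter> generated_complex (set (take j Fs))"
      then have AL: "A \<subseteq> insert v L" unfolding Fj by simp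
      show "A \<subseteq> L \<or> (v \<in> A \<and> A - {v} \<in> ?K)"
      proof (cases "v \<in> A")
        case True
        then obtain F where "F \<in> set (take i Ls)" "A \<subseteq> insert v F"
          using A vD unfolding take by (auto simp: generated_complex_def)
        then show ?thesis using True AL by (auto simp: generated_complex_def)
      qed (use AL in auto)
    next
      assume A: "A \<subseteq> L \<or> (v \<in> A \<and> A - {v} \<in> ?K)"
      then show "A \<in> Pow (Fs ! j) \<inter> generated_complex (set (take j Fs))"
      proof
        assume "A \<subseteq> L"
        moreover obtain D where "D \<in> set Ds" "L \<subseteq> D"
          using face_in_facet[OF finD link_del[OF L(1)]] setD by blast
        ultimately show ?thesis unfolding Fj take generated_complex_def by blast
      next
        assume "v \<in> A \<and> A - {v} \<in> ?K"
        then show ?thesis unfolding Fj take generated_complex_def by blast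
      qed
    qed
    have H1: "H \<subseteq> L \<or> (v \<in> H \<and> H - {v} \<in> ?K)"
      and H2: "\<And>A. A \<subseteq> L \<or> (v \<in> A \<and> A - {v} \<in> ?K) \<Longrightarrow> H \<subseteq> A \<Longrightarrow> H = A"
      using H unfolding facets_def mem_Collect_eq Ball_def inter by blast+
    from H1 show ?thesis
    proof
      assume "H \<subseteq> L"
      then have "H = L" using H2 by blast
      then show ?thesis unfolding Fj using L(2) finL by simp
    next
      assume vH: "v \<in> H \<and> H - {v} \<in> ?K"
      have "H - {v} \<in> facets ?K"
        unfolding facets_def
      proof (intro CollectI conjI ballI impI)
        fix A assume A: "A \<in> ?K" "H - {v} \<subseteq> A"
        then have "v \<notin> A" using L(2) by blast
        then have "insert v A - {v} = A" by simp
        then have "H = insert v A" using H2[of "insert v A"] A by auto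
        then show "H - {v} = A" using \<open>v \<notin> A\<close> by simp
      qed (use vH in auto)
      moreover have "0 < i"
      proof (rule ccontr)
        assume "\<not> 0 < i"
        then show False using vH by (simp add: generated_complex_def)
      qed
      ultimately have "card (H - {v}) + 1 = card L"
        using Ls i unfolding shelling_def L_def by blast
      moreover have "finite H" using vH finL finite_subset[of "H - {v}" L] by auto
      then have "card H = Suc (card (H - {v}))" using vH by (intro card.remove) auto
      ultimately show ?thesis unfolding Fj using L(2) finL by simp
    qed
  qed
  have "shelling \<Delta> Fs"
    unfolding shelling_def
  proof (intro conjI allI impI ballI)
    show "distinct Fs" by (rule dist)
    show "set Fs = facets \<Delta>" unfolding facetsDelta by (simp add: Fs_def)
  qed (use codim in blast)
  then show ?thesis by (auto simp: shellable_def)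
qed

lemma vertex_decomposable_imp_shellable:
  assumes "vertex_decomposable \<Delta>" "finite \<Delta>" "\<And>F. F \<in> \<Delta> \<Longrightarrow> finite F" "simplicial \<Delta>"
  shows "shellable \<Delta>"
  using assms
proof (induction rule: vertex_decomposable.induct)
  case void
  have "shelling {} []" by (simp add: shelling_def facets_def)
  then show ?case by (auto simp: shellable_def)
next
  case (simplex F)
  have "shelling (Pow F) [F]" by (simp add: shelling_def facets_Pow)
  then show ?case by (auto simp: shellable_def)
next
  case (shed v \<Delta>)
  have down: "A \<in> \<Delta>" if "F \<in> \<Delta>" "A \<subseteq> F" for A F
    using shed.prems(3) that by (auto simp: simplicial_def)
  have sub: "link \<Delta> v \<subseteq> \<Delta>" "deletion \<Delta> v \<subseteq> \<Delta>" using down by (auto simp: link_def deletion_def)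
  have fin1: "finite (link \<Delta> v)" and fin2: "finite (deletion \<Delta> v)"
    using sub shed.prems(1) finite_subset by blast+
  have "simplicial (link \<Delta> v)"
    unfolding simplicial_def link_def by (auto intro: down)
  then have 1: "shellable (link \<Delta> v)"
    using fin1 sub(1) shed.prems(2) by (intro shed.IH(1)) auto
  have "simplicial (deletion \<Delta> v)"
    unfolding simplicial_def deletion_def using down by auto
  then have 2: "shellable (deletion \<Delta> v)"
    using fin2 sub(2) shed.prems(2) by (intro shed.IH(2)) auto
  show ?case
    by (rule shellable_shed[OF shed.prems shed.hyps(1) 1 2 shed.hyps(4)])
qed

section \<open>Regular sequences from shellings\<close>

text \<open>Subsets of an ambient ring type stand for modules over a subring \<open>S\<close>.
  Polynomials in the variables \<open>V\<close> and their ideals can then be handled with the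
  operations of the type, without ring records.\<close>

definition submod :: "'r::comm_ring_1 set \<Rightarrow> 'r set \<Rightarrow> bool" where
  "submod S M \<longleftrightarrow> 0 \<in> M \<and> (\<forall>a\<in>M. \<forall>b\<in>M. a + b \<in> M) \<and> (\<forall>c\<in>S. \<forall>a\<in>M. c * a \<in> M)"

definition subring1 :: "'r::comm_ring_1 set \<Rightarrow> bool" where
  "subring1 S \<longleftrightarrow> submod S S \<and> 1 \<in> S \<and> - 1 \<in> S"

lemma submodD:
  assumes "submod S M"
  shows "0 \<in> M" "a \<in> M \<Longrightarrow> b \<in> M \<Longrightarrow> a + b \<in> M" "c \<in> S \<Longrightarrow> a \<in> M \<Longrightarrow> c * a \<in> M"
  using assms by (auto simp: submod_def)

lemma submod_uminus: "subring1 S \<Longrightarrow> submod S M \<Longrightarrow> a \<in> M \<Longrightarrow> - a \<in> M"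
  using submodD(3)[of S M "- 1" a] by (auto simp: subring1_def)

lemma submod_diff: "subring1 S \<Longrightarrow> submod S M \<Longrightarrow> a \<in> M \<Longrightarrow> b \<in> M \<Longrightarrow> a - b \<in> M"
  using submodD(2)[of S M a "- b"] submod_uminus by auto

lemma submod_sum: "submod S M \<Longrightarrow> (\<And>i. i \<in> I \<Longrightarrow> f i \<in> M) \<Longrightarrow> sum f I \<in> M"
  by (induction I rule: infinite_finite_induct) (auto simp: submod_def)

lemma subring1D:
  assumes "subring1 S"
  shows "submod S S" "1 \<in> S" "0 \<in> S" "a \<in> S \<Longrightarrow> b \<in> S \<Longrightarrow> a + b \<in> S"
    "a \<in> S \<Longrightarrow> b \<in> S \<Longrightarrow> a * b \<in> S" "a \<in> S \<Longrightarrow> b \<in> S \<Longrightarrow> a - b \<in> S" "a \<in> S \<Longrightarrow> - a \<in> S"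
  using assms submod_diff[OF assms, of S] submod_uminus[OF assms, of S]
  by (auto simp: subring1_def submod_def)

lemma subring1_power: "subring1 S \<Longrightarrow> a \<in> S \<Longrightarrow> a ^ n \<in> S"
  by (induction n) (auto simp: subring1D)

text \<open>The submodule \<open>B + x A\<close>, by which \<open>A\<close> is divided to reduce
  \<open>A / B\<close> modulo \<open>x\<close>.\<close>

definition adjoin :: "'r::comm_ring_1 set \<Rightarrow> 'r \<Rightarrow> 'r set \<Rightarrow> 'r set" where
  "adjoin B x A = {b + x * a | b a. b \<in> B \<and> a \<in> A}"

lemma in_adjoin: "b \<in> B \<Longrightarrow> a \<in> A \<Longrightarrow> b + x * a \<in> adjoin B x A"
  by (auto simp: adjoin_def)

lemma adjoin_superset: "0 \<in> A \<Longrightarrow> B \<subseteq> adjoin B x A"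
  using in_adjoin[of _ B 0 A x] by auto

lemma submod_adjoin:
  assumes "submod S B" "submod S A"
  shows "submod S (adjoin B x A)"
  unfolding submod_def
proof (intro conjI ballI)
  show "0 \<in> adjoin B x A" using in_adjoin[of 0 B 0 A x] assms by (auto simp: submodD)
  fix p q assume "p \<in> adjoin B x A" "q \<in> adjoin B x A"
  then obtain b a b' a' where "p = b + x * a" "q = b' + x * a'" "b \<in> B" "a \<in> A" "b' \<in> B" "a' \<in> A"
    by (auto simp: adjoin_def)
  then have "p + q = (b + b') + x * (a + a')" "b + b' \<in> B" "a + a' \<in> A"
    using assms by (auto simp: submodD algebra_simps)
  then show "p + q \<in> adjoin B x A" using in_adjoin by metis
next
  fix c p assume "c \<in> S" "p \<in> adjoin B x A"
  then obtain b a where "p = b + x * a" "b \<in> B" "a \<in> A" by (auto simp: adjoin_def)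
  then have "c * p = c * b + x * (c * a)" "c * b \<in> B" "c * a \<in> A"
    using submodD(3)[OF assms(1) \<open>c \<in> S\<close>] submodD(3)[OF assms(2) \<open>c \<in> S\<close>]
    by (simp_all add: algebra_simps)
  then show "c * p \<in> adjoin B x A" using in_adjoin by metis
qed

lemma adjoin_subset:
  assumes "submod S A" "B \<subseteq> A" "x \<in> S"
  shows "adjoin B x A \<subseteq> A"
  using assms by (auto simp: adjoin_def submod_def)

text \<open>Weak regularity on the quotient \<open>A / B\<close>: a proper last quotient is not required.\<close>

fun wreg :: "'r::comm_ring_1 list \<Rightarrow> 'r set \<Rightarrow> 'r set \<Rightarrow> bool" where
  "wreg [] A B \<longleftrightarrow> True"
| "wreg (x # xs) A B \<longleftrightarrow> (\<forall>a\<in>A. x * a \<in> B \<longrightarrow> a \<in> B) \<and> wreg xs A (adjoin B x A)"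

lemma wreg_trivial: "A \<subseteq> B \<Longrightarrow> 0 \<in> A \<Longrightarrow> wreg xs A B"
proof (induction xs arbitrary: B)
  case (Cons x xs)
  then have "A \<subseteq> adjoin B x A" using adjoin_superset by blast
  then show ?case using Cons by auto
qed simp

text \<open>Multiplication by \<open>m\<close> identifies \<open>A0 / B0\<close> with
  \<open>A\<close> modulo \<open>B\<close>. The identification survives adjoining
  \<open>x A0\<close> and \<open>x A\<close>, so regularity transfers element by element.\<close>

lemma wreg_iso:
  assumes S: "subring1 S" "set xs \<subseteq> S" and A: "submod S A0" "submod S A"
    and B: "submod S B0" "submod S B" "B0 \<subseteq> A0"
    and m: "\<And>a. a \<in> A0 \<Longrightarrow> m * a \<in> A" "\<And>a. a \<in> A0 \<Longrightarrow> m * a \<in> B \<longleftrightarrow> a \<in> B0"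
      "\<And>a. a \<in> A \<Longrightarrow> \<exists>a0\<in>A0. \<exists>b\<in>B. a = m * a0 + b"
    and "wreg xs A0 B0"
  shows "wreg xs A B"
  using assms
proof (induction xs arbitrary: B0 B)
  case (Cons x xs)
  have x: "x \<in> S" using Cons.prems by simp
  have reg0: "a \<in> B0" if "a \<in> A0" "x * a \<in> B0" for a using Cons.prems(11) that by simp
  have 1: "y \<in> B" if y: "y \<in> A" "x * y \<in> B" for y
  proof -
    obtain a0 b where ab: "a0 \<in> A0" "b \<in> B" "y = m * a0 + b" using Cons.prems(10) y by blast
    have "x * b \<in> B" using ab x Cons.prems(6) by (simp add: submodD)
    then have "x * y - x * b \<in> B" using y submod_diff[OF S(1) Cons.prems(6)] by blast
    then have "m * (x * a0) \<in> B" using ab by (simp add: algebra_simps)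
    moreover have "x * a0 \<in> A0" using ab x Cons.prems(3) by (simp add: submodD)
    ultimately have "a0 \<in> B0" using Cons.prems(9) reg0 ab by blast
    then have "m * a0 \<in> B" using Cons.prems(9) ab by blast
    then show ?thesis using ab Cons.prems(6) by (simp add: submodD)
  qed
  have "wreg xs A (adjoin B x A)"
  proof (rule Cons.IH)
    show "subring1 S" "set xs \<subseteq> S" "submod S A0" "submod S A" using Cons.prems by auto
    show "submod S (adjoin B0 x A0)" "submod S (adjoin B x A)"
      using Cons.prems by (auto intro: submod_adjoin)
    show "adjoin B0 x A0 \<subseteq> A0" using adjoin_subset[OF Cons.prems(3) Cons.prems(7) x] .
    show "m * a \<in> A" if "a \<in> A0" for a using Cons.prems(8) that .
    show "\<exists>a0\<in>A0. \<exists>b\<in>adjoin B x A. a = m * a0 + b" if a: "a \<in> A" for a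
    proof -
      obtain a0 b where "a0 \<in> A0" "b \<in> B" "a = m * a0 + b" using Cons.prems(10)[OF a] by blast
      moreover have "B \<subseteq> adjoin B x A" using Cons.prems(4) by (simp add: adjoin_superset submodD)
      ultimately show ?thesis by blast
    qed
    show "wreg xs A0 (adjoin B0 x A0)" using Cons.prems(11) by simp
    show "m * a \<in> adjoin B x A \<longleftrightarrow> a \<in> adjoin B0 x A0" if a: "a \<in> A0" for a
    proof
      assume "m * a \<in> adjoin B x A"
      then obtain b a' where ba: "m * a = b + x * a'" "b \<in> B" "a' \<in> A" by (auto simp: adjoin_def)
      then obtain a1 b1 where ab: "a1 \<in> A0" "b1 \<in> B" "a' = m * a1 + b1"
        using Cons.prems(10) by blast
      have "m * (a - x * a1) = b + x * b1" using ba ab by (simp add: algebra_simps)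
      moreover have "b + x * b1 \<in> B" using ba ab x Cons.prems(6) by (simp add: submodD)
      moreover have "a - x * a1 \<in> A0"
        using a ab x submod_diff[OF S(1) Cons.prems(3)] submodD(3)[OF Cons.prems(3)] by blast
      ultimately have "a - x * a1 \<in> B0" using Cons.prems(9) by metis
      then show "a \<in> adjoin B0 x A0" using in_adjoin[of "a - x * a1" B0 a1 A0 x] ab by simp
    next
      assume "a \<in> adjoin B0 x A0"
      then obtain b0 a1 where b0: "a = b0 + x * a1" "b0 \<in> B0" "a1 \<in> A0" by (auto simp: adjoin_def)
      then have "m * b0 \<in> B" "m * a1 \<in> A" using Cons.prems(7,8,9) by blast+
      then show "m * a \<in> adjoin B x A"
        using in_adjoin[of "m * b0" B "m * a1" A x] b0 by (simp add: algebra_simps)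
    qed
  qed
  then show ?case using 1 by simp
qed simp

text \<open>Regularity on the two ends of the exact sequence from \<open>A' / B\<close> over
  \<open>A / B\<close> to \<open>A / A'\<close> gives it in the middle. The sequence stays exact
  modulo \<open>x\<close> because \<open>x\<close> is a nonzerodivisor on \<open>A / A'\<close>: an
  \<open>x * a1\<close> in \<open>A'\<close> forces \<open>a1\<close> into
  \<open>A'\<close>.\<close>

lemma wreg_exact:
  assumes S: "subring1 S" "set xs \<subseteq> S" and "submod S A" "submod S A'" "submod S B"
    and "B \<subseteq> A'" "A' \<subseteq> A" "wreg xs A' B" "wreg xs A A'"
  shows "wreg xs A B"
  using assms
proof (induction xs arbitrary: A' B)
  case (Cons x xs)
  have x: "x \<in> S" "set xs \<subseteq> S" using Cons.prems by auto
  have 1: "a \<in> B" if "a \<in> A" "x * a \<in> B" for a using Cons.prems that by auto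
  let ?B = "adjoin B x A" and ?A' = "adjoin A' x A"
  have sub: "submod S ?B" "submod S ?A'" "submod S (adjoin B x A')"
    using Cons.prems by (auto intro: submod_adjoin)
  have "wreg xs ?A' ?B"
  proof (rule wreg_iso[of S xs A' ?A' "adjoin B x A'" ?B 1])
    show "adjoin B x A' \<subseteq> A'" by (rule adjoin_subset[OF Cons.prems(4,6) x(1)])
    have A'_sub: "A' \<subseteq> ?A'" using Cons.prems(3) by (simp add: adjoin_superset submodD)
    then show "1 * a \<in> ?A'" if "a \<in> A'" for a using that by auto
    show "1 * a \<in> ?B \<longleftrightarrow> a \<in> adjoin B x A'" if a: "a \<in> A'" for a
    proof
      assume "1 * a \<in> ?B"
      then obtain b a1 where ba: "a = b + x * a1" "b \<in> B" "a1 \<in> A" by (auto simp: adjoin_def)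
      then have "x * a1 = a - b" by simp
      also have "\<dots> \<in> A'" using a ba Cons.prems(6) submod_diff[OF S(1) Cons.prems(4)] by blast
      finally have "a1 \<in> A'" using Cons.prems(9) ba by simp
      then show "a \<in> adjoin B x A'" using ba in_adjoin by auto
    next
      assume "a \<in> adjoin B x A'"
      then show "1 * a \<in> ?B" using Cons.prems(7) by (auto simp: adjoin_def)
    qed
    show "\<exists>a0\<in>A'. \<exists>b\<in>?B. a = 1 * a0 + b" if "a \<in> ?A'" for a
    proof -
      from that obtain a' a1 where "a = a' + x * a1" "a' \<in> A'" "a1 \<in> A" by (auto simp: adjoin_def)
      moreover then have "0 + x * a1 \<in> ?B" using Cons.prems(5) by (intro in_adjoin) (auto simp: submodD)
      ultimately show ?thesis by auto
    qed
    show "wreg xs A' (adjoin B x A')" using Cons.prems(8) by simp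
  qed (use S x sub Cons.prems in auto)
  moreover have "wreg xs A ?A'" using Cons.prems(9) by simp
  moreover have "?B \<subseteq> ?A'" using Cons.prems(6) by (auto simp: adjoin_def)
  moreover have "?A' \<subseteq> A" by (rule adjoin_subset[OF Cons.prems(3,7) x(1)])
  ultimately have "wreg xs A ?B"
    using Cons.IH[OF S(1) x(2) Cons.prems(3) sub(2,1)] by blast
  then show ?case using 1 by simp
qed simp

section \<open>Polynomials and ideals spanned by monomials\<close>

abbreviation "single \<equiv> Poly_Mapping.single"
abbreviation "keys \<equiv> Poly_Mapping.keys"
abbreviation "lookup \<equiv> Poly_Mapping.lookup"

type_synonym ('a, 'k) mpoly = "('a \<Rightarrow>\<^sub>0 nat) \<Rightarrow>\<^sub>0 'k"

lemma keys_plus_nat: "keys (a + b) = keys a \<union> keys (b :: 'a \<Rightarrow>\<^sub>0 nat)"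
  by (auto simp: in_keys_iff lookup_add)

lemma sum_monomials: "p = (\<Sum>k\<in>keys p. single k (lookup p k))"
  by (rule poly_mapping_eqI)
    (auto simp: lookup_sum lookup_single when_def in_keys_iff sum.delta)

lemma monomial_mult:
  fixes p :: "('a::cancel_comm_monoid_add) \<Rightarrow>\<^sub>0 ('k::comm_semiring_1)"
  shows "lookup (single m c * p) (m + j) = c * lookup p j"
proof -
  have "single m c * p = single m c * (\<Sum>k\<in>keys p. single k (lookup p k))"
    by (subst sum_monomials[of p]) simp
  also have "\<dots> = (\<Sum>k\<in>keys p. single (m + k) (c * lookup p k))"
    by (simp add: sum_distrib_left mult_single)
  finally have "lookup (single m c * p) (m + j) = (\<Sum>k\<in>keys p. (c * lookup p k when k = j))"
    by (simp add: lookup_sum lookup_single)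
  also have "\<dots> = c * lookup p j"
    by (auto simp: when_def sum.delta' in_keys_iff)
  finally show ?thesis .
qed

lemma keys_monomial_mult:
  fixes p :: "('a::cancel_comm_monoid_add) \<Rightarrow>\<^sub>0 ('k::comm_semiring_1)"
  shows "keys (single m 1 * p) = (+) m ` keys p"
proof
  show "keys (single m 1 * p) \<subseteq> (+) m ` keys p"
    using keys_mult[of "single m (1 :: 'k)" p] by (auto split: if_splits)
  show "(+) m ` keys p \<subseteq> keys (single m 1 * p)"
    using monomial_mult[of m 1 p] by (auto simp: in_keys_iff)
qed

definition polys :: "'a set \<Rightarrow> ('a, 'k::field) mpoly set" where
  "polys V = {p. \<forall>m\<in>keys p. keys m \<subseteq> V}"

text \<open>The Stanley-Reisner ideal in terms of monomial supports, which lets membership be tested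
  one monomial at a time. Its agreement with the ideal generated by squarefree monomials is
  \<open>stanley_reisner_ideal_eq\<close>.\<close>

definition nonface_ideal :: "'a set \<Rightarrow> 'a set set \<Rightarrow> ('a, 'k::field) mpoly set" where
  "nonface_ideal V \<Delta> = {p \<in> polys V. \<forall>m\<in>keys p. keys m \<notin> \<Delta>}"

lemma polys_eq: "polys V = nonface_ideal V {}"
  by (simp add: nonface_ideal_def)

lemma nonface_idealI: "(\<And>m. m \<in> keys p \<Longrightarrow> keys m \<subseteq> V \<and> keys m \<notin> \<Delta>) \<Longrightarrow> p \<in> nonface_ideal V \<Delta>"
  by (auto simp: nonface_ideal_def polys_def)

lemma nonface_idealD: "p \<in> nonface_ideal V \<Delta> \<Longrightarrow> m \<in> keys p \<Longrightarrow> keys m \<subseteq> V \<and> keys m \<notin> \<Delta>"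
  by (auto simp: nonface_ideal_def polys_def)

lemma submod_nonface_ideal:
  assumes "simplicial \<Delta>"
  shows "submod (polys V) (nonface_ideal V \<Delta> :: ('a, 'k::field) mpoly set)"
  unfolding submod_def
proof (intro conjI ballI)
  show "0 \<in> (nonface_ideal V \<Delta> :: ('a, 'k) mpoly set)" by (rule nonface_idealI) simp
  fix p q :: "('a, 'k) mpoly"
  assume "p \<in> nonface_ideal V \<Delta>" "q \<in> nonface_ideal V \<Delta>"
  then show "p + q \<in> nonface_ideal V \<Delta>"
    using keys_add[of p q] by (intro nonface_idealI) (blast dest: nonface_idealD)
next
  fix p q :: "('a, 'k) mpoly"
  assume p: "p \<in> polys V" and q: "q \<in> nonface_ideal V \<Delta>"
  show "p * q \<in> nonface_ideal V \<Delta>"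
  proof (rule nonface_idealI)
    fix m assume "m \<in> keys (p * q)"
    then obtain a b where ab: "m = a + b" "a \<in> keys p" "b \<in> keys q" using keys_mult[of p q] by blast
    then have "keys a \<subseteq> V" "keys b \<subseteq> V" "keys b \<notin> \<Delta>"
      using p q by (auto simp: polys_def dest: nonface_idealD)
    then show "keys m \<subseteq> V \<and> keys m \<notin> \<Delta>"
      using assms unfolding ab(1) keys_plus_nat simplicial_def by blast
  qed
qed

lemma subring1_polys: "subring1 (polys V)"
  unfolding subring1_def polys_eq using submod_nonface_ideal[of "{}" V]
  by (auto simp: simplicial_def polys_eq intro!: nonface_idealI)

lemma nonface_ideal_subsetI:
  fixes M :: "('a, 'k::field) mpoly set"
  assumes "0 \<in> M" "\<And>a b. a \<in> M \<Longrightarrow> b \<in> M \<Longrightarrow> a + b \<in> M"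
    and "\<And>m c. keys m \<subseteq> V \<Longrightarrow> keys m \<notin> \<Delta> \<Longrightarrow> single m c \<in> M"
  shows "nonface_ideal V \<Delta> \<subseteq> M"
proof
  fix p :: "('a, 'k) mpoly" assume p: "p \<in> nonface_ideal V \<Delta>"
  have "(\<Sum>k\<in>K. single k (lookup p k)) \<in> M" if "finite K" "K \<subseteq> keys p" for K
    using that
  proof (induction K rule: finite_induct)
    case (insert k K)
    then have "single k (lookup p k) \<in> M"
      using p by (intro assms(3)) (auto dest: nonface_idealD)
    then show ?case using insert assms(2) by simp
  qed (use assms(1) in simp)
  from this[of "keys p"] show "p \<in> M" by (simp flip: sum_monomials)
qed

definition expo :: "'a set \<Rightarrow> 'a \<Rightarrow>\<^sub>0 nat" where
  "expo A = (\<Sum>v\<in>A. single v 1)"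

lemma lookup_expo: "finite A \<Longrightarrow> lookup (expo A) v = (if v \<in> A then 1 else 0)"
  by (simp add: expo_def lookup_sum lookup_single when_def)

lemma keys_expo: "finite A \<Longrightarrow> keys (expo A) = A"
  by (auto simp: in_keys_iff lookup_expo split: if_splits)

definition xmon :: "'a set \<Rightarrow> ('a, 'k::field) mpoly" where
  "xmon A = single (expo A) 1"

lemma keys_xmon_mult: "keys (xmon A * p) = (+) (expo A) ` keys p"
  by (simp add: xmon_def keys_monomial_mult)

lemma keys_in_xmon_mult:
  assumes "finite A" "m \<in> keys (xmon A * p)"
  obtains k where "k \<in> keys p" "keys m = A \<union> keys k"
  using assms by (auto simp: keys_xmon_mult keys_plus_nat keys_expo)

lemma xmon_in_polys: "finite A \<Longrightarrow> A \<subseteq> V \<Longrightarrow> xmon A \<in> polys V"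
  by (auto simp: xmon_def polys_def keys_expo)

lemma monomial_factor:
  assumes "finite A" "A \<subseteq> keys m"
  shows "single m c = xmon A * single (m - expo A) c"
proof -
  have "expo A + (m - expo A) = m"
    by (rule poly_mapping_eqI)
      (use assms in \<open>auto simp: lookup_add lookup_minus lookup_expo in_keys_iff subset_iff Suc_leI\<close>)
  then show ?thesis by (simp add: xmon_def mult_single)
qed

section \<open>Elementary symmetric polynomials on a shelled complex\<close>

definition esym :: "'a set \<Rightarrow> nat \<Rightarrow> ('a, 'k::field) mpoly" where
  "esym V i = (\<Sum>A | A \<subseteq> V \<and> card A = i. xmon A)"

text \<open>The highest degree comes first: on a facet with \<open>s\<close> vertices it becomes the
  product of all variables, and dividing by it leaves the boundary of the facet for the remaining
  \<open>s - 1\<close> polynomials.\<close>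

fun esyms :: "'a set \<Rightarrow> nat \<Rightarrow> ('a, 'k::field) mpoly list" where
  "esyms V 0 = []"
| "esyms V (Suc s) = esym V (Suc s) # esyms V s"

lemma length_esyms [simp]: "length (esyms V s) = s"
  by (induction s) auto

lemma esym_in_polys: "finite V \<Longrightarrow> esym V i \<in> polys V"
  unfolding esym_def
  by (rule submod_sum[OF subring1D(1)[OF subring1_polys]]) (auto intro: xmon_in_polys dest: finite_subset)

lemma esyms_in_polys: "finite V \<Longrightarrow> set (esyms V s) \<subseteq> polys V"
  by (induction s) (auto simp: esym_in_polys)

text \<open>\<open>R\<close> is the restriction set of the facet \<open>F\<close> in the shelling.\<close>

inductive shelled :: "nat \<Rightarrow> 'a set set \<Rightarrow> bool" for s where
  empty: "shelled s {}"
| step: "\<lbrakk>shelled s \<Delta>; finite F; card F = s; R \<subseteq> F; \<forall>A. A \<subseteq> F \<longrightarrow> (A \<in> \<Delta> \<longleftrightarrow> \<not> R \<subseteq> A)\<rbrakk>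
    \<Longrightarrow> shelled s (\<Delta> \<union> Pow F)"

lemma shelled_simplicial: "shelled s \<Delta> \<Longrightarrow> simplicial \<Delta>"
  by (induction rule: shelled.induct) (auto simp: simplicial_def)

text \<open>The facets \<open>F - {x}\<close> may be added in any order; the restriction set of
  \<open>F - {x}\<close> consists of the vertices \<open>X\<close> whose opposite facets were added
  before.\<close>

lemma shelled_boundary:
  assumes "finite F" "card F = Suc s"
  shows "shelled s (Pow F - {F})"
proof -
  have "shelled s {A. A \<subseteq> F \<and> \<not> X \<subseteq> A}" if "finite X" "X \<subseteq> F" for X
    using that
  proof (induction X rule: finite_induct)
    case empty
    then show ?case by (simp add: shelled.empty)
  next
    case (insert x X)
    have "{A. A \<subseteq> F \<and> \<not> insert x X \<subseteq> A} = {A. A \<subseteq> F \<and> \<not> X \<subseteq> A} \<union> Pow (F - {x})" by blast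
    moreover have "shelled s ({A. A \<subseteq> F \<and> \<not> X \<subseteq> A} \<union> Pow (F - {x}))"
      by (rule shelled.step[where R = X]) (use insert assms in auto)
    ultimately show ?case by simp
  qed
  from this[of F] assms have "shelled s {A. A \<subseteq> F \<and> \<not> F \<subseteq> A}" by simp
  moreover have "{A. A \<subseteq> F \<and> \<not> F \<subseteq> A} = Pow F - {F}" by blast
  ultimately show ?thesis by simp
qed

lemma esym_mod_simplex:
  assumes "finite V" "F \<subseteq> V" "card F = s"
  shows "esym V s - xmon F \<in> nonface_ideal V (Pow F)"
proof -
  have fin: "finite {A. A \<subseteq> V \<and> card A = s}" using assms(1) by simp
  have "esym V s - xmon F = (\<Sum>A\<in>{A. A \<subseteq> V \<and> card A = s} - {F}. xmon A)"
    unfolding esym_def using fin assms by (subst sum.remove[of _ F]) auto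
  also have "\<dots> \<in> nonface_ideal V (Pow F)"
  proof (rule submod_sum[of "polys V"])
    fix A assume A: "A \<in> {A. A \<subseteq> V \<and> card A = s} - {F}"
    then have "finite A" "finite F" using assms finite_subset by blast+
    then have "\<not> A \<subseteq> F" using card_subset_eq[OF \<open>finite F\<close>, of A] A assms(3) by auto
    then show "xmon A \<in> nonface_ideal V (Pow F)"
      using A \<open>finite A\<close> by (intro nonface_idealI) (auto simp: xmon_def keys_expo)
  qed (rule submod_nonface_ideal, auto simp: simplicial_def)
  finally show ?thesis .
qed

text \<open>Modulo \<open>esym V (Suc t)\<close>, which is the product of all variables on the simplex, the
  simplex becomes its boundary; the boundary is shellable of one dimension less.\<close>

lemma wreg_simplex:
  fixes V :: "'a set"
  assumes V: "finite V" and F: "F \<subseteq> V" "card F = Suc t"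
    and bd: "wreg (esyms V t) (polys V) (nonface_ideal V (Pow F - {F}) :: ('a, 'k::field) mpoly set)"
  shows "wreg (esyms V (Suc t)) (polys V) (nonface_ideal V (Pow F) :: ('a, 'k) mpoly set)"
proof -
  let ?J = "nonface_ideal V (Pow F) :: ('a, 'k) mpoly set"
  let ?e = "esym V (Suc t) :: ('a, 'k) mpoly"
  define e' where "e' = ?e - xmon F"
  have e': "e' \<in> ?J" unfolding e'_def by (rule esym_mod_simplex[OF V F])
  have finF: "finite F" using F V finite_subset by blast
  have sub: "submod (polys V) ?J" by (rule submod_nonface_ideal) (auto simp: simplicial_def)
  have sub': "submod (polys V) (nonface_ideal V (Pow F - {F}) :: ('a, 'k) mpoly set)"
    by (rule submod_nonface_ideal) (auto simp: simplicial_def)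
  have e'_mult: "e' * a \<in> ?J" if "a \<in> polys V" for a
    using submodD(3)[OF sub that e'] by (simp add: mult.commute)
  have split: "?e * a = xmon F * a + e' * a" for a by (simp add: e'_def algebra_simps)
  have 1: "a \<in> ?J" if a: "a \<in> polys V" "?e * a \<in> ?J" for a
  proof (rule nonface_idealI)
    fix m assume m: "m \<in> keys a"
    have "?e * a - e' * a \<in> ?J" by (rule submod_diff[OF subring1_polys sub a(2) e'_mult[OF a(1)]])
    then have "xmon F * a \<in> ?J" using split by simp
    moreover have "expo F + m \<in> keys (xmon F * a)" using m by (simp add: keys_xmon_mult)
    ultimately have "\<not> F \<union> keys m \<subseteq> F"
      using finF by (auto dest!: nonface_idealD simp: keys_plus_nat keys_expo)
    then show "keys m \<subseteq> V \<and> keys m \<notin> Pow F" using a m by (auto simp: polys_def)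
  qed
  have "adjoin ?J ?e (polys V) = nonface_ideal V (Pow F - {F})"
  proof
    show "adjoin ?J ?e (polys V) \<subseteq> nonface_ideal V (Pow F - {F})"
    proof
      fix p assume "p \<in> adjoin ?J ?e (polys V)"
      then obtain b a where ba: "p = b + ?e * a" "b \<in> ?J" "a \<in> polys V" by (auto simp: adjoin_def)
      have J: "?J \<subseteq> nonface_ideal V (Pow F - {F})" by (auto simp: nonface_ideal_def)
      have "xmon F * a \<in> nonface_ideal V (Pow F - {F})"
      proof (rule nonface_idealI)
        fix m assume "m \<in> keys (xmon F * a)"
        then obtain k where "k \<in> keys a" "keys m = F \<union> keys k" by (rule keys_in_xmon_mult[OF finF])
        moreover then have "keys k \<subseteq> V" using ba(3) by (auto simp: polys_def)
        ultimately show "keys m \<subseteq> V \<and> keys m \<notin> Pow F - {F}" using F by blast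
      qed
      then show "p \<in> nonface_ideal V (Pow F - {F})"
        unfolding ba(1) split using J ba(2) e'_mult[OF ba(3)] submodD(2)[OF sub'] by blast
    qed
    show "nonface_ideal V (Pow F - {F}) \<subseteq> adjoin ?J ?e (polys V)"
    proof (rule nonface_ideal_subsetI)
      have adj: "submod (polys V) (adjoin ?J ?e (polys V))"
        using sub subring1_polys by (intro submod_adjoin) (auto simp: subring1_def)
      show "0 \<in> adjoin ?J ?e (polys V)" using adj by (rule submodD)
      show "a + b \<in> adjoin ?J ?e (polys V)"
        if "a \<in> adjoin ?J ?e (polys V)" "b \<in> adjoin ?J ?e (polys V)" for a b
        using submodD(2)[OF adj that] .
      fix m :: "'a \<Rightarrow>\<^sub>0 nat" and c :: 'k assume m: "keys m \<subseteq> V" "keys m \<notin> Pow F - {F}"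
      show "single m c \<in> adjoin ?J ?e (polys V)"
      proof (cases "keys m \<subseteq> F")
        case False
        then have "single m c \<in> ?J" using m by (intro nonface_idealI) (auto split: if_splits)
        then show ?thesis using adjoin_superset[of "polys V" ?J ?e] subring1D(3)[OF subring1_polys] by blast
      next
        case True
        then have "keys m = F" using m by blast
        let ?q = "single (m - expo F) c"
        have "keys (m - expo F) \<subseteq> keys m" by (auto simp: in_keys_iff lookup_minus)
        then have q: "?q \<in> polys V" using m by (auto simp: polys_def)
        have "single m c = xmon F * ?q"
          by (rule monomial_factor) (use finF \<open>keys m = F\<close> in auto)
        also have "\<dots> = - (e' * ?q) + ?e * ?q" using split[of ?q] by simp
        also have "\<dots> \<in> adjoin ?J ?e (polys V)"
          using submod_uminus[OF subring1_polys sub e'_mult[OF q]] q by (rule in_adjoin)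
        finally show ?thesis .
      qed
    qed
  qed
  then show ?thesis using 1 bd by simp
qed

text \<open>The faces gained with \<open>F\<close> are those between \<open>R\<close> and
  \<open>F\<close>, so multiplication by \<open>xmon R\<close> identifies the ring of the simplex
  \<open>F\<close> with the quotient of the old ideal by the new one. \<open>wreg_simplex\<close>,
  fed with the boundary of \<open>F\<close> from the induction on \<open>s\<close>, treats that
  piece, and \<open>wreg_exact\<close> glues it to the ring of the earlier facets.\<close>

lemma wreg_shelled:
  fixes V :: "'a set"
  assumes V: "finite V"
  shows "shelled s \<Delta> \<Longrightarrow> \<Union>\<Delta> \<subseteq> V \<Longrightarrow>
    wreg (esyms V s) (polys V) (nonface_ideal V \<Delta> :: ('a, 'k::field) mpoly set)"
proof (induction s arbitrary: \<Delta>)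
  case 0
  then show ?case by simp
next
  case (Suc t)
  from Suc.prems show ?case
  proof (induction rule: shelled.induct)
    case empty
    then show ?case
      using wreg_trivial[of "polys V :: ('a, 'k) mpoly set"] subring1D(3)[OF subring1_polys, of V]
      unfolding polys_eq[symmetric] by blast
  next
    case (step \<Delta> F R)
    let ?A = "polys V :: ('a, 'k) mpoly set"
    let ?A' = "nonface_ideal V \<Delta> :: ('a, 'k) mpoly set"
    let ?B = "nonface_ideal V (\<Delta> \<union> Pow F) :: ('a, 'k) mpoly set"
    let ?J = "nonface_ideal V (Pow F) :: ('a, 'k) mpoly set"
    have F: "F \<subseteq> V" and R: "R \<subseteq> V" "finite R"
      using step.prems step.hyps(2,4) finite_subset by blast+
    have simp: "simplicial \<Delta>" "simplicial (Pow F)" "simplicial (\<Delta> \<union> Pow F)"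
      using shelled_simplicial[OF step.hyps(1)] by (auto simp: simplicial_def)
    have sA: "submod ?A ?A" using subring1_polys by (rule subring1D)
    have sA': "submod ?A ?A'" and sB: "submod ?A ?B" and sJ: "submod ?A ?J"
      using simp by (auto intro: submod_nonface_ideal)
    have RD: "R \<union> X \<notin> \<Delta>" for X
    proof
      assume "R \<union> X \<in> \<Delta>"
      then have "R \<in> \<Delta>" using simp(1) by (auto simp: simplicial_def)
      then show False using step.hyps(4,5) by blast
    qed
    have "wreg (esyms V t) ?A (nonface_ideal V (Pow F - {F}))"
      using Suc.IH[OF shelled_boundary[OF step.hyps(2,3)]] F by blast
    then have regF: "wreg (esyms V (Suc t)) ?A ?J" by (rule wreg_simplex[OF V F step.hyps(3)])
    have "wreg (esyms V (Suc t)) ?A' ?B"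
    proof (rule wreg_iso[OF subring1_polys esyms_in_polys[OF V] sA sA' sJ sB _ _ _ _ regF, where m = "xmon R"])
      show "?J \<subseteq> ?A" by (auto simp: nonface_ideal_def)
      show "xmon R * a \<in> ?A'" if a: "a \<in> ?A" for a
      proof (rule nonface_idealI)
        fix m assume "m \<in> keys (xmon R * a)"
        then obtain k where k: "k \<in> keys a" "keys m = R \<union> keys k" by (rule keys_in_xmon_mult[OF R(2)])
        then have "keys k \<subseteq> V" using a by (auto simp: polys_def)
        then show "keys m \<subseteq> V \<and> keys m \<notin> \<Delta>" using k R RD by simp
      qed
      show "xmon R * a \<in> ?B \<longleftrightarrow> a \<in> ?J" if a: "a \<in> ?A" for a
      proof
        assume B: "xmon R * a \<in> ?B"
        show "a \<in> ?J"
        proof (rule nonface_idealI)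
          fix m assume m: "m \<in> keys a"
          then have "expo R + m \<in> keys (xmon R * a)" by (simp add: keys_xmon_mult)
          from nonface_idealD[OF B this] have "\<not> R \<union> keys m \<subseteq> F"
            using R by (simp add: keys_plus_nat keys_expo)
          then show "keys m \<subseteq> V \<and> keys m \<notin> Pow F" using step.hyps(4) a m by (auto simp: polys_def)
        qed
      next
        assume J: "a \<in> ?J"
        show "xmon R * a \<in> ?B"
        proof (rule nonface_idealI)
          fix m assume "m \<in> keys (xmon R * a)"
          then obtain k where k: "k \<in> keys a" "keys m = R \<union> keys k" by (rule keys_in_xmon_mult[OF R(2)])
          then have "keys k \<subseteq> V" "\<not> keys k \<subseteq> F" using nonface_idealD[OF J k(1)] by auto
          then show "keys m \<subseteq> V \<and> keys m \<notin> \<Delta> \<union> Pow F" using k R RD by simp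
        qed
      qed
      show "\<exists>a0\<in>?A. \<exists>b\<in>?B. a = xmon R * a0 + b" if "a \<in> ?A'" for a
      proof -
        have "?A' \<subseteq> {a. \<exists>a0\<in>?A. \<exists>b\<in>?B. a = xmon R * a0 + b}"
        proof (rule nonface_ideal_subsetI)
          show "0 \<in> {a. \<exists>a0\<in>?A. \<exists>b\<in>?B. a = xmon R * a0 + b}"
            using submodD(1)[OF sA] submodD(1)[OF sB] by (auto intro!: bexI[of _ 0])
          fix p q assume "p \<in> {a. \<exists>a0\<in>?A. \<exists>b\<in>?B. a = xmon R * a0 + b}"
            "q \<in> {a. \<exists>a0\<in>?A. \<exists>b\<in>?B. a = xmon R * a0 + b}"
          then obtain a b a' b' where "p = xmon R * a + b" "q = xmon R * a' + b'"
            "a \<in> ?A" "a' \<in> ?A" "b \<in> ?B" "b' \<in> ?B" by blast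
          then have "p + q = xmon R * (a + a') + (b + b')" "a + a' \<in> ?A" "b + b' \<in> ?B"
            using submodD(2)[OF sA] submodD(2)[OF sB] by (auto simp: algebra_simps)
          then show "p + q \<in> {a. \<exists>a0\<in>?A. \<exists>b\<in>?B. a = xmon R * a0 + b}" by blast
        next
          fix m :: "'a \<Rightarrow>\<^sub>0 nat" and c :: 'k assume m: "keys m \<subseteq> V" "keys m \<notin> \<Delta>"
          show "single m c \<in> {a. \<exists>a0\<in>?A. \<exists>b\<in>?B. a = xmon R * a0 + b}"
          proof (cases "keys m \<subseteq> F")
            case True
            then have "R \<subseteq> keys m" using m step.hyps(5) by blast
            then have eq: "single m c = xmon R * single (m - expo R) c + 0"
              using monomial_factor[OF R(2), of m c] by simp
            have "keys (m - expo R) \<subseteq> keys m" by (auto simp: in_keys_iff lookup_minus)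
            then have "single (m - expo R) c \<in> ?A" using m by (auto simp: polys_def)
            then show ?thesis using eq submodD(1)[OF sB] by blast
          next
            case False
            then have "single m c \<in> ?B"
              using m by (intro nonface_idealI) (auto split: if_splits)
            moreover have "single m c = xmon R * 0 + single m c" by simp
            ultimately show ?thesis using submodD(1)[OF sA] by blast
          qed
        qed
        then show ?thesis using that by blast
      qed
    qed
    moreover have "wreg (esyms V (Suc t)) ?A ?A'" using step.IH step.prems by blast
    moreover have "?B \<subseteq> ?A'" "?A' \<subseteq> ?A" by (auto simp: nonface_ideal_def)
    ultimately show ?case
      using wreg_exact[OF subring1_polys esyms_in_polys[OF V] sA sA' sB] by blast
  qed
qed

section \<open>Koszul cohomology\<close>

lemma generated_complex_Un: "generated_complex (X \<union> Y) = generated_complex X \<union> generated_complex Y"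
  by (auto simp: generated_complex_def)

lemma generated_complex_singleton: "generated_complex {F} = Pow F"
  by (auto simp: generated_complex_def)

lemma generated_complex_empty: "generated_complex {} = {}"
  by (auto simp: generated_complex_def)

lemma generated_complex_down: "F \<in> generated_complex X \<Longrightarrow> A \<subseteq> F \<Longrightarrow> A \<in> generated_complex X"
  by (auto simp: generated_complex_def)

text \<open>The restriction set of \<open>F\<close> collects the vertices opposite to the
  codimension-one faces already covered. Purity of the intersection says that every face of
  \<open>F\<close> covered before lies in one of these, that is, misses an element of
  \<open>R\<close>.\<close>

lemma shelling_imp_shelled:
  assumes "shelling \<Delta> Fs" "finite \<Delta>" "simplicial \<Delta>"
    and pure: "\<And>F. F \<in> facets \<Delta> \<Longrightarrow> finite F \<and> card F = s"
  shows "shelled s \<Delta>"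
proof -
  have set: "set Fs = facets \<Delta>" using assms(1) by (simp add: shelling_def)
  have "shelled s (generated_complex (set (take k Fs)))" if "k \<le> length Fs" for k
    using that
  proof (induction k)
    case 0
    then show ?case by (simp add: generated_complex_empty shelled.empty)
  next
    case (Suc k)
    define F where "F = Fs ! k"
    let ?\<Gamma> = "generated_complex (set (take k Fs))"
    have "F \<in> set Fs" using Suc.prems by (simp add: F_def)
    then have F: "finite F" "card F = s" using pure set by auto
    define R where "R = (if k = 0 then {} else {v \<in> F. F - {v} \<in> ?\<Gamma>})"
    have R: "A \<in> ?\<Gamma> \<longleftrightarrow> \<not> R \<subseteq> A" if A: "A \<subseteq> F" for A
    proof (cases "k = 0")
      case True
      then show ?thesis by (simp add: R_def generated_complex_empty)
    next
      case False
      show ?thesis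
      proof
        assume "\<not> R \<subseteq> A"
        then obtain v where "F - {v} \<in> ?\<Gamma>" "v \<notin> A" using False by (auto simp: R_def)
        then show "A \<in> ?\<Gamma>" using generated_complex_down A by (metis subset_Diff_insert Diff_empty)
      next
        assume "A \<in> ?\<Gamma>"
        then have "A \<in> Pow F \<inter> ?\<Gamma>" using A by simp
        moreover have "finite (Pow F \<inter> ?\<Gamma>)" using F by simp
        ultimately obtain H where H: "H \<in> facets (Pow F \<inter> ?\<Gamma>)" "A \<subseteq> H"
          using face_in_facet by blast
        then have "card H + 1 = card F"
          using assms(1) False Suc.prems unfolding shelling_def F_def by auto
        moreover have HF: "H \<subseteq> F" "H \<in> ?\<Gamma>" using H by (auto simp: facets_def)
        ultimately have "card (F - H) = 1" using F by (simp add: card_Diff_subset finite_subset)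
        then obtain v where v: "F - H = {v}" by (rule card_1_singletonE)
        then have "H = F - {v}" using HF by blast
        then have "v \<in> R" using HF v False by (auto simp: R_def)
        then show "\<not> R \<subseteq> A" using v H by blast
      qed
    qed
    have "shelled s (?\<Gamma> \<union> Pow F)"
    proof (rule shelled.step[where R = R])
      show "shelled s ?\<Gamma>" using Suc by simp
      show "R \<subseteq> F" by (auto simp: R_def)
      show "\<forall>A. A \<subseteq> F \<longrightarrow> (A \<in> ?\<Gamma>) = (\<not> R \<subseteq> A)" using R by blast
    qed (rule F)+
    moreover have "set (take (Suc k) Fs) = set (take k Fs) \<union> {F}"
      using Suc.prems by (simp add: take_Suc_conv_app_nth F_def)
    ultimately show ?case by (simp only: generated_complex_Un generated_complex_singleton)
  qed
  from this[of "length Fs"] have "shelled s (generated_complex (facets \<Delta>))" by (simp add: set)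
  then show ?thesis using generated_complex_facets assms by metis
qed

section \<open>Contractions and vanishing for the Koszul complex\<close>

lemma sign_swap:
  assumes fin: "finite T" and inj: "inj_on pos T" and tv: "t \<in> T" "v \<in> T" "t \<noteq> v"
  shows "pos_sign pos t (T - {v}) * pos_sign pos v (T - {t}) =
    - (pos_sign pos v T * pos_sign pos t T :: 'r::comm_ring_1)"
proof -
  have "pos t \<noteq> pos v" using inj tv by (auto simp: inj_on_def)
  then consider "pos v < pos t" | "pos t < pos v" by linarith
  then show ?thesis
  proof cases
    case 1
    show ?thesis
      unfolding pos_sign_remove(1)[OF fin tv(2) 1] pos_sign_remove(2)[OF fin tv(2) 1]
      by (simp add: mult.commute)
  next
    case 2
    show ?thesis
      unfolding pos_sign_remove(1)[OF fin tv(1) 2] pos_sign_remove(2)[OF fin tv(1) 2]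
      by (simp add: mult.commute)
  qed
qed

lemma cobd_in_submod:
  assumes "subring1 S" "submod S M" "\<And>t. t \<in> T \<Longrightarrow> y t \<in> S" "\<And>t. t \<in> T \<Longrightarrow> h (T - {t}) \<in> M"
  shows "cobd pos y h T \<in> M"
  unfolding cobd_def
proof (rule submod_sum[OF assms(2)])
  fix t assume t: "t \<in> T"
  have "pos_sign pos t T * y t \<in> S"
    using assms(1,3) t by (intro subring1D(5) subring1_power) (auto simp: subring1_def)
  then show "pos_sign pos t T * y t * h (T - {t}) \<in> M"
    by (rule submodD(3)[OF assms(2) _ assms(4)[OF t]])
qed

lemma cobd_sum:
  "cobd pos y (\<lambda>A. \<Sum>i\<in>I. a i * h i A) T = (\<Sum>i\<in>I. a i * cobd pos y (h i) T)"
  unfolding cobd_def sum_distrib_left by (subst sum.swap) (simp only: mult_ac)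

text \<open>Contraction with \<open>v\<close> is a homotopy between multiplication by \<open>y v\<close> and zero.\<close>

lemma cobd_contraction:
  fixes g :: "'a set \<Rightarrow> 'r::comm_ring_1"
  assumes "finite T" "inj_on pos (insert v T)"
  defines "h \<equiv> \<lambda>A. if v \<in> A then 0 else pos_sign pos v (insert v A) * g (insert v A)"
  shows "y v * g T - cobd pos y h T =
    (if v \<in> T then 0 else pos_sign pos v (insert v T) * cobd pos y g (insert v T))"
proof (cases "v \<in> T")
  case True
  have "cobd pos y h T = (\<Sum>t\<in>T. if t = v then y v * g T else 0)"
    unfolding cobd_def
  proof (rule sum.cong)
    fix t assume t: "t \<in> T"
    show "pos_sign pos t T * y t * h (T - {t}) = (if t = v then y v * g T else 0)"
    proof (cases "t = v")
      case True
      have "insert v (T - {v}) = T" using \<open>v \<in> T\<close> by auto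
      then have "h (T - {v}) = pos_sign pos v T * g T" by (simp add: h_def)
      then show ?thesis using True by (simp add: mult_ac)
    qed (use True in \<open>simp add: h_def\<close>)
  qed simp
  also have "\<dots> = y v * g T" using True assms(1) by simp
  finally show ?thesis using True by simp
next
  case False
  let ?s = "pos_sign pos v (insert v T) :: 'r"
  let ?R = "\<Sum>t\<in>T. pos_sign pos t (insert v T) * y t * g (insert v T - {t})"
  have ss: "?s * (?s * x) = x" for x by (simp add: mult.assoc[symmetric])
  have "cobd pos y h T = (\<Sum>t\<in>T. - (?s * (pos_sign pos t (insert v T) * y t * g (insert v T - {t}))))"
    unfolding cobd_def
  proof (rule sum.cong)
    fix t assume t: "t \<in> T"
    have eq: "insert v (T - {t}) = insert v T - {t}" "insert v T - {v} = T" using t False by auto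
    have "pos_sign pos t (insert v T - {v}) *
        pos_sign pos v (insert v T - {t}) =
        - (?s * pos_sign pos t (insert v T) :: 'r)"
      by (rule sign_swap) (use assms t False in auto)
    then have sw: "pos_sign pos t T *
        pos_sign pos v (insert v (T - {t})) =
        - (?s * pos_sign pos t (insert v T) :: 'r)" unfolding eq .
    have "h (T - {t}) = pos_sign pos v (insert v (T - {t})) * g (insert v T - {t})"
      using False eq(1) by (simp add: h_def)
    then have "pos_sign pos t T * y t * h (T - {t}) =
       (pos_sign pos t T * pos_sign pos v (insert v (T - {t})))
        * (y t * g (insert v T - {t}))"
      by (simp only: mult_ac)
    also have "\<dots> = - (?s * (pos_sign pos t (insert v T) * y t * g (insert v T - {t})))"
      unfolding sw by (simp only: mult_minus_left mult.assoc)
    finally show "pos_sign pos t T * y t * h (T - {t}) =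
      - (?s * (pos_sign pos t (insert v T) * y t * g (insert v T - {t})))" .
  qed simp
  also have "\<dots> = - (?s * ?R)" by (simp only: sum_negf sum_distrib_left)
  finally have dh: "cobd pos y h T = - (?s * ?R)" .
  have "?s * cobd pos y g (insert v T) = ?s * (?s * (y v * g T)) + ?s * ?R"
    unfolding cobd_insert[OF assms(1) False] by (simp only: distrib_left mult.assoc)
  then show ?thesis using False by (simp add: ss dh)
qed

text \<open>The ideal generated by \<open>B\<close> and the \<open>y v\<close>, with explicit
  coefficients: these become the coefficients of the contracting homotopy.\<close>

definition span_mod :: "'a set \<Rightarrow> ('a \<Rightarrow> 'r::comm_ring_1) \<Rightarrow> 'r set \<Rightarrow> 'r set \<Rightarrow> 'r set" where
  "span_mod V y S B = {(\<Sum>v\<in>V. a v * y v) + b | a b. (\<forall>v\<in>V. a v \<in> S) \<and> b \<in> B}"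

lemma span_mod_mono: "B \<subseteq> B' \<Longrightarrow> span_mod V y S B \<subseteq> span_mod V y S B'"
  unfolding span_mod_def by blast

text \<open>Vanishing of the Koszul cohomology of \<open>S / B\<close> below the length of a regular sequence.\<close>

lemma koszul_vanishing:
  fixes S :: "'r::comm_ring_1 set" and pos :: "'a \<Rightarrow> nat"
  assumes S: "subring1 S" and V: "finite V" "inj_on pos V" "\<And>v. v \<in> V \<Longrightarrow> y v \<in> S"
  shows "wreg fs S B \<Longrightarrow> submod S B \<Longrightarrow> B \<subseteq> S \<Longrightarrow> set fs \<subseteq> S \<Longrightarrow>
    (\<And>f. f \<in> set fs \<Longrightarrow> \<exists>t. f ^ t \<in> span_mod V y S B) \<Longrightarrow> i < length fs \<Longrightarrow>
    (\<And>T. T \<subseteq> V \<Longrightarrow> g T \<in> S) \<Longrightarrow>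
    (\<And>T. T \<subseteq> V \<Longrightarrow> card T = Suc i \<Longrightarrow> cobd pos y g T \<in> B) \<Longrightarrow>
    \<exists>h. (\<forall>T. T \<subseteq> V \<longrightarrow> h T \<in> S) \<and> (\<forall>T. T \<subseteq> V \<longrightarrow> card T = i \<longrightarrow> g T - cobd pos y h T \<in> B)"
proof (induction fs arbitrary: B i g)
  case (Cons f fs)
  have f: "f \<in> S" "set fs \<subseteq> S" using Cons.prems(4) by auto
  have reg: "a \<in> B" if "a \<in> S" "f * a \<in> B" for a using Cons.prems(1) that by simp
  have SS: "submod S S" using S by (rule subring1D)
  have B: "submod S B" by fact
  define B' where "B' = adjoin B f S"
  have B': "submod S B'" "B \<subseteq> B'" "B' \<subseteq> S"
    unfolding B'_def using submod_adjoin[OF B SS] adjoin_superset subring1D(3)[OF S]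
      adjoin_subset[OF SS Cons.prems(3) f(1)] by blast+
  have finT: "finite T" "inj_on pos T" if "T \<subseteq> V" for T
    using that V finite_subset inj_on_subset by blast+
  have yT: "y t \<in> S" if "T \<subseteq> V" "t \<in> T" for t T using that V by blast
  define coboundary where "coboundary g \<longleftrightarrow> (\<exists>h. (\<forall>T. T \<subseteq> V \<longrightarrow> h T \<in> S) \<and>
      (\<forall>T. T \<subseteq> V \<longrightarrow> card T = i \<longrightarrow> g T - cobd pos y h T \<in> B))" for g
  \<comment> \<open>Multiplication by \<open>f\<close> is injective on cohomology in degree
    \<open>i\<close>. If \<open>f g\<close> is the coboundary of \<open>h\<close> modulo
    \<open>B\<close>, then \<open>h\<close> is a cocycle modulo \<open>B'\<close>, where the shorter
    sequence \<open>fs\<close> kills it one degree lower.\<close>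
  have cancel: "coboundary g" if g: "\<And>T. T \<subseteq> V \<Longrightarrow> g T \<in> S" and cb: "coboundary (\<lambda>T. f * g T)" for g
  proof -
    obtain h where h: "\<And>T. T \<subseteq> V \<Longrightarrow> h T \<in> S"
      "\<And>T. T \<subseteq> V \<Longrightarrow> card T = i \<Longrightarrow> f * g T - cobd pos y h T \<in> B"
      using cb unfolding coboundary_def by blast
    show ?thesis
    proof (cases i)
      case 0
      have "g T - cobd pos y (\<lambda>_. 0) T \<in> B" if T: "T \<subseteq> V" "card T = i" for T
      proof -
        have "T = {}" using T 0 finT by simp
        then have "f * g T \<in> B" using h(2)[OF T] by (simp add: cobd_def)
        then show ?thesis using reg g T by (simp add: cobd_def)
      qed
      then show ?thesis unfolding coboundary_def using subring1D(3)[OF S] by (intro exI[of _ "\<lambda>_. 0"]) auto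
    next
      case (Suc j)
      have "cobd pos y h T \<in> B'" if T: "T \<subseteq> V" "card T = Suc j" for T
      proof -
        have b: "f * g T - cobd pos y h T \<in> B" using h(2) T Suc by simp
        have "cobd pos y h T = - (f * g T - cobd pos y h T) + f * g T" by simp
        also have "\<dots> \<in> B'" unfolding B'_def
          using submod_uminus[OF S B b] g[OF T(1)] by (rule in_adjoin)
        finally show ?thesis .
      qed
      moreover have "\<exists>t. f' ^ t \<in> span_mod V y S B'" if "f' \<in> set fs" for f'
        using Cons.prems(5)[of f'] that span_mod_mono[OF B'(2), of V y S] by auto
      ultimately have "\<exists>u. (\<forall>T. T \<subseteq> V \<longrightarrow> u T \<in> S) \<and>
          (\<forall>T. T \<subseteq> V \<longrightarrow> card T = j \<longrightarrow> h T - cobd pos y u T \<in> B')"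
        using Cons.prems(1,6) B' f(2) h(1) Suc by (intro Cons.IH) (auto simp: B'_def)
      then obtain u where u: "\<And>T. T \<subseteq> V \<Longrightarrow> u T \<in> S"
        "\<And>T. T \<subseteq> V \<Longrightarrow> card T = j \<Longrightarrow> h T - cobd pos y u T \<in> B'" by blast
      have "\<exists>b a. h T - cobd pos y u T = b + f * a \<and> b \<in> B \<and> a \<in> S" if "T \<subseteq> V" "card T = j" for T
        using u(2)[OF that] by (auto simp: B'_def adjoin_def)
      \<comment> \<open>Writing \<open>h\<close> as a coboundary plus \<open>\<beta> + f w\<close>
        gives \<open>f\<close> times the difference of \<open>g\<close> and the coboundary of
        \<open>w\<close> in \<open>B\<close>, and regularity cancels \<open>f\<close>.\<close>
      then obtain \<beta> w where bw: "\<And>T. T \<subseteq> V \<Longrightarrow> card T = j \<Longrightarrow>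
          h T - cobd pos y u T = \<beta> T + f * w T \<and> \<beta> T \<in> B \<and> w T \<in> S" by metis
      \<comment> \<open>\<open>w\<close> is controlled on \<open>j\<close>-subsets only; the value 0
        elsewhere keeps the cochain in \<open>S\<close>.\<close>
      define w' where "w' T = (if T \<subseteq> V \<and> card T = j then w T else 0)" for T
      have w': "w' T \<in> S" for T using bw subring1D(3)[OF S] by (auto simp: w'_def)
      have "g T - cobd pos y w' T \<in> B" if T: "T \<subseteq> V" "card T = i" for T
      proof -
        have sub: "T - {t} \<subseteq> V" "card (T - {t}) = j" if "t \<in> T" for t
          using T that finT(1)[OF T(1)] Suc by auto
        have "cobd pos y h T = cobd pos y (\<lambda>A. (cobd pos y u A + \<beta> A) + f * w' A) T"
          by (rule cobd_cong) (use bw sub in \<open>auto simp: w'_def algebra_simps\<close>)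
        also have "\<dots> = cobd pos y \<beta> T + f * cobd pos y w' T"
          using cobd_cobd[OF finT[OF T(1)], of y u] by (simp add: cobd_add cobd_mult)
        finally have "f * (g T - cobd pos y w' T) = (f * g T - cobd pos y h T) + cobd pos y \<beta> T"
          by (simp add: algebra_simps)
        also have "\<dots> \<in> B"
          using h(2)[OF T] cobd_in_submod[OF S B, of T y \<beta> pos] yT[OF T(1)] bw sub
          by (intro submodD(2)[OF B]) auto
        finally have "f * (g T - cobd pos y w' T) \<in> B" .
        moreover have "g T - cobd pos y w' T \<in> S"
          using g[OF T(1)] cobd_in_submod[OF S SS, of T y w' pos] yT[OF T(1)] w'
          by (intro subring1D(6)[OF S]) auto
        ultimately show ?thesis using reg by blast
      qed
      then show ?thesis unfolding coboundary_def using w' by blast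
    qed
  qed
  obtain t where "f ^ t \<in> span_mod V y S B" using Cons.prems(5)[of f] by auto
  then obtain a b where ab: "f ^ t = (\<Sum>v\<in>V. a v * y v) + b" "\<And>v. v \<in> V \<Longrightarrow> a v \<in> S" "b \<in> B"
    unfolding span_mod_def by blast
  \<comment> \<open>Contraction with \<open>v\<close> makes multiplication by \<open>y v\<close>
    null-homotopic. As \<open>f ^ t\<close> is a combination of the \<open>y v\<close> modulo
    \<open>B\<close>, it annihilates the class of \<open>g\<close>; the \<open>t\<close> factors are
    then cancelled one by one.\<close>
  define h where "h v A = (if v \<in> A then 0
      else pos_sign pos v (insert v A) * g (insert v A))" for v A
  have sign: "(-1) ^ k \<in> S" for k using S by (intro subring1_power) (auto simp: subring1_def)
  have hS: "h v A \<in> S" if "A \<subseteq> V" "v \<in> V" for v A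
    using that Cons.prems(7) sign subring1D(3,5)[OF S] by (auto simp: h_def)
  have "coboundary (\<lambda>T. f ^ t * g T)"
    unfolding coboundary_def
  proof (intro exI[of _ "\<lambda>A. \<Sum>v\<in>V. a v * h v A"] conjI allI impI)
    show "(\<Sum>v\<in>V. a v * h v T) \<in> S" if "T \<subseteq> V" for T
      by (rule submod_sum[OF SS]) (use that ab(2) hS subring1D(5)[OF S] in auto)
    fix T assume T: "T \<subseteq> V" "card T = i"
    have "f ^ t * g T - cobd pos y (\<lambda>A. \<Sum>v\<in>V. a v * h v A) T =
        (\<Sum>v\<in>V. a v * (y v * g T - cobd pos y (h v) T)) + g T * b"
      unfolding cobd_sum ab(1) by (simp add: algebra_simps sum_distrib_right sum_subtractf sum_distrib_left)
    also have "\<dots> \<in> B"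
    proof (rule submodD(2)[OF B submod_sum[OF B] submodD(3)[OF B Cons.prems(7)[OF T(1)] ab(3)]])
      fix v assume v: "v \<in> V"
      have ins: "insert v T \<subseteq> V" using T v by simp
      have "y v * g T - cobd pos y (h v) T \<in> B"
      proof (cases "v \<in> T")
        case True
        then show ?thesis
          using cobd_contraction[OF finT(1)[OF T(1)] finT(2)[OF ins], of y g] submodD(1)[OF B]
          by (simp add: h_def[abs_def])
      next
        case False
        have "cobd pos y g (insert v T) \<in> B"
          using Cons.prems(8)[OF ins] T False finT(1)[OF T(1)] by simp
        then have "pos_sign pos v (insert v T) * cobd pos y g (insert v T) \<in> B"
          using sign by (intro submodD(3)[OF B])
        then show ?thesis
          using cobd_contraction[OF finT(1)[OF T(1)] finT(2)[OF ins], of y g] False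
          by (simp add: h_def[abs_def])
      qed
      then show "a v * (y v * g T - cobd pos y (h v) T) \<in> B" by (rule submodD(3)[OF B ab(2)[OF v]])
    qed
    finally show "f ^ t * g T - cobd pos y (\<lambda>A. \<Sum>v\<in>V. a v * h v A) T \<in> B" .
  qed
  then have "coboundary g"
  proof (induction t)
    case (Suc t)
    have "f ^ t * g T \<in> S" if "T \<subseteq> V" for T
      using that Cons.prems(7) subring1D(5)[OF S] subring1_power[OF S f(1)] by blast
    moreover have "coboundary (\<lambda>T. f * (f ^ t * g T))" using Suc.prems by (simp add: mult.assoc)
    ultimately have "coboundary (\<lambda>T. f ^ t * g T)" by (rule cancel)
    then show ?case by (rule Suc.IH)
  qed simp
  then show ?case unfolding coboundary_def by blast
qed simp

section \<open>Regular sequences, obstructions and algebraic independence\<close>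

lemma lookup_sign_mult: "lookup ((-1) ^ k * p) m = (-1) ^ k * lookup p m"
  for p :: "('a::monoid_add) \<Rightarrow>\<^sub>0 ('k::comm_ring_1)"
  by (induction k) (simp_all add: mult.assoc)

lemma lookup_var_mult:
  fixes p :: "('a, 'k::field) mpoly"
  assumes "finite A" "v \<in> A"
  shows "lookup (single (single v 1) 1 * p) (expo A) = lookup p (expo (A - {v}))"
proof -
  have "expo A = single v 1 + expo (A - {v})"
    unfolding expo_def using assms by (simp add: sum.remove)
  then show ?thesis using monomial_mult[of "single v 1" 1 p "expo (A - {v})"] by simp
qed

lemma lookup_var2_mult:
  fixes p :: "('a, 'k::field) mpoly"
  assumes "finite A"
  shows "lookup (single (single v 2) 1 * p) (expo A) = 0"
proof (rule ccontr)
  assume "\<not> ?thesis"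
  then have "expo A \<in> keys (single (single v 2) 1 * p)"
    by (simp add: in_keys_iff)
  then obtain k where "expo A = single v 2 + k" by (auto simp: keys_monomial_mult)
  then have "lookup (expo A) v = 2 + lookup k v" by (simp add: lookup_add)
  then show False using assms by (simp add: lookup_expo split: if_splits)
qed

lemma single_sum: "single m (sum f B) = (\<Sum>t\<in>B. single m (f t))"
  by (induction B rule: infinite_finite_induct) (simp_all add: single_add)

lemma simplicial_co_complex: "simplicial (co_complex V D)"
  unfolding simplicial_def
proof (intro ballI allI impI)
  fix F A assume "F \<in> co_complex V D" "A \<subseteq> F"
  then obtain W where "W \<in> D" "A \<subseteq> V - W" unfolding in_co_complex by (meson order_trans)
  then show "A \<in> co_complex V D" unfolding in_co_complex by blast
qed

text \<open>Parameters generating the irrelevant ideal up to radical; the squares outside \<open>U\<close> keep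
  a cohomology class of the link of the complement of \<open>U\<close> alive.\<close>

definition param :: "'a set \<Rightarrow> 'a \<Rightarrow> ('a, 'k::field) mpoly" where
  "param U v = single (single v (if v \<in> U then 1 else 2)) 1"

text \<open>The class is transported to a Koszul cocycle in degree \<open>card F + k\<close>. A
  regular sequence longer than that would give a Koszul primitive, and its squarefree coefficients
  would form a simplicial primitive of \<open>c\<close>. So
  \<open>length fs \<le> card F + k\<close>, and \<open>k + r < card U\<close> turns this into the
  stated bound.\<close>

lemma obstruction_bound:
  fixes V :: "'a set" and c :: "'a set \<Rightarrow> 'k::field" and fs :: "('a, 'k) mpoly list"
  assumes V: "finite V" "U \<subseteq> V" and ob: "obstruction U r D c"
    and D: "\<And>W. W \<in> D \<Longrightarrow> W \<subseteq> V"
    and reg: "wreg fs (polys V) (nonface_ideal V (co_complex V D))" "set fs \<subseteq> polys V"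
    and rad: "\<And>f. f \<in> set fs \<Longrightarrow>
      \<exists>t. f ^ t \<in> span_mod V (param U) (polys V) (nonface_ideal V (co_complex V D))"
  shows "length fs + r < card V"
proof -
  let ?\<Delta> = "co_complex V D" and ?L = "co_complex U {W \<in> D. W \<subseteq> U}"
  let ?J = "nonface_ideal V ?\<Delta> :: ('a, 'k) mpoly set" and ?P = "polys V :: ('a, 'k) mpoly set"
  define F where "F = V - U"
  obtain pos0 :: "'a \<Rightarrow> nat" and k where ob': "inj_on pos0 U" "k + r < card U"
     "\<And>B. B \<in> ?L \<Longrightarrow> card B = Suc k \<Longrightarrow> cobd1 pos0 c B = 0"
     "\<not> (\<exists>b. \<forall>B \<in> ?L. card B = k \<longrightarrow> c B = cobd1 pos0 b B)"
    using ob unfolding obstruction_def by blast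
  have fU: "finite U" "finite F" using V finite_subset by (auto simp: F_def)
  obtain e :: "'a \<Rightarrow> nat" where e: "inj_on e F"
    using finite_imp_inj_to_nat_seg[OF fU(2)] by blast
  define M where "M = Suc (Max (insert 0 (pos0 ` U)))"
  have M: "pos0 u < M" if "u \<in> U" for u
    using that fU by (simp add: M_def less_Suc_eq_le)
  \<comment> \<open>All of \<open>U\<close> precedes \<open>F\<close>, so a vertex of
    \<open>B\<close> has the same sign in \<open>F \<union> B\<close> as in
    \<open>B\<close>.\<close>
  define pos where "pos v = (if v \<in> U then pos0 v else M + e v)" for v
  have inj: "inj_on pos V"
  proof (rule inj_onI)
    fix u v assume uv: "u \<in> V" "v \<in> V" "pos u = pos v"
    show "u = v"
    proof (cases "u \<in> U"; cases "v \<in> U")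
      assume "u \<in> U" "v \<in> U"
      then show ?thesis using uv ob'(1) by (simp add: pos_def inj_on_def)
    next
      assume "u \<notin> U" "v \<notin> U"
      then show ?thesis using uv e by (simp add: pos_def inj_on_def F_def)
    next
      assume "u \<in> U" "v \<notin> U"
      then show ?thesis using uv M[of u] by (simp add: pos_def)
    next
      assume "u \<notin> U" "v \<in> U"
      then show ?thesis using uv M[of v] by (simp add: pos_def)
    qed
  qed
  have finT: "finite T" if "T \<subseteq> V" for T using that V finite_subset by blast
  have face: "F \<union> B \<in> ?\<Delta> \<longleftrightarrow> B \<in> ?L" if "B \<subseteq> U" for B
  proof
    assume "F \<union> B \<in> ?\<Delta>"
    then obtain W where W: "W \<in> D" "F \<union> B \<subseteq> V - W" by (auto simp: in_co_complex)
    then have "W \<subseteq> U" "B \<subseteq> U - W" using that D[OF W(1)] by (auto simp: F_def)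
    then show "B \<in> ?L" using W(1) by (auto simp: in_co_complex)
  next
    assume "B \<in> ?L"
    then obtain W where W: "W \<in> D" "W \<subseteq> U" "B \<subseteq> U - W" by (auto simp: in_co_complex)
    then have "F \<union> B \<subseteq> V - W" using V(2) by (auto simp: F_def)
    then show "F \<union> B \<in> ?\<Delta>" using W(1) by (auto simp: in_co_complex)
  qed
  have sign_eq: "card {u \<in> F \<union> B. pos u < pos t} = card {u \<in> B. pos0 u < pos0 t}"
    if "B \<subseteq> U" "t \<in> B" for B t
  proof -
    have "{u \<in> F \<union> B. pos u < pos t} = {u \<in> B. pos0 u < pos0 t}"
    proof (rule Set.set_eqI)
      fix u
      have t: "t \<in> U" "pos t = pos0 t" using that by (auto simp: pos_def)
      show "u \<in> {u \<in> F \<union> B. pos u < pos t} \<longleftrightarrow> u \<in> {u \<in> B. pos0 u < pos0 t}"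
      proof (cases "u \<in> U")
        case True
        then show ?thesis using t(2) by (simp add: pos_def F_def)
      next
        case False
        then have "u \<notin> B" "\<not> pos u < pos0 t" using that M[OF t(1)] by (auto simp: pos_def)
        then show ?thesis using t(2) by simp
      qed
    qed
    then show ?thesis by simp
  qed
  \<comment> \<open>The value at \<open>F \<union> B\<close> is placed in the squarefree degree of
    that set. This monomial is nonzero in the face ring exactly when \<open>B\<close> is a face of
    the link.\<close>
  define g where "g T = (if F \<subseteq> T then single 0 (c (T - F)) * xmon T else 0)"
    for T :: "'a set"
  let ?y = "param U :: 'a \<Rightarrow> ('a, 'k) mpoly"
  have S: "subring1 ?P" by (rule subring1_polys)
  have simp: "simplicial ?\<Delta>" by (rule simplicial_co_complex)
  have subJ: "submod ?P ?J" by (rule submod_nonface_ideal[OF simp])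
  have const: "single 0 a \<in> ?P" for a by (auto simp: polys_def)
  have y_var: "?y v * xmon A = xmon (insert v A)" if "v \<in> U" "v \<notin> A" "finite A" for v A
  proof -
    have "expo (insert v A) = single v 1 + expo A"
      unfolding expo_def by (rule sum.insert[OF that(3,2)])
    then show ?thesis using that(1) by (simp only: param_def xmon_def mult_single if_True mult_1)
  qed
  have cocycle: "cobd pos ?y g T \<in> ?J" if T: "T \<subseteq> V" "card T = Suc (card F + k)" for T
  proof (cases "F \<subseteq> T")
    case False
    then have "cobd pos ?y g T = 0" by (auto simp: cobd_def g_def intro!: sum.neutral)
    then show ?thesis using submodD(1)[OF subJ] by simp
  next
    case True
    define B where "B = T - F"
    have TB: "T = F \<union> B" "F \<inter> B = {}" "B \<subseteq> U" "finite B"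
      using True T(1) finT by (auto simp: B_def F_def)
    have cB: "card B = Suc k" using T(2) fU TB by (simp add: card_Un_disjoint)
    have "cobd pos ?y g T = (\<Sum>t\<in>B. pos_sign pos t T * ?y t * g (T - {t}))"
      unfolding cobd_def
      by (rule sum.mono_neutral_right) (use TB fU in \<open>auto simp: g_def\<close>)
    also have "\<dots> = (\<Sum>t\<in>B. single 0 (pos_sign pos0 t B * c (B - {t})) * xmon T)"
    proof (rule sum.cong)
      fix t assume t: "t \<in> B"
      have tt: "F \<subseteq> T - {t}" "T - {t} - F = B - {t}" "insert t (T - {t}) = T" using t TB by auto
      have "?y t * g (T - {t}) = single 0 (c (B - {t})) * (?y t * xmon (T - {t}))"
        using tt by (simp add: g_def mult_ac)
      also have "?y t * xmon (T - {t}) = xmon T"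
        using y_var[of t "T - {t}"] t TB fU tt(3) by auto
      finally have e1: "?y t * g (T - {t}) = single 0 (c (B - {t})) * xmon T" .
      have e2: "pos_sign pos t T =
          (single 0 (pos_sign pos0 t B) :: ('a, 'k) mpoly)"
      proof -
        have "(-1) ^ n = (single 0 ((-1) ^ n) :: ('a, 'k) mpoly)" for n
          by (induction n) (simp_all add: single_uminus)
        then show ?thesis unfolding TB(1) using sign_eq[OF TB(3) t] by simp
      qed
      show "pos_sign pos t T * ?y t * g (T - {t}) =
        single 0 (pos_sign pos0 t B * c (B - {t})) * xmon T"
        unfolding mult.assoc[of _ "?y t"] e1 e2 by (simp add: mult_single flip: mult.assoc)
    qed simp
    also have "\<dots> = single 0 (cobd1 pos0 c B) * xmon T"
      by (simp add: cobd_def single_sum sum_distrib_right)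
    finally have eq: "cobd pos ?y g T = single 0 (cobd1 pos0 c B) * xmon T" .
    show ?thesis
    proof (cases "T \<in> ?\<Delta>")
      case True
      then have "B \<in> ?L" using face TB by simp
      then show ?thesis unfolding eq using ob'(3) cB submodD(1)[OF subJ] by simp
    next
      case False
      then have "xmon T \<in> ?J"
        using T finT by (intro nonface_idealI) (auto simp: xmon_def keys_expo)
      then show ?thesis unfolding eq using const by (rule submodD(3)[OF subJ, rotated])
    qed
  qed
  have gP: "g T \<in> ?P" if "T \<subseteq> V" for T
    using subring1D(5)[OF S const xmon_in_polys[OF finT[OF that] that]] subring1D(3)[OF S]
    by (simp add: g_def)
  have yP: "?y v \<in> ?P" if "v \<in> V" for v using that by (auto simp: param_def polys_def)
  have JP: "?J \<subseteq> ?P" by (auto simp: nonface_ideal_def)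
  have "length fs \<le> card F + k"
  proof (rule ccontr)
    assume "\<not> length fs \<le> card F + k"
    then have less: "card F + k < length fs" by simp
    have "\<exists>h. (\<forall>T. T \<subseteq> V \<longrightarrow> h T \<in> ?P) \<and>
        (\<forall>T. T \<subseteq> V \<longrightarrow> card T = card F + k \<longrightarrow> g T - cobd pos ?y h T \<in> ?J)"
      by (rule koszul_vanishing[OF S V(1) inj _ reg(1) subJ JP reg(2) _ less])
        (use yP rad gP cocycle in blast)+
    then obtain h where h: "\<And>T. T \<subseteq> V \<Longrightarrow> card T = card F + k \<Longrightarrow> g T - cobd pos ?y h T \<in> ?J"
      by blast
    \<comment> \<open>Comparing coefficients of \<open>expo T\<close> in the coboundary of
      \<open>h\<close>: for \<open>t\<close> in \<open>F\<close> the parameter is a square and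
      contributes nothing, while for \<open>t\<close> in \<open>B\<close> it lowers the degree to
      \<open>expo (T - {t})\<close>.\<close>
    define b where "b B = lookup (h (F \<union> B)) (expo (F \<union> B))" for B
    have "c B = cobd1 pos0 b B" if B: "B \<in> ?L" "card B = k" for B
    proof -
      have BU: "B \<subseteq> U" using B by (auto simp: in_co_complex)
      then have FB: "F \<inter> B = {}" "finite B" using fU finite_subset by (auto simp: F_def)
      define T where "T = F \<union> B"
      have T: "T \<subseteq> V" "card T = card F + k" "T \<in> ?\<Delta>" "finite T"
        using BU FB B fU V(2) face[OF BU] by (auto simp: T_def F_def card_Un_disjoint)
      have "expo T \<notin> keys (g T - cobd pos ?y h T)"
        using nonface_idealD[OF h[OF T(1,2)], of "expo T"] T by (auto simp: keys_expo)
      then have "lookup (g T) (expo T) = lookup (cobd pos ?y h T) (expo T)"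
        by (simp add: in_keys_iff lookup_minus)
      moreover have "lookup (g T) (expo T) = c B"
      proof -
        have "T - F = B" "F \<subseteq> T" using FB by (auto simp: T_def)
        then show ?thesis by (simp add: g_def xmon_def mult_single)
      qed
      moreover have "lookup (cobd pos ?y h T) (expo T) = cobd1 pos0 b B"
      proof -
        have "lookup (cobd pos ?y h T) (expo T) =
            (\<Sum>t\<in>T. pos_sign pos t T * lookup (?y t * h (T - {t})) (expo T))"
          unfolding cobd_def by (simp add: lookup_sum mult.assoc lookup_sign_mult)
        also have "\<dots> = (\<Sum>t\<in>B. pos_sign pos t T * lookup (?y t * h (T - {t})) (expo T))"
        proof (rule sum.mono_neutral_right)
          show "\<forall>t\<in>T - B. pos_sign pos t T * lookup (?y t * h (T - {t})) (expo T) = 0"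
            using lookup_var2_mult[OF T(4)] by (auto simp: T_def F_def param_def)
        qed (use T in \<open>auto simp: T_def\<close>)
        also have "\<dots> = cobd1 pos0 b B"
          unfolding cobd_def
        proof (rule sum.cong)
          fix t assume t: "t \<in> B"
          have tT: "t \<in> T" "T - {t} = F \<union> (B - {t})" using t FB by (auto simp: T_def)
          have "lookup (?y t * h (T - {t})) (expo T) = lookup (h (T - {t})) (expo (T - {t}))"
            using lookup_var_mult[OF T(4) tT(1)] t BU by (auto simp: param_def)
          then have "lookup (?y t * h (T - {t})) (expo T) = b (B - {t})"
            unfolding b_def tT(2) .
          then show "pos_sign pos t T * lookup (?y t * h (T - {t})) (expo T) =
              pos_sign pos0 t B * 1 * b (B - {t})"
            using sign_eq[OF BU t] by (simp add: T_def)
        qed simp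
        finally show ?thesis .
      qed
      ultimately show ?thesis by simp
    qed
    then show False using ob'(4) by blast
  qed
  moreover have "card V = card U + card F"
    using V fU card_Un_disjoint[of U F] by (simp add: F_def Un_absorb1)
  ultimately show ?thesis using ob'(2) by linarith
qed

section \<open>Algebraic dependence and bounds on chains\<close>

fun power_product :: "'r::comm_ring_1 list \<Rightarrow> nat list \<Rightarrow> 'r" where
  "power_product (f # fs) (a # as) = f ^ a * power_product fs as"
| "power_product _ _ = 1"

lemma power_product_in: "subring1 S \<Longrightarrow> set fs \<subseteq> S \<Longrightarrow> power_product fs as \<in> S"
  by (induction fs as rule: power_product.induct) (auto simp: subring1D subring1_power)

text \<open>The monomials of lowest degree in the first element are divided out; covers
  both regular sequences and elements of the successive differences of a chain of primes.\<close>

lemma chain_independent: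
  fixes S :: "'r::comm_ring_1 set"
  assumes S: "subring1 S"
  shows "set fs \<subseteq> S \<Longrightarrow> (\<And>i. i \<le> length fs \<Longrightarrow> submod S (B i)) \<Longrightarrow>
    (\<And>i. i < length fs \<Longrightarrow> fs ! i \<in> B (Suc i) \<and> B i \<subseteq> B (Suc i) \<and>
      (\<forall>a\<in>S. fs ! i * a \<in> B i \<longrightarrow> a \<in> B i)) \<Longrightarrow>
    (\<And>k. k \<in> K \<Longrightarrow> k \<in> S \<and> (k \<in> B (length fs) \<longrightarrow> k = 0)) \<Longrightarrow>
    finite A \<Longrightarrow> (\<And>\<alpha>. \<alpha> \<in> A \<Longrightarrow> length \<alpha> = length fs \<and> c \<alpha> \<in> K) \<Longrightarrow>
    (\<Sum>\<alpha>\<in>A. c \<alpha> * power_product fs \<alpha>) \<in> B 0 \<Longrightarrow> \<alpha> \<in> A \<Longrightarrow> c \<alpha> = 0"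
proof (induction fs arbitrary: B A c \<alpha>)
  case Nil
  then have "A = {[]}" by fastforce
  then show ?case using Nil by simp
next
  case (Cons f fs)
  show ?case
  proof (rule ccontr)
    assume "c \<alpha> \<noteq> 0"
    have f: "f \<in> S" "set fs \<subseteq> S" using Cons.prems(1) by auto
    have SS: "submod S S" using S by (rule subring1D)
    have step0: "f \<in> B 1" "B 0 \<subseteq> B 1" "\<And>a. a \<in> S \<Longrightarrow> f * a \<in> B 0 \<Longrightarrow> a \<in> B 0"
      using Cons.prems(3)[of 0] by auto
    define m where "m = (LEAST m. \<exists>\<beta>\<in>A. c \<beta> \<noteq> 0 \<and> hd \<beta> = m)"
    have "\<exists>m. \<exists>\<beta>\<in>A. c \<beta> \<noteq> 0 \<and> hd \<beta> = m" using \<open>c \<alpha> \<noteq> 0\<close> Cons.prems(8) by blast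
    then have "\<exists>\<beta>\<in>A. c \<beta> \<noteq> 0 \<and> hd \<beta> = m" unfolding m_def by (rule LeastI_ex)
    then obtain \<beta> where \<beta>: "\<beta> \<in> A" "c \<beta> \<noteq> 0" "hd \<beta> = m" by blast
    have least: "m \<le> hd \<gamma>" if "\<gamma> \<in> A" "c \<gamma> \<noteq> 0" for \<gamma>
      unfolding m_def using that by (intro Least_le) blast
    have len: "\<gamma> = hd \<gamma> # tl \<gamma>" "length (tl \<gamma>) = length fs" if "\<gamma> \<in> A" for \<gamma>
      using Cons.prems(6)[OF that] by (cases \<gamma>; simp)+
    have cS: "c \<gamma> \<in> S" if "\<gamma> \<in> A" for \<gamma> using Cons.prems(4,6) that by blast
    \<comment> \<open>\<open>Q\<close> is the part with exactly \<open>m\<close> factors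
      \<open>f\<close>; the rest is \<open>f * G\<close> after division by
      \<open>f ^ m\<close>.\<close>
    define A' where "A' = {\<gamma> \<in> A. hd \<gamma> = m}"
    define Q where "Q = (\<Sum>\<gamma>\<in>A'. c \<gamma> * power_product fs (tl \<gamma>))"
    define G where "G = (\<Sum>\<gamma>\<in>A - A'. c \<gamma> * (f ^ (hd \<gamma> - m - 1) * power_product fs (tl \<gamma>)))"
    have QS: "Q \<in> S" unfolding Q_def
      by (rule submod_sum[OF SS]) (use cS power_product_in[OF S f(2)] subring1D(5)[OF S] A'_def in auto)
    have GS: "G \<in> S" unfolding G_def
      by (rule submod_sum[OF SS])
        (use cS power_product_in[OF S f(2)] subring1D(5)[OF S] subring1_power[OF S f(1)] in auto)
    have "(\<Sum>\<gamma>\<in>A. c \<gamma> * power_product (f # fs) \<gamma>) = (\<Sum>\<gamma>\<in>A'. c \<gamma> * power_product (f # fs) \<gamma>)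
        + (\<Sum>\<gamma>\<in>A - A'. c \<gamma> * power_product (f # fs) \<gamma>)"
      using Cons.prems(5) by (subst sum.subset_diff[of A' A]) (auto simp: A'_def)
    also have "(\<Sum>\<gamma>\<in>A'. c \<gamma> * power_product (f # fs) \<gamma>) = f ^ m * Q"
      unfolding Q_def sum_distrib_left
    proof (rule sum.cong)
      fix \<gamma> assume "\<gamma> \<in> A'"
      then have "\<gamma> = m # tl \<gamma>" using len[of \<gamma>] by (auto simp: A'_def)
      then have "power_product (f # fs) \<gamma> = f ^ m * power_product fs (tl \<gamma>)" by (metis power_product.simps(1))
      then show "c \<gamma> * power_product (f # fs) \<gamma> = f ^ m * (c \<gamma> * power_product fs (tl \<gamma>))" by simp
    qed simp
    also have "(\<Sum>\<gamma>\<in>A - A'. c \<gamma> * power_product (f # fs) \<gamma>) = f ^ m * (f * G)"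
      unfolding G_def sum_distrib_left
    proof (rule sum.cong)
      fix \<gamma> assume \<gamma>: "\<gamma> \<in> A - A'"
      show "c \<gamma> * power_product (f # fs) \<gamma> = f ^ m * (f * (c \<gamma> * (f ^ (hd \<gamma> - m - 1) * power_product fs (tl \<gamma>))))"
      proof (cases "c \<gamma> = 0")
        case False
        then have "m < hd \<gamma>" using least[of \<gamma>] \<gamma> by (auto simp: A'_def)
        then have "f ^ hd \<gamma> = f ^ m * (f * f ^ (hd \<gamma> - m - 1))"
          by (simp flip: power_Suc power_add)
        moreover have "power_product (f # fs) \<gamma> = f ^ hd \<gamma> * power_product fs (tl \<gamma>)"
          using len[of \<gamma>] \<gamma> by (metis DiffD1 power_product.simps(1))
        ultimately show ?thesis by (simp add: mult_ac)
      qed simp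
    qed simp
    \<comment> \<open>The power of \<open>f\<close> cancels modulo \<open>B 0\<close>, and
      \<open>f * G\<close> lies in \<open>B 1\<close> together with \<open>f\<close>. Hence
      \<open>Q\<close>, a relation among the remaining elements, lies in \<open>B 1\<close>.\<close>
    finally have "f ^ m * (Q + f * G) \<in> B 0" using Cons.prems(7) by (simp add: distrib_left)
    moreover have X: "Q + f * G \<in> S" using QS GS f by (simp add: subring1D[OF S])
    have "Q + f * G \<in> B 0" if "f ^ j * (Q + f * G) \<in> B 0" for j
      using that
    proof (induction j)
      case (Suc j)
      have "f ^ j * (Q + f * G) \<in> S" using X subring1_power[OF S f(1)] by (simp add: subring1D[OF S])
      then show ?case using step0(3)[of "f ^ j * (Q + f * G)"] Suc by (simp add: mult.assoc)
    qed simp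
    ultimately have "Q + f * G \<in> B 1" using step0(2) by blast
    moreover have B1: "submod S (B 1)" using Cons.prems(2)[of 1] by simp
    moreover have "f * G \<in> B 1" using submodD(3)[OF B1 GS step0(1)] by (simp add: mult.commute)
    ultimately have "Q + f * G - f * G \<in> B 1" using submod_diff[OF S B1] by blast
    then have "Q \<in> B (Suc 0)" by simp
    moreover have "Q = (\<Sum>\<gamma>\<in>tl ` A'. c (m # \<gamma>) * power_product fs \<gamma>)"
    proof -
      have "inj_on tl A'"
        by (rule inj_onI) (metis (mono_tags, lifting) A'_def len(1) mem_Collect_eq)
      moreover have "c (m # tl \<gamma>) = c \<gamma>" if "\<gamma> \<in> A'" for \<gamma>
        using len(1)[of \<gamma>] that by (simp add: A'_def)
      ultimately show ?thesis unfolding Q_def by (simp add: sum.reindex)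
    qed
    moreover have "tl \<beta> \<in> tl ` A'" using \<beta> by (simp add: A'_def)
    ultimately have "c (m # tl \<beta>) = 0"
    proof (intro Cons.IH[where B = "\<lambda>i. B (Suc i)" and A = "tl ` A'" and c = "\<lambda>\<gamma>. c (m # \<gamma>)"])
      show "submod S (B (Suc i))" if "i \<le> length fs" for i using Cons.prems(2) that by simp
      show "fs ! i \<in> B (Suc (Suc i)) \<and> B (Suc i) \<subseteq> B (Suc (Suc i)) \<and>
          (\<forall>a\<in>S. fs ! i * a \<in> B (Suc i) \<longrightarrow> a \<in> B (Suc i))" if "i < length fs" for i
        using Cons.prems(3)[of "Suc i"] that by simp
      show "k \<in> S \<and> (k \<in> B (Suc (length fs)) \<longrightarrow> k = 0)" if "k \<in> K" for k
        using Cons.prems(4)[OF that] by simp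
      show "length \<gamma> = length fs \<and> c (m # \<gamma>) \<in> K" if "\<gamma> \<in> tl ` A'" for \<gamma>
      proof -
        obtain \<delta> where "\<delta> \<in> A" "hd \<delta> = m" "\<gamma> = tl \<delta>" using \<open>\<gamma> \<in> tl ` A'\<close> by (auto simp: A'_def)
        then show ?thesis using len[of \<delta>] Cons.prems(6)[of \<delta>] by auto
      qed
    qed (use f Cons.prems(5) in \<open>auto simp: A'_def\<close>)
    then show False using \<beta> len(1)[OF \<beta>(1)] by simp
  qed
qed

text \<open>Gaussian elimination: the equation for \<open>t\<close> is solved for the unknown at
  \<open>\<gamma>\<close>, which is substituted into the others.\<close>

lemma homogeneous_system_solvable:
  fixes M :: "'i \<Rightarrow> 'j \<Rightarrow> 'k::field"
  assumes "finite T"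
  shows "finite A \<Longrightarrow> card T < card A \<Longrightarrow>
    \<exists>c. (\<exists>\<alpha>\<in>A. c \<alpha> \<noteq> 0) \<and> (\<forall>t\<in>T. (\<Sum>\<alpha>\<in>A. c \<alpha> * M \<alpha> t) = 0)"
  using assms
proof (induction T arbitrary: A M rule: finite_induct)
  case empty
  then show ?case by (intro exI[of _ "\<lambda>_. 1"]) (auto simp: card_gt_0_iff)
next
  case (insert t T)
  show ?case
  proof (cases "\<forall>\<alpha>\<in>A. M \<alpha> t = 0")
    case True
    have "card T < card A" using insert by simp
    then obtain c where "\<exists>\<alpha>\<in>A. c \<alpha> \<noteq> 0" "\<forall>t\<in>T. (\<Sum>\<alpha>\<in>A. c \<alpha> * M \<alpha> t) = 0"
      using insert.IH[OF insert.prems(1)] by blast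
    then show ?thesis using True by (intro exI[of _ c]) auto
  next
    case False
    then obtain \<gamma> where \<gamma>: "\<gamma> \<in> A" "M \<gamma> t \<noteq> 0" by blast
    define M' where "M' \<alpha> u = M \<alpha> u - M \<alpha> t / M \<gamma> t * M \<gamma> u" for \<alpha> u
    have "card T < card (A - {\<gamma>})" using insert \<gamma> by simp
    then obtain c where c: "\<exists>\<alpha>\<in>A - {\<gamma>}. c \<alpha> \<noteq> 0"
      "\<And>u. u \<in> T \<Longrightarrow> (\<Sum>\<alpha>\<in>A - {\<gamma>}. c \<alpha> * M' \<alpha> u) = 0"
      using insert.IH[of "A - {\<gamma>}" M'] insert.prems(1) by blast
    define x where "x = - (\<Sum>\<alpha>\<in>A - {\<gamma>}. c \<alpha> * M \<alpha> t) / M \<gamma> t"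
    define c' where "c' = c(\<gamma> := x)"
    have sum: "(\<Sum>\<alpha>\<in>A. c' \<alpha> * M \<alpha> u) = x * M \<gamma> u + (\<Sum>\<alpha>\<in>A - {\<gamma>}. c \<alpha> * M \<alpha> u)" for u
    proof -
      have "(\<Sum>\<alpha>\<in>A - {\<gamma>}. c' \<alpha> * M \<alpha> u) = (\<Sum>\<alpha>\<in>A - {\<gamma>}. c \<alpha> * M \<alpha> u)"
        by (rule sum.cong) (auto simp: c'_def)
      then show ?thesis using sum.remove[OF insert.prems(1) \<gamma>(1), of "\<lambda>\<alpha>. c' \<alpha> * M \<alpha> u"]
        by (simp add: c'_def)
    qed
    have "(\<Sum>\<alpha>\<in>A. c' \<alpha> * M \<alpha> t) = 0" unfolding sum x_def using \<gamma> by simp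
    moreover have "(\<Sum>\<alpha>\<in>A. c' \<alpha> * M \<alpha> u) = 0" if "u \<in> T" for u
    proof -
      have "(\<Sum>\<alpha>\<in>A - {\<gamma>}. c \<alpha> * M' \<alpha> u) =
          (\<Sum>\<alpha>\<in>A - {\<gamma>}. c \<alpha> * M \<alpha> u) - (\<Sum>\<alpha>\<in>A - {\<gamma>}. c \<alpha> * M \<alpha> t / M \<gamma> t * M \<gamma> u)"
        by (simp add: M'_def right_diff_distrib sum_subtractf mult.assoc)
      also have "(\<Sum>\<alpha>\<in>A - {\<gamma>}. c \<alpha> * M \<alpha> t / M \<gamma> t * M \<gamma> u) = - x * M \<gamma> u"
        by (simp add: x_def sum_divide_distrib sum_distrib_right)
      finally have "(\<Sum>\<alpha>\<in>A - {\<gamma>}. c \<alpha> * M' \<alpha> u) = x * M \<gamma> u + (\<Sum>\<alpha>\<in>A - {\<gamma>}. c \<alpha> * M \<alpha> u)"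
        by simp
      then show ?thesis unfolding sum using c(2)[OF that] by simp
    qed
    moreover have "\<exists>\<alpha>\<in>A. c' \<alpha> \<noteq> 0" using c(1) by (auto simp: c'_def)
    ultimately show ?thesis by (intro exI[of _ c']) auto
  qed
qed

text \<open>Exponents are bounded separately rather than by total degree, since exponent vectors
  supported on \<open>F\<close> then number at most \<open>(E + 1) ^ card F\<close>.\<close>

definition expo_bounded :: "nat \<Rightarrow> ('a, 'k::field) mpoly \<Rightarrow> bool" where
  "expo_bounded E p \<longleftrightarrow> (\<forall>m\<in>keys p. \<forall>v. lookup m v \<le> E)"

lemma expo_bounded_mult: "expo_bounded E p \<Longrightarrow> expo_bounded E' q \<Longrightarrow> expo_bounded (E + E') (p * q)"
  unfolding expo_bounded_def using keys_mult[of p q]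
  by (fastforce simp: lookup_add intro: add_mono)

lemma expo_bounded_power: "expo_bounded E p \<Longrightarrow> expo_bounded (n * E) (p ^ n)"
proof (induction n)
  case (Suc n)
  then show ?case using expo_bounded_mult[of E p "n * E" "p ^ n"] by simp
qed (simp add: expo_bounded_def)

lemma expo_bounded_mono: "expo_bounded E p \<Longrightarrow> E \<le> E' \<Longrightarrow> expo_bounded E' p"
  unfolding expo_bounded_def using order_trans by blast

lemma expo_bounded_power_product:
  "\<forall>f\<in>set fs. expo_bounded E f \<Longrightarrow> set \<alpha> \<subseteq> {..<d} \<Longrightarrow> expo_bounded (length fs * (d * E)) (power_product fs \<alpha>)"
proof (induction fs \<alpha> rule: power_product.induct)
  case (1 f fs a as)
  have "expo_bounded (a * E) (f ^ a)" using 1 by (simp add: expo_bounded_power)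
  then have "expo_bounded (d * E) (f ^ a)" using 1 by (auto intro: expo_bounded_mono)
  then show ?case using 1 expo_bounded_mult by fastforce
qed (auto simp: expo_bounded_def)

lemma expo_bounded_exists: "\<exists>E. expo_bounded E p"
proof -
  have "finite {lookup m v | m v. m \<in> keys p}"
  proof -
    have "{lookup m v | m v. m \<in> keys p} \<subseteq> (\<Union>m\<in>keys p. insert 0 (lookup m ` keys m))"
      by (auto simp: in_keys_iff)
    then show ?thesis by (rule finite_subset) auto
  qed
  then show ?thesis
    by (intro exI[of _ "Max {lookup m v | m v. m \<in> keys p}"]) (auto simp: expo_bounded_def intro!: Max_ge)
qed

lemma card_bounded_monomials:
  assumes "finite F"
  shows "finite {m. keys m \<subseteq> F \<and> (\<forall>v. lookup m v \<le> E)}"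
    "card {m. keys m \<subseteq> F \<and> (\<forall>v. lookup m v \<le> E)} \<le> Suc E ^ card F"
proof -
  let ?T = "{m. keys m \<subseteq> F \<and> (\<forall>v. lookup m v \<le> E)}" and ?\<Pi> = "PiE F (\<lambda>_. {..E})"
  define \<phi> :: "('a \<Rightarrow>\<^sub>0 nat) \<Rightarrow> 'a \<Rightarrow> nat" where "\<phi> m = restrict (lookup m) F" for m
  have inj: "inj_on \<phi> ?T"
  proof (rule inj_onI)
    fix m m' assume m: "m \<in> ?T" "m' \<in> ?T" "\<phi> m = \<phi> m'"
    show "m = m'"
    proof (rule poly_mapping_eqI)
      fix v
      show "lookup m v = lookup m' v"
      proof (cases "v \<in> F")
        case True
        then show ?thesis using fun_cong[OF m(3), of v] by (simp add: \<phi>_def)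
      next
        case False
        then have "v \<notin> keys m" "v \<notin> keys m'" using m by auto
        then show ?thesis by (simp add: in_keys_iff)
      qed
    qed
  qed
  have sub: "\<phi> ` ?T \<subseteq> ?\<Pi>" by (auto simp: \<phi>_def)
  have fin: "finite ?\<Pi>" using assms by (intro finite_PiE) auto
  show "finite ?T" using finite_imageD[OF finite_subset[OF sub fin] inj] .
  show "card ?T \<le> Suc E ^ card F"
    using card_inj_on_le[OF inj sub fin] assms by (simp add: card_PiE)
qed

text \<open>A dimension count. There are \<open>d ^ (s + 1)\<close> power products with exponents
  below \<open>d\<close>, but only the coefficients at monomials supported on faces matter modulo
  the ideal, and their number grows like \<open>d ^ s\<close>.\<close>

lemma algebraically_dependent:
  fixes fs :: "('a, 'k::field) mpoly list"
  assumes \<Delta>: "finite \<Delta>" "\<And>F. F \<in> \<Delta> \<Longrightarrow> finite F \<and> card F \<le> s"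
    and fs: "length fs = Suc s" "set fs \<subseteq> polys V"
  shows "\<exists>A c. finite A \<and> (\<forall>\<alpha>\<in>A. length \<alpha> = length fs) \<and> (\<exists>\<alpha>\<in>A. c \<alpha> \<noteq> 0) \<and>
    (\<Sum>\<alpha>\<in>A. single 0 (c \<alpha>) * power_product fs \<alpha>) \<in> nonface_ideal V \<Delta>"
proof -
  have "\<exists>E. \<forall>f\<in>set fs. expo_bounded E f"
  proof (induction fs)
    case (Cons f fs)
    obtain E E' where "\<forall>f\<in>set fs. expo_bounded E f" "expo_bounded E' f"
      using Cons expo_bounded_exists by blast
    then have "\<forall>g\<in>set (f # fs). expo_bounded (max E E') g" by (auto intro: expo_bounded_mono)
    then show ?case by blast
  qed simp
  then obtain E where E: "\<forall>f\<in>set fs. expo_bounded E f" by blast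
  define a where "a = Suc (Suc s * E)"
  \<comment> \<open>Since \<open>Suc N \<le> a * d\<close>, at most
    \<open>card \<Delta> * a ^ s * d ^ s\<close> coefficients occur; this \<open>d\<close> exceeds
    the factor in front of \<open>d ^ s\<close>.\<close>
  define d where "d = Suc (card \<Delta> * a ^ s)"
  define N where "N = Suc s * (d * E)"
  define A where "A = {\<alpha>. set \<alpha> \<subseteq> {..<d} \<and> length \<alpha> = Suc s}"
  define T where "T = {m. keys m \<in> \<Delta> \<and> (\<forall>v. lookup m v \<le> N)}"
  have TU: "T \<subseteq> (\<Union>F\<in>\<Delta>. {m. keys m \<subseteq> F \<and> (\<forall>v. lookup m v \<le> N)})" by (auto simp: T_def)
  have finU: "finite (\<Union>F\<in>\<Delta>. {m. keys m \<subseteq> F \<and> (\<forall>v. lookup m v \<le> N)})"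
    using \<Delta> card_bounded_monomials(1) by blast
  then have finT: "finite T" using TU finite_subset by blast
  have "card T \<le> (\<Sum>F\<in>\<Delta>. card {m. keys m \<subseteq> F \<and> (\<forall>v. lookup m v \<le> N)})"
    using card_mono[OF finU TU] card_UN_le[OF \<Delta>(1)] order_trans by blast
  also have "\<dots> \<le> (\<Sum>F\<in>\<Delta>. Suc N ^ s)"
  proof (rule sum_mono)
    fix F assume F: "F \<in> \<Delta>"
    have "card {m. keys m \<subseteq> F \<and> (\<forall>v. lookup m v \<le> N)} \<le> Suc N ^ card F"
      using card_bounded_monomials(2) \<Delta>(2)[OF F] by blast
    also have "\<dots> \<le> Suc N ^ s" using \<Delta>(2)[OF F] by (intro power_increasing) auto
    finally show "card {m. keys m \<subseteq> F \<and> (\<forall>v. lookup m v \<le> N)} \<le> Suc N ^ s" .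
  qed
  also have "\<dots> = card \<Delta> * Suc N ^ s" by simp
  also have "\<dots> \<le> card \<Delta> * (a * d) ^ s"
  proof -
    have "Suc N \<le> a * d" by (simp add: N_def a_def d_def algebra_simps)
    then show ?thesis by (intro mult_left_mono power_mono) auto
  qed
  also have "\<dots> = (card \<Delta> * a ^ s) * d ^ s" by (simp add: power_mult_distrib)
  also have "\<dots> < d * d ^ s" by (rule mult_strict_right_mono) (auto simp: d_def)
  also have "\<dots> = card A" unfolding A_def by (subst card_lists_length_eq) auto
  finally have "card T < card A" .
  moreover have finA: "finite A" unfolding A_def by (rule finite_lists_length_eq) simp
  ultimately obtain c where c: "\<exists>\<alpha>\<in>A. c \<alpha> \<noteq> 0"
    "\<And>t. t \<in> T \<Longrightarrow> (\<Sum>\<alpha>\<in>A. c \<alpha> * lookup (power_product fs \<alpha>) t) = 0"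
    using homogeneous_system_solvable[OF finT finA, of "\<lambda>\<alpha>. lookup (power_product fs \<alpha>)"] by blast
  define p where "p = (\<Sum>\<alpha>\<in>A. single 0 (c \<alpha>) * power_product fs \<alpha>)"
  have lookup_p: "lookup p m = (\<Sum>\<alpha>\<in>A. c \<alpha> * lookup (power_product fs \<alpha>) m)" for m
    by (simp add: p_def lookup_sum monomial_mult[of 0 _ _ m, simplified])
  have "p \<in> polys V"
    unfolding p_def
  proof (rule submod_sum[OF subring1D(1)[OF subring1_polys]])
    fix \<alpha>
    have "single 0 (c \<alpha>) \<in> polys V" by (auto simp: polys_def)
    then show "single 0 (c \<alpha>) * power_product fs \<alpha> \<in> polys V"
      using power_product_in[OF subring1_polys fs(2)] by (intro subring1D(5)[OF subring1_polys])
  qed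
  moreover have "keys m \<notin> \<Delta>" if m: "m \<in> keys p" for m
  proof
    assume "keys m \<in> \<Delta>"
    have "lookup p m \<noteq> 0" using m by (simp add: in_keys_iff)
    then obtain \<alpha> where "\<alpha> \<in> A" "lookup (power_product fs \<alpha>) m \<noteq> 0"
      unfolding lookup_p by (metis (no_types, lifting) mult_zero_right sum.neutral)
    moreover have "expo_bounded N (power_product fs \<alpha>)" if "\<alpha> \<in> A"
      using expo_bounded_power_product[OF E, of \<alpha> d] that fs(1) by (simp add: A_def N_def)
    ultimately have "\<forall>v. lookup m v \<le> N" by (auto simp: expo_bounded_def in_keys_iff)
    then have "m \<in> T" using \<open>keys m \<in> \<Delta>\<close> by (simp add: T_def)
    then show False using c(2) \<open>lookup p m \<noteq> 0\<close> lookup_p by simp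
  qed
  ultimately have "p \<in> nonface_ideal V \<Delta>" by (simp add: nonface_ideal_def)
  then show ?thesis using finA c(1) fs(1) by (intro exI[of _ A] exI[of _ c]) (auto simp: A_def p_def)
qed

section \<open>Depth and dimension of the face ring\<close>

lemma var_eq_xmon: "var v = xmon {v}"
  by (simp add: var_def xmon_def expo_def)

lemma prod_var: "finite F \<Longrightarrow> (\<Prod>v\<in>F. var v) = xmon F"
proof (induction F rule: finite_induct)
  case (insert v F)
  then show ?case by (simp add: var_eq_xmon xmon_def mult_single expo_def)
qed (simp add: xmon_def expo_def)

lemma xmon_remove:
  assumes "finite A" "v \<in> A"
  shows "xmon A = xmon (A - {v}) * var v"
proof -
  have "prod var A = var v * prod var (A - {v})" using assms by (rule prod.remove)
  then show ?thesis using assms(1) by (simp add: prod_var mult.commute)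
qed

abbreviation adjoin_list :: "'r::comm_ring_1 set \<Rightarrow> 'r list \<Rightarrow> 'r set \<Rightarrow> 'r set" where
  "adjoin_list S \<equiv> fold (\<lambda>x B. adjoin B x S)"

lemma adjoin_list:
  assumes "subring1 S" "submod S B" "B \<subseteq> S" "set fs \<subseteq> S"
  shows "submod S (adjoin_list S fs B)" "B \<subseteq> adjoin_list S fs B" "adjoin_list S fs B \<subseteq> S"
    "set fs \<subseteq> adjoin_list S fs B"
proof -
  have "submod S (adjoin_list S fs B) \<and> B \<subseteq> adjoin_list S fs B \<and> adjoin_list S fs B \<subseteq> S \<and>
      set fs \<subseteq> adjoin_list S fs B"
    using assms(2-)
  proof (induction fs arbitrary: B)
    case (Cons f fs)
    have SS: "submod S S" using assms(1) by (rule subring1D)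
    have "submod S (adjoin B f S)" using Cons.prems(1) SS by (rule submod_adjoin)
    moreover have "adjoin B f S \<subseteq> S" using Cons.prems by (intro adjoin_subset[OF SS]) auto
    moreover have "B \<subseteq> adjoin B f S" using adjoin_superset subring1D(3)[OF assms(1)] by blast
    moreover have "0 + f * 1 \<in> adjoin B f S"
      using submodD(1)[OF Cons.prems(1)] subring1D(2)[OF assms(1)] by (rule in_adjoin)
    ultimately show ?case using Cons.IH[of "adjoin B f S"] Cons.prems(3) by auto
  qed simp
  then show "submod S (adjoin_list S fs B)" "B \<subseteq> adjoin_list S fs B" "adjoin_list S fs B \<subseteq> S"
    "set fs \<subseteq> adjoin_list S fs B" by blast+
qed

lemma adjoin_list_least:
  assumes "submod S M" "B \<subseteq> M" "set fs \<subseteq> M"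
  shows "adjoin_list S fs B \<subseteq> M"
  using assms(2,3)
proof (induction fs arbitrary: B)
  case (Cons f fs)
  have "f * a \<in> M" if "a \<in> S" for a
    using submodD(3)[OF assms(1) that, of f] Cons.prems(2) by (simp add: mult.commute)
  then have "adjoin B f S \<subseteq> M" using Cons.prems(1) submodD(2)[OF assms(1)] by (auto simp: adjoin_def)
  then show ?case using Cons by simp
qed simp

lemma wreg_nth:
  "wreg fs A B \<longleftrightarrow> (\<forall>i<length fs. \<forall>a\<in>A. fs ! i * a \<in> adjoin_list A (take i fs) B \<longrightarrow>
     a \<in> adjoin_list A (take i fs) B)"
proof (induction fs arbitrary: B)
  case (Cons f fs)
  show ?case unfolding wreg.simps Cons.IH by (auto simp: less_Suc_eq_0_disj)
qed simp

text \<open>Modulo the ideal both factors may be reduced to polynomials in the variables of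
  \<open>F\<close>, whose product must then be zero. The linear order on the variables orders the
  exponent vectors and so excludes zero divisors.\<close>

lemma nonface_ideal_simplex_prime:
  fixes p q :: "('a::linorder, 'k::field) mpoly"
  assumes "p \<in> polys V" "q \<in> polys V" "p * q \<in> nonface_ideal V (Pow F)"
  shows "p \<in> nonface_ideal V (Pow F) \<or> q \<in> nonface_ideal V (Pow F)"
proof -
  let ?N = "nonface_ideal V (Pow F) :: ('a, 'k) mpoly set"
  have sub: "submod (polys V) ?N" by (rule submod_nonface_ideal) (auto simp: simplicial_def)
  have split: "\<exists>p1 p2. p = p1 + p2 \<and> p1 \<in> polys V \<and> p2 \<in> ?N \<and> (\<forall>m\<in>keys p1. keys m \<subseteq> F)"
    if p: "p \<in> polys V" for p
  proof -
    let ?t = "\<lambda>k. single k (lookup p k)"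
    let ?A = "{k \<in> keys p. keys k \<subseteq> F}"
    have S: "submod (polys V) (polys V)" using subring1_polys by (rule subring1D)
    have "p = sum ?t (keys p)" by (rule sum_monomials)
    also have "\<dots> = sum ?t (keys p - ?A) + sum ?t ?A"
      by (rule sum.subset_diff) auto
    also have "\<dots> = sum ?t ?A + sum ?t (keys p - ?A)" by (rule add.commute)
    finally have "p = sum ?t ?A + sum ?t (keys p - ?A)" .
    moreover have "sum ?t ?A \<in> polys V"
      using p by (intro submod_sum[OF S]) (auto simp: polys_def)
    moreover have "sum ?t (keys p - ?A) \<in> ?N"
      using p by (intro submod_sum[OF sub] nonface_idealI) (auto simp: polys_def split: if_splits)
    moreover have "keys m \<subseteq> F" if m: "m \<in> keys (sum ?t ?A)" for m
    proof (rule ccontr)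
      assume "\<not> keys m \<subseteq> F"
      then have "lookup (sum ?t ?A) m = 0"
        by (auto simp: lookup_sum lookup_single when_def intro!: sum.neutral)
      then show False using m by (simp add: in_keys_iff)
    qed
    ultimately show ?thesis by blast
  qed
  obtain p1 p2 where p: "p = p1 + p2" "p1 \<in> polys V" "p2 \<in> ?N" "\<forall>m\<in>keys p1. keys m \<subseteq> F"
    using split[OF assms(1)] by blast
  obtain q1 q2 where q: "q = q1 + q2" "q1 \<in> polys V" "q2 \<in> ?N" "\<forall>m\<in>keys q1. keys m \<subseteq> F"
    using split[OF assms(2)] by blast
  have "p1 * q1 = p * q - (q * p2 + p1 * q2)" unfolding p(1) q(1) by (simp add: algebra_simps)
  also have "\<dots> \<in> ?N"
    by (intro submod_diff[OF subring1_polys sub] submodD(2)[OF sub] submodD(3)[OF sub] assms p q)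
  finally have pq: "p1 * q1 \<in> ?N" .
  have "keys (p1 * q1) = {}"
  proof (rule ccontr)
    assume "keys (p1 * q1) \<noteq> {}"
    then obtain m where m: "m \<in> keys (p1 * q1)" by blast
    then obtain a b where "m = a + b" "a \<in> keys p1" "b \<in> keys q1" using keys_mult[of p1 q1] by blast
    then have "keys m \<subseteq> F" using p(4) q(4) by (simp add: keys_plus_nat)
    then show False using nonface_idealD[OF pq m] by simp
  qed
  then have "p1 * q1 = 0" by (auto intro: poly_mapping_eqI simp: in_keys_iff)
  then have "p1 = 0 \<or> q1 = 0" by simp
  then show ?thesis using p q by auto
qed

section \<open>The face ring as a quotient ring\<close>

locale face_ring =
  fixes V :: "'a set" and \<Delta> :: "'a set set" and R :: "('a, 'k::field) mpoly ring"
  assumes finite_V: "finite V" and faces: "\<Delta> \<subseteq> Pow V" and simplicial: "simplicial \<Delta>"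
    and R_def: "R = poly_ring V"
begin

abbreviation P :: "('a, 'k) mpoly set" where "P \<equiv> polys V"
abbreviation J :: "('a, 'k) mpoly set" where "J \<equiv> nonface_ideal V \<Delta>"
abbreviation Q :: "('a, 'k) mpoly set ring" where "Q \<equiv> R Quot J"
abbreviation \<pi> :: "('a, 'k) mpoly \<Rightarrow> ('a, 'k) mpoly set" where "\<pi> p \<equiv> J +>\<^bsub>R\<^esub> p"

lemma R_simps [simp]: "carrier R = P" "\<zero>\<^bsub>R\<^esub> = 0" "\<one>\<^bsub>R\<^esub> = 1" "p \<otimes>\<^bsub>R\<^esub> q = p * q" "p \<oplus>\<^bsub>R\<^esub> q = p + q"
  by (simp_all add: R_def poly_ring_def polys_def)

lemma subring1_P: "subring1 P"
  by (rule subring1_polys)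

lemmas P = subring1D[OF subring1_P]

lemma cring_R: "cring R"
proof (rule cringI)
  show "abelian_group R"
  proof (rule abelian_groupI)
    fix x assume "x \<in> carrier R"
    then show "\<exists>y\<in>carrier R. y \<oplus>\<^bsub>R\<^esub> x = \<zero>\<^bsub>R\<^esub>" using P(7) by (intro bexI[of _ "- x"]) auto
  qed (simp_all add: P add.assoc add.commute)
  show "comm_monoid R" by (rule comm_monoidI) (simp_all add: P mult_ac)
qed (simp_all add: distrib_right)

sublocale R: cring R by (rule cring_R)

lemma a_inv_R: "p \<in> P \<Longrightarrow> \<ominus>\<^bsub>R\<^esub> p = - p"
  using R.minus_equality[of "- p" p] P(7) by simp

lemma ideal_submod:
  assumes "submod P M" "M \<subseteq> P"
  shows "ideal M R"
proof (rule idealI)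
  show "subgroup M (add_monoid R)"
  proof (rule R.add.subgroupI)
    show "M \<noteq> {}" using submodD(1)[OF assms(1)] by blast
    fix a assume "a \<in> M"
    then show "\<ominus>\<^bsub>R\<^esub> a \<in> M" using a_inv_R assms(2) submod_uminus[OF subring1_polys assms(1)] by auto
  qed (use assms submodD(2)[OF assms(1)] in auto)
  fix a x assume "a \<in> M" "x \<in> carrier R"
  then show "x \<otimes>\<^bsub>R\<^esub> a \<in> M" "a \<otimes>\<^bsub>R\<^esub> x \<in> M"
    using submodD(3)[OF assms(1), of x a] by (simp_all add: mult.commute)
qed (rule R.ring_axioms)

lemma submod_ideal:
  assumes "ideal M R"
  shows "submod P M" "M \<subseteq> P"
proof -
  interpret M: ideal M R by fact
  show "M \<subseteq> P" using M.a_subset by simp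
  show "submod P M"
    unfolding submod_def using M.zero_closed M.a_closed M.I_l_closed by simp
qed

lemma submod_J: "submod P J" "J \<subseteq> P"
  using submod_nonface_ideal[OF simplicial] by (auto simp: nonface_ideal_def)

lemma ideal_J: "ideal J R"
  by (rule ideal_submod[OF submod_J])

sublocale J: ideal J R by (rule ideal_J)

lemma cring_Q: "cring Q"
  by (rule J.quotient_is_cring[OF cring_R])

sublocale Q: cring Q by (rule cring_Q)

text \<open>A monomial whose support is not a face is a multiple of the squarefree monomial of its
  support.\<close>

lemma stanley_reisner_ideal_eq: "stanley_reisner_ideal V \<Delta> = J"
proof -
  let ?G = "{\<Prod>v\<in>F. var v | F. F \<subseteq> V \<and> finite F \<and> F \<notin> \<Delta>} :: ('a, 'k) mpoly set"
  have G: "?G = {xmon F | F. F \<subseteq> V \<and> F \<notin> \<Delta>}"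
  proof (intro Collect_cong iff_exI)
    fix p :: "('a, 'k) mpoly" and F
    have "finite F" if "F \<subseteq> V" using that finite_V finite_subset by blast
    then show "(p = prod var F \<and> F \<subseteq> V \<and> finite F \<and> F \<notin> \<Delta>) \<longleftrightarrow> (p = xmon F \<and> F \<subseteq> V \<and> F \<notin> \<Delta>)"
      by (auto simp: prod_var)
  qed
  have sub: "?G \<subseteq> J"
  proof
    fix p assume "p \<in> ?G"
    then obtain F where F: "p = xmon F" "F \<subseteq> V" "F \<notin> \<Delta>" unfolding G by blast
    then have "finite F" using finite_V finite_subset by blast
    then show "p \<in> J" unfolding F(1) using F(2,3)
      by (intro nonface_idealI) (auto simp: xmon_def keys_expo)
  qed
  have "Idl\<^bsub>R\<^esub> ?G \<subseteq> J" using R.genideal_minimal[OF ideal_J sub] .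
  moreover have "J \<subseteq> Idl\<^bsub>R\<^esub> ?G"
  proof -
    have I: "ideal (Idl\<^bsub>R\<^esub> ?G) R" using sub submod_J by (intro R.genideal_ideal) auto
    have "?G \<subseteq> Idl\<^bsub>R\<^esub> ?G" using sub submod_J by (intro R.genideal_self) auto
    show ?thesis
    proof (rule nonface_ideal_subsetI)
      fix m :: "'a \<Rightarrow>\<^sub>0 nat" and c :: 'k assume m: "keys m \<subseteq> V" "keys m \<notin> \<Delta>"
      have "single m c = single (m - expo (keys m)) c * xmon (keys m)"
        using monomial_factor[of "keys m" m c] by (simp add: mult.commute)
      also have "\<dots> \<in> Idl\<^bsub>R\<^esub> ?G"
      proof (rule submodD(3)[OF submod_ideal(1)[OF I]])
        have "keys (m - expo (keys m)) \<subseteq> keys m" by (auto simp: in_keys_iff lookup_minus)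
        then show "single (m - expo (keys m)) c \<in> P" using m by (auto simp: polys_def)
        show "xmon (keys m) \<in> Idl\<^bsub>R\<^esub> ?G" using \<open>?G \<subseteq> Idl\<^bsub>R\<^esub> ?G\<close> m unfolding G by blast
      qed
      finally show "single m c \<in> Idl\<^bsub>R\<^esub> ?G" .
    qed (use submodD[OF submod_ideal(1)[OF I]] in auto)
  qed
  ultimately show ?thesis by (simp add: stanley_reisner_ideal_def R_def)
qed

lemma carrier_Q: "carrier Q = \<pi> ` P"
  by (auto simp: FactRing_def A_RCOSETS_def')

lemma \<pi>_mult: "p \<in> P \<Longrightarrow> q \<in> P \<Longrightarrow> \<pi> p \<otimes>\<^bsub>Q\<^esub> \<pi> q = \<pi> (p * q)"
  using J.rcoset_mult_add by (simp add: FactRing_def)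

lemma \<pi>_one: "\<one>\<^bsub>Q\<^esub> = \<pi> 1"
  by (simp add: FactRing_def)

lemma \<pi>_mem_image:
  assumes "submod P M" "J \<subseteq> M" "p \<in> P"
  shows "\<pi> p \<in> \<pi> ` M \<longleftrightarrow> p \<in> M"
proof
  assume "\<pi> p \<in> \<pi> ` M"
  then obtain m where m: "m \<in> M" "\<pi> p = \<pi> m" by blast
  have "0 + p \<in> \<pi> p" using submodD(1)[OF submod_J(1)] by (force simp: a_r_coset_def')
  then have "p \<in> \<pi> m" using m by simp
  then obtain j where "j \<in> J" "p = j + m" by (auto simp: a_r_coset_def')
  then show "p \<in> M" using assms m submodD(2)[OF assms(1)] by blast
qed blast

lemma ideal_image: "submod P M \<Longrightarrow> M \<subseteq> P \<Longrightarrow> ideal (\<pi> ` M) Q"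
  by (rule R.ring_ideal_imp_quot_ideal[OF ideal_J ideal_submod])

lemma submod_vimage:
  assumes "ideal N Q"
  shows "submod P {p \<in> P. \<pi> p \<in> N}" "J \<subseteq> {p \<in> P. \<pi> p \<in> N}"
proof -
  have "ideal {p \<in> carrier R. \<pi> p \<in> N} R"
    by (rule ring_hom_ring.ideal_vimage[OF J.rcos_ring_hom_ring assms])
  then show "submod P {p \<in> P. \<pi> p \<in> N}" using submod_ideal by simp
  have "\<pi> p \<in> N" if "p \<in> J" for p
  proof -
    have "\<pi> p = \<zero>\<^bsub>Q\<^esub>" using J.a_rcos_const[OF that] by (simp add: FactRing_def)
    then show ?thesis using additive_subgroup.zero_closed[OF ideal.axioms(1)[OF assms]] by simp
  qed
  then show "J \<subseteq> {p \<in> P. \<pi> p \<in> N}" using submod_J by blast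
qed

lemma genideal_vimage:
  assumes "X \<subseteq> P"
  shows "ideal (Idl\<^bsub>Q\<^esub> (\<pi> ` X)) Q" "X \<subseteq> {p \<in> P. \<pi> p \<in> Idl\<^bsub>Q\<^esub> (\<pi> ` X)}"
proof -
  have sub: "\<pi> ` X \<subseteq> carrier Q" using assms by (auto simp: carrier_Q)
  show "ideal (Idl\<^bsub>Q\<^esub> (\<pi> ` X)) Q" by (rule Q.genideal_ideal[OF sub])
  show "X \<subseteq> {p \<in> P. \<pi> p \<in> Idl\<^bsub>Q\<^esub> (\<pi> ` X)}" using Q.genideal_self[OF sub] assms by auto
qed

lemma genideal_vimage_least:
  assumes "submod P M" "M \<subseteq> P" "J \<subseteq> M" "X \<subseteq> M" "p \<in> P" "\<pi> p \<in> Idl\<^bsub>Q\<^esub> (\<pi> ` X)"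
  shows "p \<in> M"
proof -
  have "Idl\<^bsub>Q\<^esub> (\<pi> ` X) \<subseteq> \<pi> ` M"
    using assms by (intro Q.genideal_minimal ideal_image) auto
  then show ?thesis using \<pi>_mem_image[OF assms(1,3,5)] assms(6) by blast
qed

lemma genideal_list:
  assumes "set fs \<subseteq> P" "p \<in> P"
  shows "\<pi> p \<in> Idl\<^bsub>Q\<^esub> (\<pi> ` set fs) \<longleftrightarrow> p \<in> adjoin_list P fs J"
proof
  note A = adjoin_list[OF subring1_polys submod_J assms(1)]
  show "\<pi> p \<in> Idl\<^bsub>Q\<^esub> (\<pi> ` set fs) \<Longrightarrow> p \<in> adjoin_list P fs J"
    by (rule genideal_vimage_least[OF A(1,3,2,4) assms(2)])
  show "p \<in> adjoin_list P fs J \<Longrightarrow> \<pi> p \<in> Idl\<^bsub>Q\<^esub> (\<pi> ` set fs)"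
    using adjoin_list_least[OF submod_vimage[OF genideal_vimage(1)[OF assms(1)]] genideal_vimage(2)[OF assms(1)]]
    by blast
qed

lemma regular_sequence_iff:
  assumes "set fs \<subseteq> P"
  shows "regular_sequence Q (map \<pi> fs) \<longleftrightarrow> wreg fs P J \<and> 1 \<notin> adjoin_list P fs J"
proof -
  have take: "set (take i fs) \<subseteq> P" for i using assms set_take_subset[of i fs] by blast
  have "(\<forall>y\<in>carrier Q. map \<pi> fs ! i \<otimes>\<^bsub>Q\<^esub> y \<in> Idl\<^bsub>Q\<^esub> (set (take i (map \<pi> fs))) \<longrightarrow>
      y \<in> Idl\<^bsub>Q\<^esub> (set (take i (map \<pi> fs)))) \<longleftrightarrow>
      (\<forall>a\<in>P. fs ! i * a \<in> adjoin_list P (take i fs) J \<longrightarrow> a \<in> adjoin_list P (take i fs) J)"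
    if i: "i < length fs" for i
  proof -
    have f: "fs ! i \<in> P" using assms i by auto
    have eq: "\<pi> (fs ! i) \<otimes>\<^bsub>Q\<^esub> \<pi> a \<in> Idl\<^bsub>Q\<^esub> (\<pi> ` set (take i fs)) \<longleftrightarrow>
        fs ! i * a \<in> adjoin_list P (take i fs) J" if "a \<in> P" for a
      using \<pi>_mult[OF f that] genideal_list[OF take P(5)[OF f that]] by simp
    show ?thesis using i by (simp add: carrier_Q take_map eq genideal_list[OF take])
  qed
  moreover have "Idl\<^bsub>Q\<^esub> (set (map \<pi> fs)) \<noteq> carrier Q \<longleftrightarrow> 1 \<notin> adjoin_list P fs J"
  proof -
    have "Idl\<^bsub>Q\<^esub> (\<pi> ` set fs) = carrier Q \<longleftrightarrow> \<one>\<^bsub>Q\<^esub> \<in> Idl\<^bsub>Q\<^esub> (\<pi> ` set fs)"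
      using ideal.one_imp_carrier[OF genideal_vimage(1)[OF assms]] Q.one_closed by blast
    then show ?thesis using genideal_list[OF assms P(2)] by (simp add: \<pi>_one)
  qed
  moreover have "set (map \<pi> fs) \<subseteq> carrier Q" using assms by (auto simp: carrier_Q)
  ultimately show ?thesis unfolding regular_sequence_def wreg_nth by auto
qed

lemma regular_sequence_lift:
  assumes "regular_sequence Q xs"
  obtains fs where "set fs \<subseteq> P" "xs = map \<pi> fs"
proof -
  have "set xs \<subseteq> \<pi> ` P" using assms by (simp add: regular_sequence_def carrier_Q)
  then have "\<exists>fs. set fs \<subseteq> P \<and> xs = map \<pi> fs"
  proof (induction xs)
    case (Cons x xs)
    then obtain fs p where "set fs \<subseteq> P" "xs = map \<pi> fs" "p \<in> P" "x = \<pi> p" by auto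
    then show ?case by (intro exI[of _ "p # fs"]) auto
  qed simp
  then show thesis using that by blast
qed

text \<open>The first \<open>s + 1\<close> elements would be algebraically dependent modulo
  \<open>J\<close>, while \<open>chain_independent\<close> excludes this. Constants can serve as its
  coefficients: as 1 is not in the last ideal, no nonzero constant is. The family \<open>B\<close>
  is left general so that regular sequences and chains of primes are both covered.\<close>

lemma chain_length_le:
  assumes dim: "\<And>F. F \<in> \<Delta> \<Longrightarrow> card F \<le> s" and fs: "set fs \<subseteq> P"
    and B: "\<And>i. i \<le> length fs \<Longrightarrow> submod P (B i)" "J \<subseteq> B 0" "1 \<notin> B (length fs)"
    and chain: "\<And>i. i < length fs \<Longrightarrow> fs ! i \<in> B (Suc i) \<and> B i \<subseteq> B (Suc i) \<and>
      (\<forall>a\<in>P. fs ! i * a \<in> B i \<longrightarrow> a \<in> B i)"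
  shows "length fs \<le> s"
proof (rule ccontr)
  assume "\<not> length fs \<le> s"
  define gs where "gs = take (Suc s) fs"
  have len: "length gs = Suc s" "Suc s \<le> length fs" using \<open>\<not> length fs \<le> s\<close> by (auto simp: gs_def)
  have gs: "set gs \<subseteq> P" using fs set_take_subset[of "Suc s" fs] by (auto simp: gs_def)
  have fin: "finite \<Delta>" using finite_V faces by (meson finite_Pow_iff finite_subset)
  have fc: "finite F \<and> card F \<le> s" if "F \<in> \<Delta>" for F
    using that dim faces finite_V finite_subset by blast
  obtain A c where A: "finite A" "\<forall>\<alpha>\<in>A. length \<alpha> = length gs" "\<exists>\<alpha>\<in>A. c \<alpha> \<noteq> 0"
    "(\<Sum>\<alpha>\<in>A. single 0 (c \<alpha>) * power_product gs \<alpha>) \<in> J"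
    using algebraically_dependent[OF fin fc len(1) gs] by blast
  have mono: "B i \<subseteq> B (length fs)" if "i \<le> length fs" for i
    using that
  proof (induction rule: inc_induct)
    case (step i)
    then show ?case using chain[of i] by auto
  qed simp
  have one: "1 \<notin> B (Suc s)" using mono[OF len(2)] B(3) by blast
  obtain \<alpha> where \<alpha>: "\<alpha> \<in> A" "c \<alpha> \<noteq> 0" using A(3) by blast
  have "single 0 (c \<alpha>) = (0 :: ('a, 'k) mpoly)"
  proof (rule chain_independent[OF subring1_polys gs, where B = B and A = A
        and K = "range (single 0)" and \<alpha> = \<alpha> and c = "\<lambda>\<alpha>. single 0 (c \<alpha>)"])
    show "submod P (B i)" if "i \<le> length gs" for i using B(1)[of i] that len by simp
    show "gs ! i \<in> B (Suc i) \<and> B i \<subseteq> B (Suc i) \<and> (\<forall>a\<in>P. gs ! i * a \<in> B i \<longrightarrow> a \<in> B i)"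
      if "i < length gs" for i using chain[of i] that len by (simp add: gs_def)
    show "k \<in> P \<and> (k \<in> B (length gs) \<longrightarrow> k = 0)" if k: "k \<in> range (single 0)" for k
    proof -
      obtain a where a: "k = single 0 a" using k by blast
      have const: "single 0 x \<in> P" for x by (auto simp: polys_def)
      have "a = 0" if "k \<in> B (length gs)"
      proof (rule ccontr)
        assume "a \<noteq> 0"
        have "single 0 (1 / a) * k \<in> B (length gs)"
          using submodD(3)[OF B(1) const that] len by simp
        then show False using one len \<open>a \<noteq> 0\<close> by (simp add: a mult_single)
      qed
      then show ?thesis using a const by auto
    qed
  qed (use A B(2) \<alpha> in auto)
  then show False using \<alpha>(2) by (metis lookup_single_eq lookup_zero)
qed

lemma regular_sequence_length_le:
  assumes "\<And>F. F \<in> \<Delta> \<Longrightarrow> card F \<le> s" "regular_sequence Q xs"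
  shows "length xs \<le> s"
proof -
  obtain fs where fs: "set fs \<subseteq> P" "xs = map \<pi> fs" using regular_sequence_lift[OF assms(2)] .
  have reg: "wreg fs P J" "1 \<notin> adjoin_list P fs J"
    using assms(2) regular_sequence_iff[OF fs(1)] fs(2) by auto
  have take: "set (take i fs) \<subseteq> P" for i using fs set_take_subset[of i fs] by blast
  note A = adjoin_list[OF subring1_polys submod_J take]
  have "length fs \<le> s"
  proof (rule chain_length_le[OF assms(1) fs(1), where B = "\<lambda>i. adjoin_list P (take i fs) J"])
    fix i assume i: "i < length fs"
    have Suc: "adjoin_list P (take (Suc i) fs) J = adjoin (adjoin_list P (take i fs) J) (fs ! i) P"
      using i by (simp add: take_Suc_conv_app_nth)
    have "fs ! i \<in> set (take (Suc i) fs)" using i by (simp add: take_Suc_conv_app_nth)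
    then have "fs ! i \<in> adjoin_list P (take (Suc i) fs) J" using A(4)[of "Suc i"] by blast
    moreover have "adjoin_list P (take i fs) J \<subseteq> adjoin_list P (take (Suc i) fs) J"
      unfolding Suc using P(3) by (rule adjoin_superset)
    ultimately show "fs ! i \<in> adjoin_list P (take (Suc i) fs) J \<and>
      adjoin_list P (take i fs) J \<subseteq> adjoin_list P (take (Suc i) fs) J \<and>
      (\<forall>a\<in>P. fs ! i * a \<in> adjoin_list P (take i fs) J \<longrightarrow> a \<in> adjoin_list P (take i fs) J)"
      using reg(1) i unfolding wreg_nth by blast
  qed (use A reg(2) in auto)
  then show ?thesis using fs(2) by simp
qed

text \<open>An element of \<open>B (Suc i)\<close> outside \<open>B i\<close> is a nonzerodivisor
  modulo \<open>B i\<close>, because the preimage \<open>B i\<close> is prime.\<close>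

lemma prime_chain_length_le:
  assumes "\<And>F. F \<in> \<Delta> \<Longrightarrow> card F \<le> s"
    and prime: "\<And>i. i \<le> n \<Longrightarrow> primeideal (N i) Q" and strict: "\<And>i. i < n \<Longrightarrow> N i \<subset> N (Suc i)"
  shows "n \<le> s"
proof -
  define B where "B i = {p \<in> P. \<pi> p \<in> N i}" for i
  have ideal: "ideal (N i) Q" if "i \<le> n" for i using prime[OF that] by (rule primeideal.axioms)
  have "\<exists>p. p \<in> B (Suc i) \<and> p \<notin> B i" if i: "i < n" for i
  proof -
    obtain x where x: "x \<in> N (Suc i)" "x \<notin> N i" using strict[OF i] by blast
    then have "x \<in> carrier Q" using ideal.Icarr[OF ideal[of "Suc i"]] i by simp
    then show ?thesis using x by (auto simp: carrier_Q B_def)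
  qed
  then obtain f where f: "\<And>i. i < n \<Longrightarrow> f i \<in> B (Suc i) \<and> f i \<notin> B i" by metis
  have "length (map f [0..<n]) \<le> s"
  proof (rule chain_length_le[OF assms(1), where B = B])
    show "set (map f [0..<n]) \<subseteq> P" using f by (auto simp: B_def)
    show "submod P (B i)" if "i \<le> length (map f [0..<n])" for i
      unfolding B_def using submod_vimage(1)[OF ideal] that by simp
    show "J \<subseteq> B 0" unfolding B_def using submod_vimage(2)[OF ideal] by simp
    show "1 \<notin> B (length (map f [0..<n]))"
    proof
      assume "1 \<in> B (length (map f [0..<n]))"
      then have "\<one>\<^bsub>Q\<^esub> \<in> N n" by (simp add: B_def \<pi>_one)
      then show False
        using ideal.one_imp_carrier[OF ideal[of n]] primeideal.I_notcarr[OF prime[of n]] by simp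
    qed
    fix i assume "i < length (map f [0..<n])"
    then have i: "i < n" by simp
    have "a \<in> B i" if a: "a \<in> P" "f i * a \<in> B i" for a
    proof -
      have fi: "f i \<in> P" "\<pi> (f i) \<notin> N i" using f[OF i] by (auto simp: B_def)
      have "\<pi> (f i) \<otimes>\<^bsub>Q\<^esub> \<pi> a \<in> N i" using a fi \<pi>_mult by (simp add: B_def)
      moreover have "\<pi> (f i) \<in> carrier Q" "\<pi> a \<in> carrier Q" using a fi by (auto simp: carrier_Q)
      ultimately have "\<pi> a \<in> N i"
        using primeideal.I_prime[OF prime[of i]] fi i by (metis less_imp_le)
      then show ?thesis using a by (simp add: B_def)
    qed
    moreover have "B i \<subseteq> B (Suc i)" using strict[OF i] by (auto simp: B_def)
    ultimately show "map f [0..<n] ! i \<in> B (Suc i) \<and> B i \<subseteq> B (Suc i) \<and>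
        (\<forall>a\<in>P. map f [0..<n] ! i * a \<in> B i \<longrightarrow> a \<in> B i)"
      using f[OF i] i by simp
  qed
  then show ?thesis by simp
qed

section \<open>The irrelevant ideal, depth and dimension\<close>

definition m_ideal :: "('a, 'k) mpoly set set" where
  "m_ideal = Idl\<^bsub>Q\<^esub> (\<pi> ` var ` V)"

lemma cohen_macaulay_iff:
  "cohen_macaulay_complex TYPE('k) V \<Delta> \<longleftrightarrow> depth Q m_ideal = krull_dim Q"
proof -
  have "{\<pi> (var v) | v. v \<in> V} = \<pi> ` var ` V" by blast
  then show ?thesis
    unfolding cohen_macaulay_complex_def irrelevant_ideal_def stanley_reisner_ring_def
      stanley_reisner_ideal_eq R_def[symmetric] m_ideal_def by simp
qed

lemma var_in_P: "var ` V \<subseteq> P"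
  by (auto simp: var_eq_xmon intro!: xmon_in_polys)

lemma esym_in_m_ideal: "\<pi> (esym V (Suc i)) \<in> m_ideal"
proof -
  let ?M = "{p \<in> P. \<pi> p \<in> m_ideal}"
  have M: "submod P ?M" "var ` V \<subseteq> ?M"
    using submod_vimage(1)[OF genideal_vimage(1)[OF var_in_P]] genideal_vimage(2)[OF var_in_P]
    unfolding m_ideal_def by blast+
  have "esym V (Suc i) \<in> ?M"
    unfolding esym_def
  proof (rule submod_sum[OF M(1)])
    fix A assume "A \<in> {A. A \<subseteq> V \<and> card A = Suc i}"
    then have A: "A \<subseteq> V" "finite A" "A \<noteq> {}" using finite_V finite_subset by auto
    then obtain v where v: "v \<in> A" by blast
    have "xmon (A - {v}) \<in> P" using A by (intro xmon_in_polys) auto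
    moreover have "var v \<in> ?M" using M(2) v A by blast
    ultimately have "xmon (A - {v}) * var v \<in> ?M" by (rule submodD(3)[OF M(1)])
    then show "xmon A \<in> ?M" by (simp only: xmon_remove[OF A(2) v])
  qed
  then show ?thesis by blast
qed

text \<open>The polynomials with some power in the span form an ideal that contains \<open>J\<close>
  and, since each parameter is a variable or its square, all variables.\<close>

lemma m_ideal_radical:
  assumes "f \<in> P" "\<pi> f \<in> m_ideal"
  shows "\<exists>t. f ^ t \<in> span_mod V (param U) P J"
proof -
  let ?Y = "span_mod V (param U) P J"
  have paramP: "param U v \<in> P" if "v \<in> V" for v using that by (auto simp: param_def polys_def)
  have Y: "submod P ?Y"
    unfolding submod_def
  proof (intro conjI ballI)
    show "0 \<in> ?Y" unfolding span_mod_def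
      using P(3) submodD(1)[OF submod_J(1)]
      by (intro CollectI exI[of _ "\<lambda>_. 0"] exI[of _ 0]) auto
    fix p q assume "p \<in> ?Y" "q \<in> ?Y"
    then obtain a b a' b' where "p = (\<Sum>v\<in>V. a v * param U v) + b" "\<forall>v\<in>V. a v \<in> P" "b \<in> J"
      "q = (\<Sum>v\<in>V. a' v * param U v) + b'" "\<forall>v\<in>V. a' v \<in> P" "b' \<in> J"
      unfolding span_mod_def by blast
    then show "p + q \<in> ?Y" unfolding span_mod_def
      using P(4) submodD(2)[OF submod_J(1)]
      by (intro CollectI exI[of _ "\<lambda>v. a v + a' v"] exI[of _ "b + b'"])
        (auto simp: algebra_simps sum.distrib)
  next
    fix c p assume c: "c \<in> P" and "p \<in> ?Y"
    then obtain a b where "p = (\<Sum>v\<in>V. a v * param U v) + b" "\<forall>v\<in>V. a v \<in> P" "b \<in> J"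
      unfolding span_mod_def by blast
    then show "c * p \<in> ?Y" unfolding span_mod_def
      using P(5)[OF c] submodD(3)[OF submod_J(1) c]
      by (intro CollectI exI[of _ "\<lambda>v. c * a v"] exI[of _ "c * b"])
        (auto simp: distrib_left sum_distrib_left mult.assoc)
  qed
  have JY: "J \<subseteq> ?Y"
  proof
    fix b assume "b \<in> J"
    then show "b \<in> ?Y" unfolding span_mod_def
      using P(3) by (intro CollectI exI[of _ "\<lambda>_. 0"] exI[of _ b]) auto
  qed
  have paramY: "param U v \<in> ?Y" if "v \<in> V" for v
    unfolding span_mod_def
    using that P(2,3) submodD(1)[OF submod_J(1)] finite_V
    by (intro CollectI exI[of _ "\<lambda>u. if u = v then 1 else 0"] exI[of _ 0]) (auto simp: if_distrib[of "\<lambda>x. x * _"] cong: if_cong)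
  define M where "M = {f \<in> P. \<exists>t. f ^ t \<in> ?Y}"
  have power_mem: "p ^ k \<in> ?Y" if "p ^ t \<in> ?Y" "t \<le> k" "p \<in> P" for p t k
  proof -
    have "p ^ k = p ^ (k - t) * p ^ t" using that(2) by (simp flip: power_add)
    then show ?thesis using submodD(3)[OF Y subring1_power[OF subring1_polys that(3)] that(1)] by simp
  qed
  have "submod P M"
    unfolding submod_def
  proof (intro conjI ballI)
    have "(0 :: ('a, 'k) mpoly) ^ 1 \<in> ?Y" using submodD(1)[OF Y] by simp
    then show "0 \<in> M" unfolding M_def using P(3) by blast
    fix p q assume "p \<in> M" "q \<in> M"
    then obtain t u where pq: "p \<in> P" "q \<in> P" "p ^ t \<in> ?Y" "q ^ u \<in> ?Y" unfolding M_def by blast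
    have nat: "of_nat k \<in> P" for k by (induction k) (auto simp: P)
    have "(p + q) ^ (t + u) = (\<Sum>k\<le>t + u. of_nat (t + u choose k) * p ^ k * q ^ (t + u - k))"
      by (rule binomial_ring)
    also have "\<dots> \<in> ?Y"
    proof (rule submod_sum[OF Y])
      fix k
      have pow: "p ^ i \<in> P" "q ^ i \<in> P" for i using pq subring1_power[OF subring1_polys] by blast+
      show "of_nat (t + u choose k) * p ^ k * q ^ (t + u - k) \<in> ?Y"
      proof (cases "t \<le> k")
        case True
        then have "(of_nat (t + u choose k) * q ^ (t + u - k)) * p ^ k \<in> ?Y"
          using power_mem[OF pq(3) _ pq(1)] nat pow P(5) by (intro submodD(3)[OF Y]) auto
        then show ?thesis by (simp add: mult_ac)
      next
        case False
        then have "u \<le> t + u - k" by simp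
        then show ?thesis
          using power_mem[OF pq(4) _ pq(2)] nat pow P(5) by (intro submodD(3)[OF Y]) auto
      qed
    qed
    finally show "p + q \<in> M" unfolding M_def using pq P(4) by blast
  next
    fix c p assume "c \<in> P" "p \<in> M"
    then obtain t where "c \<in> P" "p \<in> P" "p ^ t \<in> ?Y" unfolding M_def by blast
    then have "(c * p) ^ t \<in> ?Y" "c * p \<in> P"
      using submodD(3)[OF Y subring1_power[OF subring1_polys]] P(5) by (auto simp: power_mult_distrib)
    then show "c * p \<in> M" unfolding M_def by blast
  qed
  moreover have "M \<subseteq> P" by (auto simp: M_def)
  moreover have "J \<subseteq> M"
  proof
    fix b assume "b \<in> J"
    then have "b ^ 1 \<in> ?Y" "b \<in> P" using JY submod_J by auto
    then show "b \<in> M" unfolding M_def by blast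
  qed
  moreover have "var ` V \<subseteq> M"
  proof
    fix f :: "('a, 'k) mpoly" assume "f \<in> var ` V"
    then obtain v where v: "v \<in> V" "f = var v" by blast
    have "f ^ (if v \<in> U then 1 else 2) = param U v"
    proof -
      have two: "single v 1 + single v 1 = single v (2 :: nat)"
        by (metis one_add_one single_add)
      show ?thesis
        unfolding v(2) var_def param_def
        by (cases "v \<in> U")
          (simp_all only: if_True if_False power_one_right power2_eq_square mult_single two mult_1)
    qed
    then have "f ^ (if v \<in> U then 1 else 2) \<in> ?Y" using paramY[OF v(1)] by metis
    then show "f \<in> M" unfolding M_def using var_in_P v by blast
  qed
  ultimately have "f \<in> M"
    using genideal_vimage_least[of M "var ` V" f] assms unfolding m_ideal_def by blast
  then show ?thesis by (simp add: M_def)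
qed

lemma depth_le:
  assumes "\<And>xs. regular_sequence Q xs \<Longrightarrow> set xs \<subseteq> I \<Longrightarrow> length xs \<le> s"
  shows "depth Q I \<le> enat s"
  unfolding depth_def using assms by (intro Sup_least) auto

lemma krull_dim_le:
  assumes "\<And>F. F \<in> \<Delta> \<Longrightarrow> card F \<le> s"
  shows "krull_dim Q \<le> enat s"
  unfolding krull_dim_def
proof (rule Sup_least, clarify)
  fix n N assume "\<forall>i\<le>n. primeideal (N i) Q" "\<forall>i<n. N i \<subset> N (Suc i)"
  then have "n \<le> s" by (intro prime_chain_length_le[OF assms, of n N]) auto
  then show "enat n \<le> enat s" by simp
qed

text \<open>Weak regularity lacks only properness. Polynomials without constant term form an ideal
  containing all \<open>esym V (Suc i)\<close> and, because \<open>{}\<close> is a face, also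
  \<open>J\<close>.\<close>

lemma depth_ge:
  assumes "\<Delta> \<noteq> {}" "wreg (esyms V s) P J"
  shows "enat s \<le> depth Q m_ideal"
proof -
  have es: "set (esyms V s) \<subseteq> P" by (rule esyms_in_polys[OF finite_V])
  let ?Z = "{p \<in> P. 0 \<notin> keys p}"
  have "{} \<in> \<Delta>" using assms(1) simplicial by (auto simp: simplicial_def)
  have "?Z = nonface_ideal V {{}}" by (auto simp: nonface_ideal_def)
  moreover have "submod P (nonface_ideal V {{}} :: ('a, 'k) mpoly set)"
    by (rule submod_nonface_ideal) (auto simp: simplicial_def)
  ultimately have Z: "submod P ?Z" by simp
  have "esym V (Suc i) \<in> ?Z" for i
    unfolding esym_def
  proof (rule submod_sum[OF Z])
    fix A assume "A \<in> {A. A \<subseteq> V \<and> card A = Suc i}"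
    then have A: "A \<subseteq> V" "finite A" "A \<noteq> {}" using finite_V finite_subset by auto
    then have "expo A \<noteq> 0" using keys_expo[OF A(2)] by auto
    then show "xmon A \<in> ?Z" using A xmon_in_polys by (auto simp: xmon_def)
  qed
  then have "set (esyms V s) \<subseteq> ?Z" by (induction s) auto
  moreover have "J \<subseteq> ?Z" using \<open>{} \<in> \<Delta>\<close> by (auto simp: nonface_ideal_def)
  ultimately have "adjoin_list P (esyms V s) J \<subseteq> ?Z" using adjoin_list_least[OF Z] by blast
  moreover have "1 \<notin> ?Z" by simp
  ultimately have "regular_sequence Q (map \<pi> (esyms V s))"
    using regular_sequence_iff[OF es] assms(2) by blast
  moreover have "set (map \<pi> (esyms V s)) \<subseteq> m_ideal"
    by (induction s) (auto simp: esym_in_m_ideal)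
  ultimately show ?thesis
    unfolding depth_def by (intro Sup_upper CollectI exI[of _ "map \<pi> (esyms V s)"]) simp
qed

end

lemma (in face_ring) cohen_macaulay_void:
  assumes "\<Delta> = {}"
  shows "cohen_macaulay_complex TYPE('k) V \<Delta>"
proof -
  have JP: "J = P" unfolding assms by (simp add: polys_eq)
  have "\<not> regular_sequence Q xs" for xs
  proof
    assume reg: "regular_sequence Q xs"
    then obtain fs where fs: "set fs \<subseteq> P" "xs = map \<pi> fs" by (rule regular_sequence_lift)
    then have "1 \<notin> adjoin_list P fs J" using reg regular_sequence_iff by simp
    then show False using adjoin_list(2)[OF subring1_polys submod_J fs(1)] JP P(2) by blast
  qed
  then have "depth Q m_ideal = 0" by (simp add: depth_def bot_enat_def)
  moreover have "\<not> primeideal N Q" for N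
  proof
    assume "primeideal N Q"
    then interpret N: primeideal N Q .
    have "\<pi> 1 \<in> N" using submod_vimage(2)[OF N.is_ideal] JP P(2) by blast
    then show False using N.one_imp_carrier N.I_notcarr by (simp add: \<pi>_one)
  qed
  then have "{enat n | n. \<exists>N. (\<forall>i\<le>n. primeideal (N i) Q) \<and> (\<forall>i<n. N i \<subset> N (Suc i))} = {}"
    by blast
  then have "krull_dim Q = 0" unfolding krull_dim_def by (simp only: Sup_empty bot_enat_def)
  ultimately show ?thesis by (simp add: cohen_macaulay_iff)
qed

locale face_ring_linorder = face_ring V \<Delta> R
  for V :: "'a::linorder set" and \<Delta> :: "'a set set" and R :: "('a, 'k::field) mpoly ring"
begin

lemma primeideal_face:
  assumes "F \<in> \<Delta>"
  shows "primeideal (\<pi> ` nonface_ideal V (Pow F)) Q"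
proof -
  let ?N = "nonface_ideal V (Pow F) :: ('a, 'k) mpoly set"
  have N: "submod P ?N" by (rule submod_nonface_ideal) (auto simp: simplicial_def)
  have NP: "?N \<subseteq> P" by (auto simp: nonface_ideal_def)
  have "Pow F \<subseteq> \<Delta>" using assms simplicial by (auto simp: simplicial_def)
  then have JN: "J \<subseteq> ?N" by (auto simp: nonface_ideal_def)
  note mem = \<pi>_mem_image[OF N JN]
  show ?thesis
  proof (rule primeidealI[OF ideal_image[OF N NP] cring_Q])
    have "1 \<notin> ?N" by (auto dest: nonface_idealD)
    then have "\<pi> 1 \<notin> \<pi> ` ?N" using mem[OF P(2)] by simp
    then show "carrier Q \<noteq> \<pi> ` ?N" using P(2) by (auto simp: carrier_Q)
    fix a b assume ab: "a \<in> carrier Q" "b \<in> carrier Q" "a \<otimes>\<^bsub>Q\<^esub> b \<in> \<pi> ` ?N"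
    then obtain p q where pq: "p \<in> P" "q \<in> P" "a = \<pi> p" "b = \<pi> q" by (auto simp: carrier_Q)
    then have "p * q \<in> ?N" using ab(3) \<pi>_mult mem[OF P(5)] by simp
    then show "a \<in> \<pi> ` ?N \<or> b \<in> \<pi> ` ?N"
      using nonface_ideal_simplex_prime[OF pq(1,2)] pq(3,4) by blast
  qed
qed

text \<open>Dropping the vertices of \<open>F\<close> one at a time enlarges the prime of the
  remaining face, which yields \<open>card F + 1\<close> primes in a strict chain.\<close>

lemma krull_dim_ge:
  assumes "F \<in> \<Delta>"
  shows "enat (card F) \<le> krull_dim Q"
proof -
  have F: "F \<subseteq> V" "finite F" using assms faces finite_V finite_subset by blast+
  obtain xs where xs: "set xs = F" "distinct xs" using finite_distinct_list[OF F(2)] by blast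
  define N where "N i = \<pi> ` (nonface_ideal V (Pow (set (drop i xs))) :: ('a, 'k) mpoly set)" for i
  have face: "set (drop i xs) \<in> \<Delta>" for i
    using assms simplicial set_drop_subset[of i xs] xs by (auto simp: simplicial_def)
  have "N i \<subset> N (Suc i)" if i: "i < length xs" for i
  proof -
    let ?A = "nonface_ideal V (Pow (set (drop i xs))) :: ('a, 'k) mpoly set"
    let ?B = "nonface_ideal V (Pow (set (drop (Suc i) xs))) :: ('a, 'k) mpoly set"
    have drop: "drop i xs = xs ! i # drop (Suc i) xs" using i by (simp add: Cons_nth_drop_Suc)
    have "distinct (drop i xs)" using xs(2) by simp
    then have new: "xs ! i \<notin> set (drop (Suc i) xs)" unfolding drop by simp
    have v: "xs ! i \<in> V" using i xs F by auto
    have "?A \<subseteq> ?B" unfolding drop by (auto simp: nonface_ideal_def)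
    moreover have "var (xs ! i) \<in> ?B"
      using v new by (intro nonface_idealI) (auto simp: var_eq_xmon xmon_def keys_expo split: if_splits)
    moreover have "var (xs ! i) \<notin> ?A"
    proof
      assume A: "var (xs ! i) \<in> ?A"
      have "expo {xs ! i} \<in> keys (var (xs ! i) :: ('a, 'k) mpoly)" by (simp add: var_eq_xmon xmon_def)
      from nonface_idealD[OF A this] show False unfolding drop by (simp add: keys_expo)
    qed
    moreover have "submod P ?A" by (rule submod_nonface_ideal) (auto simp: simplicial_def)
    moreover have "J \<subseteq> ?A"
      using face[of i] simplicial by (auto simp: nonface_ideal_def simplicial_def)
    ultimately have "N i \<subseteq> N (Suc i)" "\<pi> (var (xs ! i)) \<in> N (Suc i)" "\<pi> (var (xs ! i)) \<notin> N i"
      using \<pi>_mem_image[of ?A "var (xs ! i)"] var_in_P v unfolding N_def by blast+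
    then show ?thesis by blast
  qed
  moreover have "primeideal (N i) Q" for i unfolding N_def by (rule primeideal_face[OF face])
  moreover have "card F = length xs" using xs distinct_card by metis
  ultimately show ?thesis
    unfolding krull_dim_def by (intro Sup_upper) blast
qed

lemma cohen_macaulay_shelled:
  assumes "shelled s \<Delta>" "F \<in> \<Delta>" "card F = s" "\<And>F. F \<in> \<Delta> \<Longrightarrow> card F \<le> s"
  shows "cohen_macaulay_complex TYPE('k) V \<Delta>"
proof -
  have "\<Union>\<Delta> \<subseteq> V" using faces by blast
  then have "wreg (esyms V s) P J" using wreg_shelled[OF finite_V assms(1)] by blast
  then have "enat s \<le> depth Q m_ideal" using depth_ge assms(2) by blast
  moreover have "depth Q m_ideal \<le> enat s"
    by (rule depth_le) (use regular_sequence_length_le[OF assms(4)] in blast)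
  moreover have "krull_dim Q \<le> enat s" by (rule krull_dim_le[OF assms(4)])
  moreover have "enat s \<le> krull_dim Q" using krull_dim_ge[OF assms(2)] assms(3) by simp
  ultimately show ?thesis by (simp add: cohen_macaulay_iff)
qed

text \<open>The complement of any member is a face of size \<open>card V - r\<close>, which the
  dimension reaches, whereas \<open>obstruction_bound\<close> keeps regular sequences in the
  irrelevant ideal strictly shorter. \<open>r < card V\<close> guards the natural-number
  subtraction.\<close>

lemma not_cohen_macaulay_obstruction:
  fixes c :: "'a set \<Rightarrow> 'k"
  assumes \<Delta>: "\<Delta> = co_complex V D" and D: "\<And>W. W \<in> D \<Longrightarrow> W \<subseteq> V \<and> card W = r" "D \<noteq> {}"
    and ob: "U \<subseteq> V" "obstruction U r D c"
  shows "\<not> cohen_macaulay_complex TYPE('k) V \<Delta>"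
proof
  assume "cohen_macaulay_complex TYPE('k) V \<Delta>"
  then have eq: "depth Q m_ideal = krull_dim Q" by (simp add: cohen_macaulay_iff)
  obtain W where W: "W \<in> D" using D(2) by blast
  have len: "length xs + r < card V" if xs: "regular_sequence Q xs" "set xs \<subseteq> m_ideal" for xs
  proof -
    obtain fs where fs: "set fs \<subseteq> P" "xs = map \<pi> fs" using regular_sequence_lift[OF xs(1)] .
    have "wreg fs P J" using xs(1) regular_sequence_iff[OF fs(1)] fs(2) by simp
    moreover have "\<exists>t. f ^ t \<in> span_mod V (param U) P J" if "f \<in> set fs" for f
      using m_ideal_radical[of f U] fs xs(2) that by auto
    ultimately have "length fs + r < card V"
      using obstruction_bound[OF finite_V ob, of fs] D(1) fs(1) unfolding \<Delta> by blast
    then show ?thesis using fs(2) by simp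
  qed
  have "r < card V"
  proof -
    have "card U \<le> card V" using ob(1) finite_V by (rule card_mono[rotated])
    moreover have "r < card U" using ob(2) unfolding obstruction_def by auto
    ultimately show ?thesis by simp
  qed
  have "depth Q m_ideal \<le> enat (card V - r - 1)"
  proof (rule depth_le)
    fix xs assume "regular_sequence Q xs" "set xs \<subseteq> m_ideal"
    then show "length xs \<le> card V - r - 1" using len by fastforce
  qed
  moreover have "enat (card V - r) \<le> krull_dim Q"
  proof -
    have "V - W \<in> \<Delta>" unfolding \<Delta> in_co_complex using W by blast
    moreover have "card (V - W) = card V - r"
      using D(1)[OF W] finite_V finite_subset by (metis card_Diff_subset)
    ultimately show ?thesis using krull_dim_ge by metis
  qed
  ultimately have "enat (card V - r) \<le> enat (card V - r - 1)" using eq by (metis order_trans)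
  then show False using \<open>r < card V\<close> by simp
qed

end

section \<open>Equivalence of the five conditions for the grid\<close>

theorem theorem4p16:
  fixes n r :: nat and G :: "(nat \<times> nat) ugraph"
  assumes "n \<ge> 3" and "r \<ge> 2"
    and "G = cartesian_product (path_graph n) (path_graph 3)"
  shows "(vertex_decomposable (Sigma_complex r G) \<longleftrightarrow> shellable (Sigma_complex r G)) \<and>
         (shellable (Sigma_complex r G) \<longleftrightarrow>
            cohen_macaulay_complex TYPE('k::field) (verts G) (Sigma_complex r G)) \<and>
         (cohen_macaulay_complex TYPE('k) (verts G) (Sigma_complex r G) \<longleftrightarrow> 2 * n \<le> r) \<and>
         (2 * n \<le> r \<longleftrightarrow> co_chordal_clutter (verts G) r (Con r G))"
proof -
  define V where "V = verts G"
  define D where "D = Con r G"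
  define \<Delta> where "\<Delta> = Sigma_complex r G"
  have G: "G = grid n" using assms(3) .
  have \<Delta>: "\<Delta> = co_complex V D" by (simp add: \<Delta>_def Sigma_complex_def co_complex_def V_def D_def)
  have finV: "finite V" by (simp add: V_def G verts_grid)
  have D: "W \<subseteq> V \<and> card W = r" if "W \<in> D" for W using that by (simp add: D_def Con_def V_def)
  have faces: "\<Delta> \<subseteq> Pow V" by (auto simp: \<Delta> in_co_complex)
  have simp: "simplicial \<Delta>" unfolding \<Delta> by (rule simplicial_co_complex)
  have fin: "finite \<Delta>" "\<And>F. F \<in> \<Delta> \<Longrightarrow> finite F"
    using faces finV finite_subset by (blast, blast)
  interpret face_ring_linorder V \<Delta> "poly_ring V :: ((nat \<times> nat), 'k) mpoly ring"
    by unfold_locales (use finV faces simp in auto)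
  have cardF: "card (V - W) = card V - r" if "W \<in> D" for W
    using D[OF that] finV finite_subset by (metis card_Diff_subset)
  have facet: "finite F \<and> card F = card V - r" if F: "F \<in> facets \<Delta>" for F
  proof -
    obtain W where W: "W \<in> D" "F \<subseteq> V - W" using F by (auto simp: facets_def \<Delta> in_co_complex)
    then have "V - W \<in> \<Delta>" by (auto simp: \<Delta> in_co_complex)
    then have "F = V - W" using F W by (auto simp: facets_def)
    then show ?thesis using cardF[OF W(1)] finV by simp
  qed
  have VD_sh: "vertex_decomposable \<Delta> \<Longrightarrow> shellable \<Delta>"
    using vertex_decomposable_imp_shellable fin simp by blast
  have sh_CM: "cohen_macaulay_complex TYPE('k) V \<Delta>" if "shellable \<Delta>"
  proof (cases "\<Delta> = {}")
    case True
    then show ?thesis by (rule cohen_macaulay_void)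
  next
    case False
    then obtain F where "F \<in> facets \<Delta>" using face_in_facet fin by blast
    then have F: "F \<in> \<Delta>" "card F = card V - r" using facet by (auto simp: facets_def)
    have "card A \<le> card V - r" if "A \<in> \<Delta>" for A
      using face_in_facet[OF fin(1) that] facet card_mono by metis
    moreover have "shelled (card V - r) \<Delta>"
      using that shelling_imp_shelled[OF _ fin(1) simp facet] by (auto simp: shellable_def)
    ultimately show ?thesis using cohen_macaulay_shelled F by blast
  qed
  have pos: "vertex_decomposable \<Delta>" "co_chordal_clutter V r D" if "2 * n \<le> r"
  proof -
    have shed: "shed_family V D"
      using shed_family_Con_grid[OF that] assms(1) by (simp add: V_def D_def G)
    show "vertex_decomposable \<Delta>"
      unfolding \<Delta> using vertex_decomposable_co_complex[OF shed finV] D by blast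
    show "co_chordal_clutter V r D" by (rule co_chordal_clutter_shed_family[OF shed finV D])
  qed
  have neg: "\<not> cohen_macaulay_complex TYPE('k) V \<Delta>" "\<not> co_chordal_clutter V r D" if "r < 2 * n"
  proof -
    \<comment> \<open>Coefficients are taken in \<open>'k\<close>, the field of the face ring, so
      that the class can enter its Koszul complex.\<close>
    have "\<exists>U \<subseteq> V. \<exists>c :: (nat \<times> nat) set \<Rightarrow> 'k. obstruction U r D c"
      using grid_obstruction_rows[of r n] grid_obstruction_cycle[of n r] assms(1,2) that
      by (cases "r \<le> n") (auto simp: V_def D_def G)
    then obtain U and c :: "(nat \<times> nat) set \<Rightarrow> 'k" where U: "U \<subseteq> V" "obstruction U r D c" by blast
    have "D \<noteq> {}"
    proof
      assume "D = {}"
      then have "co_complex U {W \<in> D. W \<subseteq> U} = {}" by (auto simp: in_co_complex)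
      then show False using U(2) unfolding obstruction_def by auto
    qed
    then show "\<not> cohen_macaulay_complex TYPE('k) V \<Delta>"
      using not_cohen_macaulay_obstruction[OF \<Delta> D _ U] by blast
    show "\<not> co_chordal_clutter V r D"
      using not_co_chordal_obstruction[OF U(2) finV U(1)] assms(2) D by simp
  qed
  \<comment> \<open>If \<open>2 * n \<le> r\<close>, everything follows from vertex decomposability
    and co-chordality. Otherwise \<open>neg\<close> refutes the last condition and the
    Cohen-Macaulay property, and with it shellability and vertex decomposability.\<close>
  show ?thesis
    unfolding V_def[symmetric] D_def[symmetric] \<Delta>_def[symmetric]
    using VD_sh sh_CM pos neg by (cases "2 * n \<le> r") auto
qed

end
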